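(* Let $E=(E^0,E^1,s,r)$ be a graph, $K$ a field, and $\varphi$ a graded $K$-algebra automorphism of the Leavitt path algebra $L_K(E)$ fixing all vertices (i.e. $\varphi(v)=v$ for all $v\in E^0$). Then there exists a graded injective homomorphism $\Psi\colon L_K(E)\to L_K(E)^{\varphi}$ of $K$-algebras, where $L_K(E)^\varphi$ is the Zhang twist of $L_K(E)$ by $\varphi$, satisfying $$\Psi(v)=v\quad(v\in E^0),\qquad \Psi(e)=e,\qquad \Psi(e^* )=\varphi^{-1}(e^* )\quad(e\in E^1).$$ If, in addition, $E^0$ is finite, then $\Psi$ is a unital $K$-algebra homomorphism.
   Context: A graph $E=(E^0,E^1,s,r)$ consists of disjoint sets $E^0$ (vertices) and $E^1$ (edges), of arbitrary cardinality, and maps $s,r\colon E^1\to E^0$ (source and range). A regular vertex is $v\in E^0$ with $0<|s^{-1}(v)|<\infty$. The Leavitt path algebra $L_K(E)$ is the (not necessarily unital) associative $K$-algebra generated by $E^0\cup E^1\cup\{e^*\mid e\in E^1\}$ subject to, for all $v,w\in E^0$, $e,f\in E^1$: (1) $vw=\delta_{v,w}w$; (2) $s(e)e=e=er(e)$ and $e^*s(e)=e^*=r(e)e^*$; (3) $e^*f=\delta_{e,f}r(e)$; (4) $v=\sum_{e\in s^{-1}(v)}ee^*$ for every regular vertex $v$. It is $\mathbb Z$-graded by $\deg v=0$, $\deg e=1$, $\deg e^*=-1$. If $E^0$ is finite, its identity is $\sum_{v\in E^0}v$. Zhang twist by a graded automorphism: if $A=\bigoplus_{n\in\mathbb Z}A_n$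 is a $\mathbb Z$-graded $K$-algebra and $\varphi$ a graded $K$-algebra automorphism of $A$, then $A^\varphi$ is the graded $K$-algebra with the same underlying graded $K$-vector space as $A$ and multiplication $a\star b=a\,\varphi^m(b)$ for $a\in A_m$, $b\in A$ ($m\in\mathbb Z$). *)

theory Defs
  imports "HOL-Algebra.Module" "HOL-Algebra.QuotRing" "Graph_Theory.Digraph"
begin

section \<open>Graded algebras and their homomorphisms\<close>

text \<open>Algebras here are associative but neither commutative nor, in general, unital; the field
  \<open>one\<close> of the record carries no information unless an identity exists.\<close>

record ('k, 'a) graded_algebra = "('k, 'a) module" +
  homog :: "int \<Rightarrow> 'a set"

definition algebra_hom ::
    "('k, 'm) ring_scheme \<Rightarrow> ('k, 'a, 'n) module_scheme \<Rightarrow> ('k, 'b, 'o) module_scheme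
      \<Rightarrow> ('a \<Rightarrow> 'b) set" where
  "algebra_hom K A B =
    {f \<in> carrier A \<rightarrow> carrier B.
      (\<forall>x\<in>carrier A. \<forall>y\<in>carrier A. f (x \<oplus>\<^bsub>A\<^esub> y) = f x \<oplus>\<^bsub>B\<^esub> f y) \<and>
      (\<forall>x\<in>carrier A. \<forall>y\<in>carrier A. f (x \<otimes>\<^bsub>A\<^esub> y) = f x \<otimes>\<^bsub>B\<^esub> f y) \<and>
      (\<forall>k\<in>carrier K. \<forall>x\<in>carrier A. f (k \<odot>\<^bsub>A\<^esub> x) = k \<odot>\<^bsub>B\<^esub> f x)}"

definition is_identity :: "('k, 'a, 'n) module_scheme \<Rightarrow> 'a \<Rightarrow> bool" where
  "is_identity A u \<longleftrightarrow>
    u \<in> carrier A \<and> (\<forall>x\<in>carrier A. u \<otimes>\<^bsub>A\<^esub> x = x \<and> x \<otimes>\<^bsub>A\<^esub> u = x)"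

definition unital_algebra_hom ::
    "('k, 'm) ring_scheme \<Rightarrow> ('k, 'a, 'n) module_scheme \<Rightarrow> ('k, 'b, 'o) module_scheme
      \<Rightarrow> ('a \<Rightarrow> 'b) set" where
  "unital_algebra_hom K A B =
    {f \<in> algebra_hom K A B.
      is_identity A \<one>\<^bsub>A\<^esub> \<and> is_identity B \<one>\<^bsub>B\<^esub> \<and> f \<one>\<^bsub>A\<^esub> = \<one>\<^bsub>B\<^esub>}"

definition graded_algebra_hom ::
    "('k, 'm) ring_scheme \<Rightarrow> ('k, 'a, 'n) graded_algebra_scheme
      \<Rightarrow> ('k, 'b, 'o) graded_algebra_scheme \<Rightarrow> ('a \<Rightarrow> 'b) set" where
  "graded_algebra_hom K A B =
    {f \<in> algebra_hom K A B. \<forall>n. f ` homog A n \<subseteq> homog B n}"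

definition graded_algebra_aut ::
    "('k, 'm) ring_scheme \<Rightarrow> ('k, 'a, 'n) graded_algebra_scheme \<Rightarrow> ('a \<Rightarrow> 'a) set" where
  "graded_algebra_aut K A =
    {f \<in> graded_algebra_hom K A A. bij_betw f (carrier A) (carrier A)}"

section \<open>Zhang twists\<close>

definition homog_components :: "('k, 'a, 'n) graded_algebra_scheme \<Rightarrow> 'a \<Rightarrow> int \<Rightarrow> 'a" where
  "homog_components A a =
    (THE c. (\<forall>n. c n \<in> homog A n) \<and> finite {n. c n \<noteq> \<zero>\<^bsub>A\<^esub>} \<and>
      a = (\<Oplus>\<^bsub>A\<^esub>n\<in>{n. c n \<noteq> \<zero>\<^bsub>A\<^esub>}. c n))"

definition aut_power :: "('k, 'a, 'n) module_scheme \<Rightarrow> ('a \<Rightarrow> 'a) \<Rightarrow> int \<Rightarrow> 'a \<Rightarrow> 'a" where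
  "aut_power A f m =
    (if 0 \<le> m then f ^^ nat m else inv_into (carrier A) f ^^ nat (- m))"

text \<open>The rule \<open>a \<star> b = a \<phi>\<^sup>m(b)\<close> for \<open>a\<close> homogeneous of degree \<open>m\<close>, extended additively in
  \<open>a\<close>. An identity of the algebra is also one of the twist, so \<open>one\<close> is kept.\<close>

definition zhang_twist ::
    "('k, 'a, 'n) graded_algebra_scheme \<Rightarrow> ('a \<Rightarrow> 'a) \<Rightarrow> ('k, 'a, 'n) graded_algebra_scheme" where
  "zhang_twist A \<phi> = A\<lparr>mult := (\<lambda>a b.
    \<Oplus>\<^bsub>A\<^esub>m\<in>{m. homog_components A a m \<noteq> \<zero>\<^bsub>A\<^esub>}.
      homog_components A a m \<otimes>\<^bsub>A\<^esub> aut_power A \<phi> m b)\<rparr>"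

section \<open>Free algebras and quotients by ideals\<close>

text \<open>The free non-unital algebra on \<open>X\<close>: finitely supported functions on the non-empty words over
  \<open>X\<close>, multiplied by convolution. Its \<open>one\<close> is the empty word, which lies outside the carrier.\<close>

definition word :: "('k, 'm) ring_scheme \<Rightarrow> 'x list \<Rightarrow> 'x list \<Rightarrow> 'k" where
  "word K w = (\<lambda>u. if u = w then \<one>\<^bsub>K\<^esub> else \<zero>\<^bsub>K\<^esub>)"

definition free_algebra ::
    "('k, 'm) ring_scheme \<Rightarrow> 'x set \<Rightarrow> ('k, 'x list \<Rightarrow> 'k) module" where
  "free_algebra K X =
    \<lparr>carrier = {f. (\<forall>w. f w \<in> carrier K) \<and> finite {w. f w \<noteq> \<zero>\<^bsub>K\<^esub>} \<and>
                   (\<forall>w. f w \<noteq> \<zero>\<^bsub>K\<^esub> \<longrightarrow> w \<noteq> [] \<and> set w \<subseteq> X)},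
     mult = (\<lambda>f g w. \<Oplus>\<^bsub>K\<^esub>i\<in>{..length w}. f (take i w) \<otimes>\<^bsub>K\<^esub> g (drop i w)),
     one = word K [],
     zero = (\<lambda>w. \<zero>\<^bsub>K\<^esub>),
     add = (\<lambda>f g w. f w \<oplus>\<^bsub>K\<^esub> g w),
     smult = (\<lambda>k f w. k \<otimes>\<^bsub>K\<^esub> f w)\<rparr>"

text \<open>In the absence of an identity, closure under scalars has to be required separately.\<close>

definition algebra_ideal ::
    "('k, 'm) ring_scheme \<Rightarrow> ('k, 'a) module \<Rightarrow> 'a set \<Rightarrow> bool" where
  "algebra_ideal K A I \<longleftrightarrow> submodule I K A \<and>
    (\<forall>a\<in>I. \<forall>x\<in>carrier A. x \<otimes>\<^bsub>A\<^esub> a \<in> I \<and> a \<otimes>\<^bsub>A\<^esub> x \<in> I)"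

definition generated_ideal ::
    "('k, 'm) ring_scheme \<Rightarrow> ('k, 'a) module \<Rightarrow> 'a set \<Rightarrow> 'a set" where
  "generated_ideal K A S = \<Inter>{I. algebra_ideal K A I \<and> S \<subseteq> I}"

section \<open>Leavitt path algebras\<close>

datatype ('v, 'e) lpa_generator = Vertex 'v | Edge 'e | Ghost 'e

definition lpa_generators :: "('v, 'e) pre_digraph \<Rightarrow> ('v, 'e) lpa_generator set" where
  "lpa_generators E = Vertex ` verts E \<union> Edge ` arcs E \<union> Ghost ` arcs E"

abbreviation lpa_free ::
    "('k, 'm) ring_scheme \<Rightarrow> ('v, 'e) pre_digraph
      \<Rightarrow> ('k, ('v, 'e) lpa_generator list \<Rightarrow> 'k) module" where
  "lpa_free K E \<equiv> free_algebra K (lpa_generators E)"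

definition regular_vertex :: "('v, 'e) pre_digraph \<Rightarrow> 'v \<Rightarrow> bool" where
  "regular_vertex E v \<longleftrightarrow> v \<in> verts E \<and> finite (out_arcs E v) \<and> out_arcs E v \<noteq> {}"

text \<open>A pair stands for the equation between its two components.\<close>

definition lpa_relations ::
    "('k, 'm) ring_scheme \<Rightarrow> ('v, 'e) pre_digraph
      \<Rightarrow> ((('v, 'e) lpa_generator list \<Rightarrow> 'k) \<times> (('v, 'e) lpa_generator list \<Rightarrow> 'k)) set" where
  "lpa_relations K E =
     {(word K [Vertex v, Vertex w],
       if v = w then word K [Vertex w] else \<zero>\<^bsub>lpa_free K E\<^esub>) | v w. v \<in> verts E \<and> w \<in> verts E}
   \<union> {(word K [Vertex (tail E e), Edge e], word K [Edge e]) | e. e \<in> arcs E}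
   \<union> {(word K [Edge e, Vertex (head E e)], word K [Edge e]) | e. e \<in> arcs E}
   \<union> {(word K [Ghost e, Vertex (tail E e)], word K [Ghost e]) | e. e \<in> arcs E}
   \<union> {(word K [Vertex (head E e), Ghost e], word K [Ghost e]) | e. e \<in> arcs E}
   \<union> {(word K [Ghost e, Edge f],
       if e = f then word K [Vertex (head E e)] else \<zero>\<^bsub>lpa_free K E\<^esub>) | e f.
         e \<in> arcs E \<and> f \<in> arcs E}
   \<union> {(word K [Vertex v], \<Oplus>\<^bsub>lpa_free K E\<^esub>e\<in>out_arcs E v. word K [Edge e, Ghost e]) | v.
         regular_vertex E v}"

definition lpa_ideal ::
    "('k, 'm) ring_scheme \<Rightarrow> ('v, 'e) pre_digraph \<Rightarrow> (('v, 'e) lpa_generator list \<Rightarrow> 'k) set" where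
  "lpa_ideal K E =
    generated_ideal K (lpa_free K E) {x \<ominus>\<^bsub>lpa_free K E\<^esub> y | x y. (x, y) \<in> lpa_relations K E}"

definition lpa_class ::
    "('k, 'm) ring_scheme \<Rightarrow> ('v, 'e) pre_digraph \<Rightarrow> (('v, 'e) lpa_generator list \<Rightarrow> 'k)
      \<Rightarrow> (('v, 'e) lpa_generator list \<Rightarrow> 'k) set" where
  "lpa_class K E f = lpa_ideal K E +>\<^bsub>lpa_free K E\<^esub> f"

fun generator_degree :: "('v, 'e) lpa_generator \<Rightarrow> int" where
  "generator_degree (Vertex v) = 0"
| "generator_degree (Edge e) = 1"
| "generator_degree (Ghost e) = -1"

definition word_degree :: "('v, 'e) lpa_generator list \<Rightarrow> int" where
  "word_degree w = sum_list (map generator_degree w)"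

text \<open>The quotient of the free algebra by the ideal of relations. The sum of the vertices is the
  identity if there are finitely many of them; otherwise \<^const>\<open>finsum\<close> gives the junk value
  zero.\<close>

definition leavitt_path_algebra ::
    "('k, 'm) ring_scheme \<Rightarrow> ('v, 'e) pre_digraph
      \<Rightarrow> ('k, (('v, 'e) lpa_generator list \<Rightarrow> 'k) set) graded_algebra" where
  "leavitt_path_algebra K E =
    \<lparr>carrier = a_rcosets\<^bsub>lpa_free K E\<^esub> (lpa_ideal K E),
     mult = rcoset_mult (lpa_free K E) (lpa_ideal K E),
     one = lpa_class K E (\<Oplus>\<^bsub>lpa_free K E\<^esub>v\<in>verts E. word K [Vertex v]),
     zero = lpa_ideal K E,
     add = set_add (lpa_free K E),
     smult = (\<lambda>k C. \<Union>f\<in>C. lpa_class K E (k \<odot>\<^bsub>lpa_free K E\<^esub> f)),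
     homog = (\<lambda>n. lpa_class K E `
       {f \<in> carrier (lpa_free K E). \<forall>w. f w \<noteq> \<zero>\<^bsub>K\<^esub> \<longrightarrow> word_degree w = n})\<rparr>"

definition lpa_vertex ::
    "('k, 'm) ring_scheme \<Rightarrow> ('v, 'e) pre_digraph \<Rightarrow> 'v
      \<Rightarrow> (('v, 'e) lpa_generator list \<Rightarrow> 'k) set" where
  "lpa_vertex K E v = lpa_class K E (word K [Vertex v])"

definition lpa_edge ::
    "('k, 'm) ring_scheme \<Rightarrow> ('v, 'e) pre_digraph \<Rightarrow> 'e
      \<Rightarrow> (('v, 'e) lpa_generator list \<Rightarrow> 'k) set" where
  "lpa_edge K E e = lpa_class K E (word K [Edge e])"

definition lpa_ghost ::
    "('k, 'm) ring_scheme \<Rightarrow> ('v, 'e) pre_digraph \<Rightarrow> 'e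
      \<Rightarrow> (('v, 'e) lpa_generator list \<Rightarrow> 'k) set" where
  "lpa_ghost K E e = lpa_class K E (word K [Ghost e])"

end

theory Submission
  imports Defs
begin

text \<open>
  Write \<open>\<star>\<close> for the product of the twist, \<open>L\<close> for the Leavitt path algebra and \<open>L\<^sub>0\<close> for its
  component of degree zero. The elements \<open>v\<close>, \<open>e\<close>, \<open>\<phi>\<inverse>(e*)\<close> satisfy the Leavitt path algebra
  relations with respect to \<open>\<star>\<close>: as \<open>e\<close> has degree \<open>1\<close> and \<open>e*\<close> has degree \<open>-1\<close>,
  \<open>\<phi>\<inverse>(e*) \<star> f = \<phi>\<inverse>(e* f)\<close> and \<open>e \<star> \<phi>\<inverse>(e*) = e e*\<close>, and \<open>\<phi>\<close> fixes the vertices on the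
  right-hand sides (\<open>twisted_family\<close>). The universal property of \<open>L\<close>
  (\<open>lpa_universal_property\<close>) therefore gives \<open>\<Psi>\<close>, and \<open>\<Psi>\<close> is graded because the images
  of the generators are homogeneous of the right degrees.

  For injectivity, the twist has the same homogeneous components as \<open>L\<close>, so the kernel of
  \<open>\<Psi>\<close> is a graded ideal and it suffices to treat a homogeneous \<open>x\<close> in it. Let \<open>p\<^sub>S\<close> be the sum
  of \<open>e e*\<close> over a finite set \<open>S\<close> of edges. If \<open>x\<close> has positive degree then \<open>x = p\<^sub>S x\<close> for
  some \<open>S\<close>, and each \<open>e* x\<close> is an element of the kernel of smaller degree; induction gives
  \<open>e* x = 0\<close> and hence \<open>x = 0\<close>. Negative degrees are symmetric, with \<open>x = x p\<^sub>S\<close>.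

  In degree zero, \<open>L\<^sub>0\<close> is the increasing union of the spans of the products of a path of length
  \<open>i \<le> n\<close> with a ghost path of length \<open>i\<close>; these spans are the levels below. Induction on the level
  \<open>n\<close> of \<open>x\<close> works because passing to a corner \<open>e* x f\<close> lowers the level and stays in the kernel,
  so that all corners of \<open>x\<close> vanish and \<open>p\<^sub>S x p\<^sub>S = 0\<close> for every \<open>S\<close>. Now \<open>x = c + d\<close> with \<open>c\<close> a
  combination of vertices and \<open>d = p\<^sub>S d p\<^sub>S\<close> for a suitable \<open>S\<close>, whence \<open>x = c - p\<^sub>S c p\<^sub>S\<close>.
  But \<open>\<Psi>\<close> fixes \<open>c\<close> and \<open>p\<^sub>S\<close> and is multiplicative for the untwisted product on \<open>\<Psi>\<close>-fixed
  elements of \<open>L\<^sub>0\<close>, so it fixes \<open>x\<close>, and \<open>x = \<Psi>(x) = 0\<close> (\<open>kernel_level\<close>).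

  Two general
  facts about \<open>L\<close> support the argument: the ideal of relations is homogeneous, so that \<open>L\<close> is graded
  (\<open>ideal_homogeneous\<close>, \<open>lpa_graded\<close>), and \<open>L\<close> is spanned by products of a path with a ghost
  path (\<open>word_monomial\<close>).
\<close>


section \<open>Associative algebras without identity\<close>

text \<open>The ring locales of the algebra hierarchy include an identity, so associative algebras without
  one are modules with a bilinear associative product.\<close>

locale assoc_algebra = Module.module K A for K (structure) and A (structure) +
  assumes mult_closed [simp, intro]:
      "\<lbrakk>x \<in> carrier A; y \<in> carrier A\<rbrakk> \<Longrightarrow> x \<otimes>\<^bsub>A\<^esub> y \<in> carrier A"
    and mult_assoc:
      "\<lbrakk>x \<in> carrier A; y \<in> carrier A; z \<in> carrier A\<rbrakk>
        \<Longrightarrow> (x \<otimes>\<^bsub>A\<^esub> y) \<otimes>\<^bsub>A\<^esub> z = x \<otimes>\<^bsub>A\<^esub> (y \<otimes>\<^bsub>A\<^esub> z)"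
    and mult_l_distr:
      "\<lbrakk>x \<in> carrier A; y \<in> carrier A; z \<in> carrier A\<rbrakk>
        \<Longrightarrow> (x \<oplus>\<^bsub>A\<^esub> y) \<otimes>\<^bsub>A\<^esub> z = x \<otimes>\<^bsub>A\<^esub> z \<oplus>\<^bsub>A\<^esub> y \<otimes>\<^bsub>A\<^esub> z"
    and mult_r_distr:
      "\<lbrakk>x \<in> carrier A; y \<in> carrier A; z \<in> carrier A\<rbrakk>
        \<Longrightarrow> z \<otimes>\<^bsub>A\<^esub> (x \<oplus>\<^bsub>A\<^esub> y) = z \<otimes>\<^bsub>A\<^esub> x \<oplus>\<^bsub>A\<^esub> z \<otimes>\<^bsub>A\<^esub> y"
    and mult_smult_left:
      "\<lbrakk>k \<in> carrier K; x \<in> carrier A; y \<in> carrier A\<rbrakk>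
        \<Longrightarrow> (k \<odot>\<^bsub>A\<^esub> x) \<otimes>\<^bsub>A\<^esub> y = k \<odot>\<^bsub>A\<^esub> (x \<otimes>\<^bsub>A\<^esub> y)"
    and mult_smult_right:
      "\<lbrakk>k \<in> carrier K; x \<in> carrier A; y \<in> carrier A\<rbrakk>
        \<Longrightarrow> x \<otimes>\<^bsub>A\<^esub> (k \<odot>\<^bsub>A\<^esub> y) = k \<odot>\<^bsub>A\<^esub> (x \<otimes>\<^bsub>A\<^esub> y)"

lemma abelian_group_homI_additive:
  assumes "abelian_group G" "abelian_group H" "h \<in> carrier G \<rightarrow> carrier H"
    and "\<And>x y. \<lbrakk>x \<in> carrier G; y \<in> carrier G\<rbrakk> \<Longrightarrow> h (x \<oplus>\<^bsub>G\<^esub> y) = h x \<oplus>\<^bsub>H\<^esub> h y"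
  shows "abelian_group_hom G H h"
  by (rule abelian_group_homI)
     (use assms in \<open>auto simp: group_hom_def group_hom_axioms_def hom_def abelian_group.a_group\<close>)

lemma (in abelian_group_hom) hom_finsum:
  "g \<in> S \<rightarrow> carrier G \<Longrightarrow> h (finsum G g S) = finsum H (\<lambda>i. h (g i)) S"
proof (induction S rule: infinite_finite_induct)
  case (insert a S)
  then have "g a \<in> carrier G" "g \<in> S \<rightarrow> carrier G" "(\<lambda>i. h (g i)) \<in> S \<rightarrow> carrier H"
    by (auto simp: Pi_iff)
  with insert show ?case
    by (simp add: G.finsum_insert H.finsum_insert)
qed (simp_all add: G.finsum_infinite H.finsum_infinite)

lemma (in abelian_group_hom) injI:
  assumes "\<And>x. \<lbrakk>x \<in> carrier G; h x = \<zero>\<^bsub>H\<^esub>\<rbrakk> \<Longrightarrow> x = \<zero>\<^bsub>G\<^esub>"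
  shows "inj_on h (carrier G)"
proof (rule inj_onI)
  fix x y assume xy: "x \<in> carrier G" "y \<in> carrier G" "h x = h y"
  then have "h (x \<ominus>\<^bsub>G\<^esub> y) = \<zero>\<^bsub>H\<^esub>" by (simp add: G.minus_eq H.r_neg)
  then have "x \<ominus>\<^bsub>G\<^esub> y = \<zero>\<^bsub>G\<^esub>" using xy assms by blast
  then show "x = y" using xy by (simp add: G.minus_eq G.add.inv_solve_right')
qed

lemma (in abelian_monoid) finsum_superset:
  assumes "finite T" "S \<subseteq> T" "\<And>i. i \<in> T - S \<Longrightarrow> f i = \<zero>" "f \<in> T \<rightarrow> carrier G"
  shows "finsum G f S = finsum G f T"
  by (rule add.finprod_mono_neutral_cong_left) (use assms in \<open>auto\<close>)

context assoc_algebra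
begin

lemma right_mult_hom: "y \<in> carrier A \<Longrightarrow> abelian_group_hom A A (\<lambda>x. x \<otimes>\<^bsub>A\<^esub> y)"
  by (rule abelian_group_homI_additive) (auto simp: mult_l_distr M.abelian_group_axioms)

lemma left_mult_hom: "y \<in> carrier A \<Longrightarrow> abelian_group_hom A A (\<lambda>x. y \<otimes>\<^bsub>A\<^esub> x)"
  by (rule abelian_group_homI_additive) (auto simp: mult_r_distr M.abelian_group_axioms)

lemma mult_zero_left [simp]: "y \<in> carrier A \<Longrightarrow> \<zero>\<^bsub>A\<^esub> \<otimes>\<^bsub>A\<^esub> y = \<zero>\<^bsub>A\<^esub>"
  using abelian_group_hom.hom_zero[OF right_mult_hom] .

lemma mult_zero_right [simp]: "y \<in> carrier A \<Longrightarrow> y \<otimes>\<^bsub>A\<^esub> \<zero>\<^bsub>A\<^esub> = \<zero>\<^bsub>A\<^esub>"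
  using abelian_group_hom.hom_zero[OF left_mult_hom] .

lemma scalar_minus_one: "x \<in> carrier A \<Longrightarrow> (\<ominus> \<one>) \<odot>\<^bsub>A\<^esub> x = \<ominus>\<^bsub>A\<^esub> x"
  by (simp add: smult_l_minus)

lemmas finsum_mult_left = abelian_group_hom.hom_finsum[OF right_mult_hom]
lemmas finsum_mult_right = abelian_group_hom.hom_finsum[OF left_mult_hom]

end

lemma algebra_homD:
  assumes "f \<in> algebra_hom K A B"
  shows "f \<in> carrier A \<rightarrow> carrier B"
    and "x \<in> carrier A \<Longrightarrow> f x \<in> carrier B"
    and "\<lbrakk>x \<in> carrier A; y \<in> carrier A\<rbrakk> \<Longrightarrow> f (x \<oplus>\<^bsub>A\<^esub> y) = f x \<oplus>\<^bsub>B\<^esub> f y"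
    and "\<lbrakk>x \<in> carrier A; y \<in> carrier A\<rbrakk> \<Longrightarrow> f (x \<otimes>\<^bsub>A\<^esub> y) = f x \<otimes>\<^bsub>B\<^esub> f y"
    and "\<lbrakk>k \<in> carrier K; x \<in> carrier A\<rbrakk> \<Longrightarrow> f (k \<odot>\<^bsub>A\<^esub> x) = k \<odot>\<^bsub>B\<^esub> f x"
  using assms by (auto simp: algebra_hom_def)

lemma algebra_hom_additive:
  assumes "f \<in> algebra_hom K A B" "abelian_group A" "abelian_group B"
  shows "abelian_group_hom A B f"
  using assms by (intro abelian_group_homI_additive) (auto simp: algebra_hom_def)

text \<open>All axioms are equations between elements that lift along the surjection. This is how quotients
  become algebras; the target is only assumed to be a record of operations.\<close>

lemma assoc_algebra_image:
  assumes F: "assoc_algebra K F" and q: "q \<in> algebra_hom K F A"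
    and surj: "q ` carrier F = carrier A" and zero: "q \<zero>\<^bsub>F\<^esub> = \<zero>\<^bsub>A\<^esub>"
  shows "assoc_algebra K A"
proof -
  interpret F: assoc_algebra K F by (fact F)
  note hom = algebra_homD[OF q]
  have lift: "\<exists>x\<in>carrier F. a = q x" if "a \<in> carrier A" for a
    using that surj by auto
  have ag: "abelian_group A"
  proof (rule abelian_groupI)
    fix x assume "x \<in> carrier A"
    then obtain x' where x': "x' \<in> carrier F" "x = q x'" using lift by blast
    then have "q (\<ominus>\<^bsub>F\<^esub> x') \<oplus>\<^bsub>A\<^esub> x = \<zero>\<^bsub>A\<^esub>"
      by (simp add: hom(3)[symmetric] F.M.l_neg zero)
    then show "\<exists>y\<in>carrier A. y \<oplus>\<^bsub>A\<^esub> x = \<zero>\<^bsub>A\<^esub>" using x' hom(2) by blast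
    show "\<zero>\<^bsub>A\<^esub> \<oplus>\<^bsub>A\<^esub> x = x" using x' by (simp add: zero[symmetric] hom(3)[symmetric])
  qed (auto dest!: lift simp: hom(2) hom(3)[symmetric] zero[symmetric] F.M.a_ac)
  show ?thesis
  proof (intro assoc_algebra.intro moduleI F.is_cring ag assoc_algebra_axioms.intro)
  qed (auto dest!: lift simp: hom(2) hom(3-5)[symmetric] F.smult_l_distr F.smult_r_distr
        F.smult_assoc1 F.mult_assoc F.mult_l_distr F.mult_r_distr F.mult_smult_left F.mult_smult_right)
qed


section \<open>Free algebras\<close>

text \<open>Both sides sum over the pairs with \<open>i + j \<le> n\<close>. For convolution, a pair of cut positions
  splits a word into three factors, and the two orders of summation are the two bracketings.\<close>

lemma (in abelian_monoid) finsum_triangle_swap: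
  fixes h :: "nat \<Rightarrow> nat \<Rightarrow> 'a"
  assumes h: "\<And>i j. h i j \<in> carrier G"
  shows "(\<Oplus>k\<in>{..n}. \<Oplus>i\<in>{..k}. h i (k - i)) = (\<Oplus>i\<in>{..n}. \<Oplus>j\<in>{..n - i}. h i j)"
proof (induction n)
  case (Suc n)
  have "(\<Oplus>i\<in>{..n}. \<Oplus>j\<in>{..Suc n - i}. h i j)
      = (\<Oplus>i\<in>{..n}. h i (Suc n - i) \<oplus> (\<Oplus>j\<in>{..n - i}. h i j))"
    by (rule finsum_cong') (auto simp: h Suc_diff_le)
  also have "\<dots> = (\<Oplus>i\<in>{..n}. h i (Suc n - i)) \<oplus> (\<Oplus>i\<in>{..n}. \<Oplus>j\<in>{..n - i}. h i j)"
    by (rule finsum_addf) (auto simp: h)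
  finally show ?case using Suc by (simp add: h a_ac)
qed (simp add: h)

lemma (in abelian_monoid) finsum_single:
  assumes "finite S" "i \<in> S" "f i \<in> carrier G" "\<And>j. \<lbrakk>j \<in> S; j \<noteq> i\<rbrakk> \<Longrightarrow> f j = \<zero>"
  shows "finsum G f S = f i"
proof -
  have "finsum G f {i} = finsum G f S"
    by (rule finsum_superset) (use assms in \<open>auto, metis zero_closed\<close>)
  then show ?thesis using assms by simp
qed

lemma free_algebra_simps:
  "zero (free_algebra K X) = (\<lambda>w. \<zero>\<^bsub>K\<^esub>)"
  "f \<oplus>\<^bsub>free_algebra K X\<^esub> g = (\<lambda>w. f w \<oplus>\<^bsub>K\<^esub> g w)"
  "k \<odot>\<^bsub>free_algebra K X\<^esub> f = (\<lambda>w. k \<otimes>\<^bsub>K\<^esub> f w)"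
  "f \<otimes>\<^bsub>free_algebra K X\<^esub> g = (\<lambda>w. \<Oplus>\<^bsub>K\<^esub>i\<in>{..length w}. f (take i w) \<otimes>\<^bsub>K\<^esub> g (drop i w))"
  by (simp_all add: free_algebra_def)

lemma free_algebra_carrier_iff:
  "f \<in> carrier (free_algebra K X) \<longleftrightarrow> (\<forall>w. f w \<in> carrier K) \<and> finite {w. f w \<noteq> \<zero>\<^bsub>K\<^esub>} \<and>
     (\<forall>w. f w \<noteq> \<zero>\<^bsub>K\<^esub> \<longrightarrow> w \<noteq> [] \<and> set w \<subseteq> X)"
  by (simp add: free_algebra_def)

lemma free_algebra_carrierD:
  assumes "f \<in> carrier (free_algebra K X)"
  shows "f w \<in> carrier K" "finite {w. f w \<noteq> \<zero>\<^bsub>K\<^esub>}" "f w \<noteq> \<zero>\<^bsub>K\<^esub> \<Longrightarrow> w \<noteq> []"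
    "f w \<noteq> \<zero>\<^bsub>K\<^esub> \<Longrightarrow> set w \<subseteq> X"
  using assms by (auto simp: free_algebra_carrier_iff)

context cring
begin

lemma free_algebra_mult_closed:
  assumes f: "f \<in> carrier (free_algebra R X)" and g: "g \<in> carrier (free_algebra R X)"
  shows "f \<otimes>\<^bsub>free_algebra R X\<^esub> g \<in> carrier (free_algebra R X)"
proof -
  note fD = free_algebra_carrierD[OF f] and gD = free_algebra_carrierD[OF g]
  let ?m = "f \<otimes>\<^bsub>free_algebra R X\<^esub> g"
  have split: "\<exists>i. f (take i w) \<noteq> \<zero> \<and> g (drop i w) \<noteq> \<zero>" if "?m w \<noteq> \<zero>" for w
  proof (rule ccontr)
    assume "\<not> ?thesis"
    then have "f (take i w) \<otimes> g (drop i w) = \<zero>" for i using fD gD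
      by (metis l_null r_null)
    then show False using that by (simp add: free_algebra_simps)
  qed
  have "{w. ?m w \<noteq> \<zero>} \<subseteq> (\<lambda>(u, v). u @ v) ` ({w. f w \<noteq> \<zero>} \<times> {w. g w \<noteq> \<zero>})"
  proof
    fix w assume "w \<in> {w. ?m w \<noteq> \<zero>}"
    with split obtain i where "f (take i w) \<noteq> \<zero>" "g (drop i w) \<noteq> \<zero>" by blast
    then show "w \<in> (\<lambda>(u, v). u @ v) ` ({w. f w \<noteq> \<zero>} \<times> {w. g w \<noteq> \<zero>})"
      by (intro image_eqI[of _ _ "(take i w, drop i w)"]) auto
  qed
  then have "finite {w. ?m w \<noteq> \<zero>}"
    by (rule finite_subset) (use fD gD in auto)
  moreover have "w \<noteq> [] \<and> set w \<subseteq> X" if "?m w \<noteq> \<zero>" for w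
  proof -
    obtain i where i: "f (take i w) \<noteq> \<zero>" "g (drop i w) \<noteq> \<zero>" using split \<open>?m w \<noteq> \<zero>\<close> by blast
    have "set w = set (take i w) \<union> set (drop i w)"
      by (metis append_take_drop_id set_append)
    then show ?thesis using fD(3,4)[OF i(1)] gD(4)[OF i(2)] by auto
  qed
  moreover have "?m w \<in> carrier R" for w using fD gD by (auto simp: free_algebra_simps)
  ultimately show ?thesis by (simp add: free_algebra_carrier_iff)
qed

lemma free_algebra_mult_assoc:
  fixes f g h :: "'x list \<Rightarrow> 'a"
  assumes "\<And>w. f w \<in> carrier R" "\<And>w. g w \<in> carrier R" "\<And>w. h w \<in> carrier R"
  shows "(f \<otimes>\<^bsub>free_algebra R X\<^esub> g) \<otimes>\<^bsub>free_algebra R X\<^esub> h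
    = f \<otimes>\<^bsub>free_algebra R X\<^esub> (g \<otimes>\<^bsub>free_algebra R X\<^esub> h)"
proof
  fix w :: "'x list"
  let ?H = "\<lambda>i j. f (take i w) \<otimes> (g (take j (drop i w)) \<otimes> h (drop (i + j) w))"
  have "((f \<otimes>\<^bsub>free_algebra R X\<^esub> g) \<otimes>\<^bsub>free_algebra R X\<^esub> h) w
      = (\<Oplus>k\<in>{..length w}. \<Oplus>i\<in>{..k}. ?H i (k - i))"
    unfolding free_algebra_simps
  proof (rule finsum_cong')
    fix k assume k: "k \<in> {..length w}"
    have "(\<Oplus>i\<in>{..k}. f (take i (take k w)) \<otimes> g (drop i (take k w))) \<otimes> h (drop k w)
        = (\<Oplus>i\<in>{..k}. f (take i (take k w)) \<otimes> g (drop i (take k w)) \<otimes> h (drop k w))"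
      by (rule finsum_ldistr) (auto simp: assms)
    also have "\<dots> = (\<Oplus>i\<in>{..k}. ?H i (k - i))"
      by (rule finsum_cong') (auto simp: assms m_assoc drop_take min_def)
    finally show "(\<Oplus>i\<in>{..length (take k w)}. f (take i (take k w)) \<otimes> g (drop i (take k w)))
        \<otimes> h (drop k w) = (\<Oplus>i\<in>{..k}. ?H i (k - i))" using k by (simp add: min.absorb2)
  qed (auto simp: assms)
  also have "\<dots> = (\<Oplus>i\<in>{..length w}. \<Oplus>j\<in>{..length w - i}. ?H i j)"
    by (rule finsum_triangle_swap) (auto simp: assms)
  also have "\<dots> = (f \<otimes>\<^bsub>free_algebra R X\<^esub> (g \<otimes>\<^bsub>free_algebra R X\<^esub> h)) w"
    unfolding free_algebra_simps
    by (rule finsum_cong') (auto simp: assms finsum_rdistr add.commute)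
  finally show "((f \<otimes>\<^bsub>free_algebra R X\<^esub> g) \<otimes>\<^bsub>free_algebra R X\<^esub> h) w
      = (f \<otimes>\<^bsub>free_algebra R X\<^esub> (g \<otimes>\<^bsub>free_algebra R X\<^esub> h)) w" .
qed

lemma free_algebra_abelian_group: "abelian_group (free_algebra R X)"
proof (rule abelian_groupI)
  fix f g assume f: "f \<in> carrier (free_algebra R X)" and g: "g \<in> carrier (free_algebra R X)"
  note fD = free_algebra_carrierD[OF f] and gD = free_algebra_carrierD[OF g]
  have "{w. f w \<oplus> g w \<noteq> \<zero>} \<subseteq> {w. f w \<noteq> \<zero>} \<union> {w. g w \<noteq> \<zero>}" by auto
  then have "finite {w. f w \<oplus> g w \<noteq> \<zero>}"
    by (rule finite_subset) (use fD gD in auto)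
  moreover have "w \<noteq> [] \<and> set w \<subseteq> X" if "f w \<oplus> g w \<noteq> \<zero>" for w
    using that fD(3,4)[of w] gD(3,4)[of w] by (cases "f w = \<zero>"; cases "g w = \<zero>") auto
  ultimately show "f \<oplus>\<^bsub>free_algebra R X\<^esub> g \<in> carrier (free_algebra R X)"
    using fD gD by (simp add: free_algebra_carrier_iff free_algebra_simps)
next
  fix f assume f: "f \<in> carrier (free_algebra R X)"
  note fD = free_algebra_carrierD[OF f]
  have "\<ominus> f w = \<zero> \<longleftrightarrow> f w = \<zero>" for w using fD by (metis minus_minus minus_zero)
  then have "(\<lambda>w. \<ominus> f w) \<in> carrier (free_algebra R X)"
    using f by (simp add: free_algebra_carrier_iff)
  then show "\<exists>g\<in>carrier (free_algebra R X). g \<oplus>\<^bsub>free_algebra R X\<^esub> f = \<zero>\<^bsub>free_algebra R X\<^esub>"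
    using fD by (auto simp: free_algebra_simps l_neg intro!: bexI[of _ "\<lambda>w. \<ominus> f w"])
qed (auto simp: free_algebra_carrier_iff free_algebra_simps a_ac)

lemma free_algebra_smult_closed:
  assumes k: "k \<in> carrier R" and f: "f \<in> carrier (free_algebra R X)"
  shows "k \<odot>\<^bsub>free_algebra R X\<^esub> f \<in> carrier (free_algebra R X)"
proof -
  note fD = free_algebra_carrierD[OF f]
  have imp: "f w \<noteq> \<zero>" if "k \<otimes> f w \<noteq> \<zero>" for w using that k by auto
  then have "{w. k \<otimes> f w \<noteq> \<zero>} \<subseteq> {w. f w \<noteq> \<zero>}" by auto
  then have "finite {w. k \<otimes> f w \<noteq> \<zero>}" using fD finite_subset by blast
  then show ?thesis using fD k imp by (auto simp: free_algebra_carrier_iff free_algebra_simps)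
qed

lemma free_algebra_assoc_algebra: "assoc_algebra R (free_algebra R X)"
proof (intro assoc_algebra.intro moduleI assoc_algebra_axioms.intro is_cring
    free_algebra_abelian_group free_algebra_smult_closed free_algebra_mult_closed)
  fix f g h assume "f \<in> carrier (free_algebra R X)" "g \<in> carrier (free_algebra R X)"
    "h \<in> carrier (free_algebra R X)"
  note D = this[THEN free_algebra_carrierD(1)]
  show "(f \<otimes>\<^bsub>free_algebra R X\<^esub> g) \<otimes>\<^bsub>free_algebra R X\<^esub> h
      = f \<otimes>\<^bsub>free_algebra R X\<^esub> (g \<otimes>\<^bsub>free_algebra R X\<^esub> h)"
    by (rule free_algebra_mult_assoc) (use D in auto)
  show "(f \<oplus>\<^bsub>free_algebra R X\<^esub> g) \<otimes>\<^bsub>free_algebra R X\<^esub> h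
      = f \<otimes>\<^bsub>free_algebra R X\<^esub> h \<oplus>\<^bsub>free_algebra R X\<^esub> g \<otimes>\<^bsub>free_algebra R X\<^esub> h"
    using D by (simp add: free_algebra_simps l_distr finsum_addf)
  show "h \<otimes>\<^bsub>free_algebra R X\<^esub> (f \<oplus>\<^bsub>free_algebra R X\<^esub> g)
      = h \<otimes>\<^bsub>free_algebra R X\<^esub> f \<oplus>\<^bsub>free_algebra R X\<^esub> h \<otimes>\<^bsub>free_algebra R X\<^esub> g"
    using D by (simp add: free_algebra_simps r_distr finsum_addf)
next
  fix k f g assume k: "k \<in> carrier R" and
    "f \<in> carrier (free_algebra R X)" "g \<in> carrier (free_algebra R X)"
  note D = this(2,3)[THEN free_algebra_carrierD(1)]
  show "(k \<odot>\<^bsub>free_algebra R X\<^esub> f) \<otimes>\<^bsub>free_algebra R X\<^esub> g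
      = k \<odot>\<^bsub>free_algebra R X\<^esub> (f \<otimes>\<^bsub>free_algebra R X\<^esub> g)"
    using D k by (simp add: free_algebra_simps finsum_rdistr m_assoc)
  show "f \<otimes>\<^bsub>free_algebra R X\<^esub> (k \<odot>\<^bsub>free_algebra R X\<^esub> g)
      = k \<odot>\<^bsub>free_algebra R X\<^esub> (f \<otimes>\<^bsub>free_algebra R X\<^esub> g)"
    using D k by (simp add: free_algebra_simps finsum_rdistr m_lcomm)
qed (auto simp: free_algebra_simps free_algebra_carrierD l_distr r_distr m_assoc)

lemma word_closed [simp]:
  "w \<noteq> [] \<Longrightarrow> set w \<subseteq> X \<Longrightarrow> word R w \<in> carrier (free_algebra R X)"
  by (auto simp: free_algebra_carrier_iff word_def)

lemma word_mult_apply: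
  assumes "\<And>w. f w \<in> carrier R"
  shows "(word R u \<otimes>\<^bsub>free_algebra R X\<^esub> f) w
    = (if take (length u) w = u then f (drop (length u) w) else \<zero>)"
proof (cases "take (length u) w = u")
  case True
  then have le: "length u \<le> length w" by (metis length_take min.absorb_iff2 min.commute)
  have "(\<Oplus>i\<in>{..length w}. word R u (take i w) \<otimes> f (drop i w))
      = word R u (take (length u) w) \<otimes> f (drop (length u) w)"
    by (rule finsum_single) (use le assms in \<open>auto simp: word_def\<close>)
  then show ?thesis using True assms by (simp add: free_algebra_simps word_def)
next
  case False
  have "word R u (take i w) \<otimes> f (drop i w) = \<zero>" if "i \<le> length w" for i
    using False that assms by (auto simp: word_def)
  then have "(\<Oplus>i\<in>{..length w}. word R u (take i w) \<otimes> f (drop i w)) = \<zero>"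
    by (intro add.finprod_one_eqI) auto
  then show ?thesis using False by (simp add: free_algebra_simps)
qed

lemma word_mult_word:
  "word R u \<otimes>\<^bsub>free_algebra R X\<^esub> word R v = word R (u @ v)"
proof
  fix w
  show "(word R u \<otimes>\<^bsub>free_algebra R X\<^esub> word R v) w = word R (u @ v) w"
    by (subst word_mult_apply) (auto simp: word_def, metis append_take_drop_id)
qed

text \<open>The premise \<open>f w \<noteq> \<zero>\<close> in the last case restricts to words in the support of \<open>f\<close>, which lets
  properties of the support, such as homogeneity, be used in the induction.\<close>

lemma free_algebra_induct [consumes 1, case_names zero add word]:
  assumes f: "f \<in> carrier (free_algebra R X)"
    and zero: "P \<zero>\<^bsub>free_algebra R X\<^esub>"
    and add: "\<And>f g. \<lbrakk>f \<in> carrier (free_algebra R X); g \<in> carrier (free_algebra R X); P f; P g\<rbrakk>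
      \<Longrightarrow> P (f \<oplus>\<^bsub>free_algebra R X\<^esub> g)"
    and word: "\<And>k w. \<lbrakk>k \<in> carrier R; w \<noteq> []; set w \<subseteq> X; f w \<noteq> \<zero>\<rbrakk>
      \<Longrightarrow> P (k \<odot>\<^bsub>free_algebra R X\<^esub> word R w)"
  shows "P f"
proof -
  interpret F: assoc_algebra R "free_algebra R X" by (rule free_algebra_assoc_algebra)
  note fD = free_algebra_carrierD[OF f]
  have main: "(\<lambda>w. if w \<in> S then f w else \<zero>) \<in> carrier (free_algebra R X) \<and>
      P (\<lambda>w. if w \<in> S then f w else \<zero>)" if "S \<subseteq> {w. f w \<noteq> \<zero>}" "finite S" for S
    using that(2,1)
  proof (induction S)
    case empty
    then show ?case using zero F.M.zero_closed by (simp add: free_algebra_simps)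
  next
    case (insert u S)
    then have u: "u \<noteq> []" "set u \<subseteq> X" using fD by auto
    have "(\<lambda>w. if w \<in> insert u S then f w else \<zero>) =
      f u \<odot>\<^bsub>free_algebra R X\<^esub> word R u \<oplus>\<^bsub>free_algebra R X\<^esub> (\<lambda>w. if w \<in> S then f w else \<zero>)"
      using insert.hyps fD by (auto simp: free_algebra_simps word_def fun_eq_iff)
    then show ?case using insert u fD by (simp add: add word)
  qed
  have "(\<lambda>w. if w \<in> {w. f w \<noteq> \<zero>} then f w else \<zero>) = f" by auto
  then show ?thesis using main[of "{w. f w \<noteq> \<zero>}"] fD by simp
qed

end

text \<open>The empty word lies outside the free algebra; its value only makes the function total. The product
  of a one-letter word has to be a separate case since there is no identity to start from.\<close>

fun word_prod :: "('a, 'n) monoid_scheme \<Rightarrow> ('x \<Rightarrow> 'a) \<Rightarrow> 'x list \<Rightarrow> 'a" where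
  "word_prod A h [] = \<one>\<^bsub>A\<^esub>"
| "word_prod A h [x] = h x"
| "word_prod A h (x # y # w) = h x \<otimes>\<^bsub>A\<^esub> word_prod A h (y # w)"

definition free_lift ::
    "('k, 'm) ring_scheme \<Rightarrow> ('k, 'a, 'n) module_scheme \<Rightarrow> ('x \<Rightarrow> 'a) \<Rightarrow> ('x list \<Rightarrow> 'k) \<Rightarrow> 'a" where
  "free_lift K A h f = (\<Oplus>\<^bsub>A\<^esub>w\<in>{w. f w \<noteq> \<zero>\<^bsub>K\<^esub>}. f w \<odot>\<^bsub>A\<^esub> word_prod A h w)"

context assoc_algebra
begin

lemma word_prod_closed:
  assumes "h \<in> X \<rightarrow> carrier A" "w \<noteq> []" "set w \<subseteq> X"
  shows "word_prod A h w \<in> carrier A"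
  using assms(2,3) by (induction w rule: induct_list012) (use assms(1) in auto)

lemma word_prod_append:
  assumes h: "h \<in> X \<rightarrow> carrier A" and "u \<noteq> []" "set u \<subseteq> X" and v: "v \<noteq> []" "set v \<subseteq> X"
  shows "word_prod A h (u @ v) = word_prod A h u \<otimes>\<^bsub>A\<^esub> word_prod A h v"
  using assms(2,3)
proof (induction u rule: induct_list012)
  case (2 x)
  then show ?case using v by (cases v) auto
next
  case (3 x y u)
  then show ?case using h v word_prod_closed[OF h v] word_prod_closed[OF h, of "y # u"]
    by (auto simp: mult_assoc Pi_iff)
qed simp

lemma free_lift_superset:
  assumes h: "h \<in> X \<rightarrow> carrier A" and f: "f \<in> carrier (free_algebra K X)"
    and S: "finite S" "{w. f w \<noteq> \<zero>\<^bsub>K\<^esub>} \<subseteq> S" "\<And>w. w \<in> S \<Longrightarrow> w \<noteq> [] \<and> set w \<subseteq> X"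
  shows "free_lift K A h f = (\<Oplus>\<^bsub>A\<^esub>w\<in>S. f w \<odot>\<^bsub>A\<^esub> word_prod A h w)"
  unfolding free_lift_def
  by (rule M.finsum_superset)
     (use S word_prod_closed[OF h] free_algebra_carrierD[OF f] in \<open>auto\<close>)

text \<open>The universal property of the free algebra. Multiplicativity reduces by bilinearity to words, where
  it is \<open>word_prod_append\<close>.\<close>

lemma free_lift_algebra_hom:
  assumes h: "h \<in> X \<rightarrow> carrier A"
  shows "free_lift K A h \<in> algebra_hom K (free_algebra K X) A"
    and "\<And>w. w \<noteq> [] \<Longrightarrow> set w \<subseteq> X \<Longrightarrow> free_lift K A h (word K w) = word_prod A h w"
proof -
  interpret F: assoc_algebra K "free_algebra K X" by (rule R.free_algebra_assoc_algebra)
  let ?F = "free_algebra K X" and ?L = "free_lift K A h"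
  note wp = word_prod_closed[OF h] and D = free_algebra_carrierD
  have closed: "?L f \<in> carrier A" if "f \<in> carrier ?F" for f
    unfolding free_lift_def by (rule M.finsum_closed) (use D[OF that] wp in auto)
  have add: "?L (f \<oplus>\<^bsub>?F\<^esub> g) = ?L f \<oplus>\<^bsub>A\<^esub> ?L g" if fg: "f \<in> carrier ?F" "g \<in> carrier ?F" for f g
  proof -
    let ?S = "{w. f w \<noteq> \<zero>\<^bsub>K\<^esub>} \<union> {w. g w \<noteq> \<zero>\<^bsub>K\<^esub>}"
    have S: "finite ?S" "\<And>w. w \<in> ?S \<Longrightarrow> w \<noteq> [] \<and> set w \<subseteq> X"
      using fg by (simp_all add: free_algebra_carrier_iff) blast
    have "?L (f \<oplus>\<^bsub>?F\<^esub> g) = (\<Oplus>\<^bsub>A\<^esub>w\<in>?S. (f \<oplus>\<^bsub>?F\<^esub> g) w \<odot>\<^bsub>A\<^esub> word_prod A h w)"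
      by (rule free_lift_superset[OF h F.M.a_closed[OF fg]])
         (use S in \<open>auto simp: free_algebra_simps\<close>)
    also have "\<dots> = (\<Oplus>\<^bsub>A\<^esub>w\<in>?S. f w \<odot>\<^bsub>A\<^esub> word_prod A h w \<oplus>\<^bsub>A\<^esub> g w \<odot>\<^bsub>A\<^esub> word_prod A h w)"
      by (rule M.finsum_cong')
         (use fg[THEN D(1)] S wp in \<open>auto simp: free_algebra_simps smult_l_distr\<close>)
    also have "\<dots> = (\<Oplus>\<^bsub>A\<^esub>w\<in>?S. f w \<odot>\<^bsub>A\<^esub> word_prod A h w) \<oplus>\<^bsub>A\<^esub> (\<Oplus>\<^bsub>A\<^esub>w\<in>?S. g w \<odot>\<^bsub>A\<^esub> word_prod A h w)"
      by (rule M.finsum_addf) (use fg[THEN D(1)] S wp in auto)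
    also have "(\<Oplus>\<^bsub>A\<^esub>w\<in>?S. f w \<odot>\<^bsub>A\<^esub> word_prod A h w) = ?L f"
      by (rule free_lift_superset[OF h, symmetric]) (use S fg in auto)
    also have "(\<Oplus>\<^bsub>A\<^esub>w\<in>?S. g w \<odot>\<^bsub>A\<^esub> word_prod A h w) = ?L g"
      by (rule free_lift_superset[OF h, symmetric]) (use S fg in auto)
    finally show ?thesis .
  qed
  have smult: "?L (k \<odot>\<^bsub>?F\<^esub> f) = k \<odot>\<^bsub>A\<^esub> ?L f" if k: "k \<in> carrier K" and f: "f \<in> carrier ?F" for k f
  proof -
    have "?L (k \<odot>\<^bsub>?F\<^esub> f) = (\<Oplus>\<^bsub>A\<^esub>w\<in>{w. f w \<noteq> \<zero>\<^bsub>K\<^esub>}. (k \<odot>\<^bsub>?F\<^esub> f) w \<odot>\<^bsub>A\<^esub> word_prod A h w)"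
      by (rule free_lift_superset[OF h F.smult_closed[OF k f]])
         (use k D[OF f] in \<open>auto simp: free_algebra_simps\<close>)
    also have "\<dots> = (\<Oplus>\<^bsub>A\<^esub>w\<in>{w. f w \<noteq> \<zero>\<^bsub>K\<^esub>}. k \<odot>\<^bsub>A\<^esub> (f w \<odot>\<^bsub>A\<^esub> word_prod A h w))"
      by (rule M.finsum_cong') (use k D[OF f] wp in \<open>auto simp: free_algebra_simps smult_assoc1\<close>)
    also have "\<dots> = k \<odot>\<^bsub>A\<^esub> ?L f"
      unfolding free_lift_def
      by (rule finsum_smult_ldistr[symmetric]) (use k D[OF f] wp in auto)
    finally show ?thesis .
  qed
  show word: "?L (word K w) = word_prod A h w" if "w \<noteq> []" "set w \<subseteq> X" for w
  proof -
    have "?L (word K w) = (\<Oplus>\<^bsub>A\<^esub>w'\<in>{w}. word K w w' \<odot>\<^bsub>A\<^esub> word_prod A h w')"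
      by (rule free_lift_superset[OF h R.word_closed[OF that]])
         (use that in \<open>auto simp: word_def\<close>)
    then show ?thesis using wp[OF that] by (simp add: word_def)
  qed
  have zero: "?L \<zero>\<^bsub>?F\<^esub> = \<zero>\<^bsub>A\<^esub>" by (simp add: free_lift_def free_algebra_simps)
  have "?L (f \<otimes>\<^bsub>?F\<^esub> g) = ?L f \<otimes>\<^bsub>A\<^esub> ?L g" if f: "f \<in> carrier ?F" and g: "g \<in> carrier ?F" for f g
    using f
  proof (induction f rule: R.free_algebra_induct)
    case zero
    then show ?case using g closed \<open>?L \<zero>\<^bsub>?F\<^esub> = \<zero>\<^bsub>A\<^esub>\<close> by simp
  next
    case (add f f')
    then show ?case using g closed \<open>\<And>f g. \<lbrakk>f \<in> carrier ?F; g \<in> carrier ?F\<rbrakk> \<Longrightarrow> ?L (f \<oplus>\<^bsub>?F\<^esub> g) = ?L f \<oplus>\<^bsub>A\<^esub> ?L g\<close>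
      by (simp add: F.mult_l_distr mult_l_distr)
  next
    case (word k u)
    have wg: "?L (word K u \<otimes>\<^bsub>?F\<^esub> g) = ?L (word K u) \<otimes>\<^bsub>A\<^esub> ?L g" using g
    proof (induction g rule: R.free_algebra_induct)
      case zero
      then show ?case using word closed \<open>?L \<zero>\<^bsub>?F\<^esub> = \<zero>\<^bsub>A\<^esub>\<close> by simp
    next
      case (add g g')
      then show ?case using word closed \<open>\<And>f g. \<lbrakk>f \<in> carrier ?F; g \<in> carrier ?F\<rbrakk> \<Longrightarrow> ?L (f \<oplus>\<^bsub>?F\<^esub> g) = ?L f \<oplus>\<^bsub>A\<^esub> ?L g\<close>
        by (simp add: F.mult_r_distr mult_r_distr)
    next
      case (word l v)
      then show ?case using \<open>u \<noteq> []\<close> \<open>set u \<subseteq> X\<close>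
        by (simp add: F.mult_smult_right mult_smult_right smult R.word_mult_word
            \<open>\<And>w. \<lbrakk>w \<noteq> []; set w \<subseteq> X\<rbrakk> \<Longrightarrow> ?L (word K w) = word_prod A h w\<close> word_prod_append[OF h] wp)
    qed
    then show ?case using word g closed
      by (simp add: F.mult_smult_left mult_smult_left smult)
  qed
  then show "?L \<in> algebra_hom K ?F A"
    by (simp add: algebra_hom_def closed add smult)
qed

end


section \<open>Ideals and quotients\<close>

text \<open>Closure under negation comes for free: it is multiplication by the scalar \<open>-1\<close>.\<close>

lemma algebra_idealI:
  assumes A: "assoc_algebra K A" and "I \<subseteq> carrier A" "\<zero>\<^bsub>A\<^esub> \<in> I"
    and "\<And>a b. \<lbrakk>a \<in> I; b \<in> I\<rbrakk> \<Longrightarrow> a \<oplus>\<^bsub>A\<^esub> b \<in> I"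
    and smult: "\<And>k a. \<lbrakk>k \<in> carrier K; a \<in> I\<rbrakk> \<Longrightarrow> k \<odot>\<^bsub>A\<^esub> a \<in> I"
    and "\<And>a x. \<lbrakk>a \<in> I; x \<in> carrier A\<rbrakk> \<Longrightarrow> x \<otimes>\<^bsub>A\<^esub> a \<in> I"
    and "\<And>a x. \<lbrakk>a \<in> I; x \<in> carrier A\<rbrakk> \<Longrightarrow> a \<otimes>\<^bsub>A\<^esub> x \<in> I"
  shows "algebra_ideal K A I"
proof -
  interpret assoc_algebra K A by (fact A)
  have "\<ominus>\<^bsub>A\<^esub> a \<in> I" if "a \<in> I" for a
    using smult[of "\<ominus>\<^bsub>K\<^esub> \<one>\<^bsub>K\<^esub>" a] that assms(2) scalar_minus_one by auto
  then show ?thesis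
    unfolding algebra_ideal_def using assms by (auto intro!: submoduleI)
qed

lemma algebra_idealD:
  assumes I: "algebra_ideal K A I" and A: "assoc_algebra K A"
  shows "I \<subseteq> carrier A" "\<zero>\<^bsub>A\<^esub> \<in> I"
    "\<And>a b. \<lbrakk>a \<in> I; b \<in> I\<rbrakk> \<Longrightarrow> a \<oplus>\<^bsub>A\<^esub> b \<in> I"
    "\<And>a b. \<lbrakk>a \<in> I; b \<in> I\<rbrakk> \<Longrightarrow> a \<ominus>\<^bsub>A\<^esub> b \<in> I"
    "\<And>k a. \<lbrakk>k \<in> carrier K; a \<in> I\<rbrakk> \<Longrightarrow> k \<odot>\<^bsub>A\<^esub> a \<in> I"
    "\<And>a x. \<lbrakk>a \<in> I; x \<in> carrier A\<rbrakk> \<Longrightarrow> x \<otimes>\<^bsub>A\<^esub> a \<in> I"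
    "\<And>a x. \<lbrakk>a \<in> I; x \<in> carrier A\<rbrakk> \<Longrightarrow> a \<otimes>\<^bsub>A\<^esub> x \<in> I"
    "abelian_subgroup I A"
proof -
  interpret assoc_algebra K A by (fact A)
  have sub: "submodule I K A" using I by (simp add: algebra_ideal_def)
  note E = submoduleE[OF sub]
  show "I \<subseteq> carrier A" "\<And>a b. \<lbrakk>a \<in> I; b \<in> I\<rbrakk> \<Longrightarrow> a \<oplus>\<^bsub>A\<^esub> b \<in> I"
    "\<And>k a. \<lbrakk>k \<in> carrier K; a \<in> I\<rbrakk> \<Longrightarrow> k \<odot>\<^bsub>A\<^esub> a \<in> I"
    using E by auto
  show "\<And>a b. \<lbrakk>a \<in> I; b \<in> I\<rbrakk> \<Longrightarrow> a \<ominus>\<^bsub>A\<^esub> b \<in> I"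
    using E by (auto simp: a_minus_def)
  show as: "abelian_subgroup I A"
    by (rule abelian_subgroupI3) (use sub in \<open>auto simp: additive_subgroup_def submodule_def M.abelian_group_axioms\<close>)
  show "\<zero>\<^bsub>A\<^esub> \<in> I"
    using additive_subgroup.zero_closed[OF abelian_subgroup.axioms(1)[OF as]] .
qed (use I in \<open>auto simp: algebra_ideal_def\<close>)

lemma generated_ideal_is_ideal:
  assumes A: "assoc_algebra K A" and S: "S \<subseteq> carrier A"
  shows "algebra_ideal K A (generated_ideal K A S)" "S \<subseteq> generated_ideal K A S"
proof -
  interpret assoc_algebra K A by (fact A)
  have "algebra_ideal K A (carrier A)" by (rule algebra_idealI[OF A]) auto
  then have sub: "generated_ideal K A S \<subseteq> carrier A"
    using S by (auto simp: generated_ideal_def)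
  note D = algebra_idealD[OF _ A]
  show "algebra_ideal K A (generated_ideal K A S)"
    by (rule algebra_idealI[OF A sub]) (auto simp: generated_ideal_def D)
  show "S \<subseteq> generated_ideal K A S" by (auto simp: generated_ideal_def)
qed

lemma generated_ideal_minimal:
  "algebra_ideal K A I \<Longrightarrow> S \<subseteq> I \<Longrightarrow> generated_ideal K A S \<subseteq> I"
  by (auto simp: generated_ideal_def)

lemma kernel_is_ideal:
  assumes A: "assoc_algebra K A" and B: "assoc_algebra K B" and f: "f \<in> algebra_hom K A B"
  shows "algebra_ideal K A {x \<in> carrier A. f x = \<zero>\<^bsub>B\<^esub>}"
proof -
  interpret A: assoc_algebra K A by (fact A)
  interpret B: assoc_algebra K B by (fact B)
  interpret f: abelian_group_hom A B f
    by (rule algebra_hom_additive[OF f A.M.abelian_group_axioms B.M.abelian_group_axioms])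
  show ?thesis
    by (rule algebra_idealI[OF A]) (auto simp: algebra_homD[OF f])
qed

locale algebra_quotient = assoc_algebra K A
  for K :: "('k, 'm) ring_scheme" (structure) and A :: "('k, 'a) module" (structure) +
  fixes I :: "'a set"
  assumes ideal: "algebra_ideal K A I"
begin

lemmas ideal_facts = algebra_idealD[OF ideal assoc_algebra_axioms]

lemma coset_eq_iff:
  assumes x: "x \<in> carrier A" and y: "y \<in> carrier A"
  shows "I +>\<^bsub>A\<^esub> x = I +>\<^bsub>A\<^esub> y \<longleftrightarrow> x \<ominus>\<^bsub>A\<^esub> y \<in> I"
proof -
  interpret I: abelian_subgroup I A by (rule ideal_facts)
  have "I +>\<^bsub>A\<^esub> x = I +>\<^bsub>A\<^esub> y \<longleftrightarrow> x \<in> I +>\<^bsub>A\<^esub> y"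
    using I.a_rcos_self[OF x] I.a_repr_independence'[OF _ y] by metis
  then show ?thesis using I.a_rcos_module[OF y x] by (simp add: a_minus_def)
qed

lemma in_cosetD:
  assumes "x \<in> carrier A" "y \<in> I +>\<^bsub>A\<^esub> x"
  shows "y \<in> carrier A" "y \<ominus>\<^bsub>A\<^esub> x \<in> I"
proof -
  interpret I: abelian_subgroup I A by (rule ideal_facts)
  show "y \<in> carrier A" "y \<ominus>\<^bsub>A\<^esub> x \<in> I"
    using I.a_elemrcos_carrier[OF assms] I.a_rcos_module_imp[OF assms] by (auto simp: a_minus_def)
qed

lemma in_own_coset: "x \<in> carrier A \<Longrightarrow> x \<in> I +>\<^bsub>A\<^esub> x"
  using abelian_subgroup.a_rcos_self[OF ideal_facts(8)] .

lemma coset_add: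
  "\<lbrakk>x \<in> carrier A; y \<in> carrier A\<rbrakk>
    \<Longrightarrow> set_add A (I +>\<^bsub>A\<^esub> x) (I +>\<^bsub>A\<^esub> y) = I +>\<^bsub>A\<^esub> (x \<oplus>\<^bsub>A\<^esub> y)"
  using abelian_subgroup.a_rcos_sum[OF ideal_facts(8)] .

lemma coset_zero: "I +>\<^bsub>A\<^esub> \<zero>\<^bsub>A\<^esub> = I"
  using abelian_subgroup.a_rcos_const[OF ideal_facts(8,2)] .

text \<open>\<^const>\<open>rcoset_mult\<close> unites the cosets of all products of representatives; these cosets coincide
  because \<open>x' y' - x y = (x' - x) y' + x (y' - y)\<close>.\<close>

lemma coset_mult:
  assumes x: "x \<in> carrier A" and y: "y \<in> carrier A"
  shows "rcoset_mult A I (I +>\<^bsub>A\<^esub> x) (I +>\<^bsub>A\<^esub> y) = I +>\<^bsub>A\<^esub> (x \<otimes>\<^bsub>A\<^esub> y)"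
proof -
  have eq: "I +>\<^bsub>A\<^esub> (x' \<otimes>\<^bsub>A\<^esub> y') = I +>\<^bsub>A\<^esub> (x \<otimes>\<^bsub>A\<^esub> y)"
    if x': "x' \<in> I +>\<^bsub>A\<^esub> x" and y': "y' \<in> I +>\<^bsub>A\<^esub> y" for x' y'
  proof -
    note X = in_cosetD[OF x x'] and Y = in_cosetD[OF y y']
    have "x' = (x' \<ominus>\<^bsub>A\<^esub> x) \<oplus>\<^bsub>A\<^esub> x" "y' = (y' \<ominus>\<^bsub>A\<^esub> y) \<oplus>\<^bsub>A\<^esub> y"
      using X(1) Y(1) x y by (simp_all add: M.minus_eq M.a_assoc M.l_neg)
    then obtain i j where ij: "i \<in> I" "j \<in> I" "x' = i \<oplus>\<^bsub>A\<^esub> x" "y' = j \<oplus>\<^bsub>A\<^esub> y" using X Y by blast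
    have ijc: "i \<in> carrier A" "j \<in> carrier A" using ij ideal_facts(1) by auto
    have "x' \<otimes>\<^bsub>A\<^esub> y' \<ominus>\<^bsub>A\<^esub> x \<otimes>\<^bsub>A\<^esub> y = i \<otimes>\<^bsub>A\<^esub> (j \<oplus>\<^bsub>A\<^esub> y) \<oplus>\<^bsub>A\<^esub> x \<otimes>\<^bsub>A\<^esub> j"
      using ijc x y unfolding ij
      by (simp add: M.minus_eq mult_l_distr mult_r_distr M.a_assoc M.r_neg) (simp add: M.a_comm)
    also have "\<dots> \<in> I"
      using ij ijc x y by (intro ideal_facts(3,6,7)) auto
    finally show ?thesis using X(1) Y(1) x y by (simp add: coset_eq_iff)
  qed
  show ?thesis
    unfolding rcoset_mult_def using eq in_own_coset[OF x] in_own_coset[OF y] by blast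
qed

lemma coset_smult:
  assumes k: "k \<in> carrier K" and x: "x \<in> carrier A"
  shows "(\<Union>y\<in>I +>\<^bsub>A\<^esub> x. I +>\<^bsub>A\<^esub> (k \<odot>\<^bsub>A\<^esub> y)) = I +>\<^bsub>A\<^esub> (k \<odot>\<^bsub>A\<^esub> x)"
proof -
  have "I +>\<^bsub>A\<^esub> (k \<odot>\<^bsub>A\<^esub> y) = I +>\<^bsub>A\<^esub> (k \<odot>\<^bsub>A\<^esub> x)" if y: "y \<in> I +>\<^bsub>A\<^esub> x" for y
  proof -
    note Y = in_cosetD[OF x y]
    have "k \<odot>\<^bsub>A\<^esub> y \<ominus>\<^bsub>A\<^esub> k \<odot>\<^bsub>A\<^esub> x = k \<odot>\<^bsub>A\<^esub> (y \<ominus>\<^bsub>A\<^esub> x)"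
      using k x Y(1) by (simp add: M.minus_eq smult_r_distr smult_r_minus)
    then show ?thesis using k x Y ideal_facts(5) by (simp add: coset_eq_iff)
  qed
  then show ?thesis using in_own_coset[OF x] by blast
qed

end

section \<open>Graded algebras\<close>

locale graded_assoc_algebra = assoc_algebra K A
  for K :: "('k, 'm) ring_scheme" (structure) and A :: "('k, 'a, 'n) graded_algebra_scheme" (structure) +
  assumes homog_subset: "homog A n \<subseteq> carrier A"
    and homog_zero [simp, intro]: "\<zero>\<^bsub>A\<^esub> \<in> homog A n"
    and homog_add: "\<lbrakk>x \<in> homog A n; y \<in> homog A n\<rbrakk> \<Longrightarrow> x \<oplus>\<^bsub>A\<^esub> y \<in> homog A n"
    and homog_smult: "\<lbrakk>k \<in> carrier K; x \<in> homog A n\<rbrakk> \<Longrightarrow> k \<odot>\<^bsub>A\<^esub> x \<in> homog A n"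
    and homog_mult: "\<lbrakk>x \<in> homog A m; y \<in> homog A n\<rbrakk> \<Longrightarrow> x \<otimes>\<^bsub>A\<^esub> y \<in> homog A (m + n)"
    and ex1_homog_decomposition: "a \<in> carrier A \<Longrightarrow> \<exists>!c. (\<forall>n. c n \<in> homog A n) \<and>
      finite {n. c n \<noteq> \<zero>\<^bsub>A\<^esub>} \<and> a = (\<Oplus>\<^bsub>A\<^esub>n\<in>{n. c n \<noteq> \<zero>\<^bsub>A\<^esub>}. c n)"
begin

lemma homog_closed [intro]: "x \<in> homog A n \<Longrightarrow> x \<in> carrier A"
  using homog_subset by auto

abbreviation component :: "'a \<Rightarrow> int \<Rightarrow> 'a" where
  "component \<equiv> homog_components A"

lemma
  assumes "a \<in> carrier A"
  shows component_homog: "component a n \<in> homog A n"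
    and finite_components: "finite {n. component a n \<noteq> \<zero>\<^bsub>A\<^esub>}"
    and sum_components: "(\<Oplus>\<^bsub>A\<^esub>n\<in>{n. component a n \<noteq> \<zero>\<^bsub>A\<^esub>}. component a n) = a"
  using theI'[OF ex1_homog_decomposition[OF assms]] unfolding homog_components_def by auto

lemma component_closed [simp, intro]: "a \<in> carrier A \<Longrightarrow> component a n \<in> carrier A"
  using component_homog by auto

lemma component_eqI:
  assumes S: "finite S" "\<And>n. n \<notin> S \<Longrightarrow> c n = \<zero>\<^bsub>A\<^esub>"
    and c: "\<And>n. c n \<in> homog A n" and a: "a = (\<Oplus>\<^bsub>A\<^esub>n\<in>S. c n)"
  shows "component a = c"
proof -
  have cc: "c n \<in> carrier A" for n using c by auto
  have sub: "{n. c n \<noteq> \<zero>\<^bsub>A\<^esub>} \<subseteq> S" using S by auto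
  have "(\<Oplus>\<^bsub>A\<^esub>n\<in>{n. c n \<noteq> \<zero>\<^bsub>A\<^esub>}. c n) = a"
    unfolding a by (rule M.finsum_superset) (use S(1) sub cc in auto)
  moreover have "a \<in> carrier A" unfolding a using cc by auto
  ultimately show ?thesis
    unfolding homog_components_def using c finite_subset[OF sub S(1)]
    by (intro the1_equality ex1_homog_decomposition) auto
qed

lemma sum_components_superset:
  assumes a: "a \<in> carrier A" and "finite S" "\<And>n. n \<notin> S \<Longrightarrow> component a n = \<zero>\<^bsub>A\<^esub>"
  shows "(\<Oplus>\<^bsub>A\<^esub>n\<in>S. component a n) = a"
proof -
  have "(\<Oplus>\<^bsub>A\<^esub>n\<in>{n. component a n \<noteq> \<zero>\<^bsub>A\<^esub>}. component a n) = (\<Oplus>\<^bsub>A\<^esub>n\<in>S. component a n)"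
    by (rule M.finsum_superset) (use assms in auto)
  then show ?thesis using sum_components[OF a] by simp
qed

lemma component_of_homog:
  assumes "a \<in> homog A n"
  shows "component a = (\<lambda>m. if m = n then a else \<zero>\<^bsub>A\<^esub>)"
  by (rule component_eqI[of "{n}"]) (use assms homog_closed in auto)

lemma component_add:
  assumes "a \<in> carrier A" "b \<in> carrier A"
  shows "component (a \<oplus>\<^bsub>A\<^esub> b) = (\<lambda>n. component a n \<oplus>\<^bsub>A\<^esub> component b n)"
proof -
  let ?S = "{n. component a n \<noteq> \<zero>\<^bsub>A\<^esub>} \<union> {n. component b n \<noteq> \<zero>\<^bsub>A\<^esub>}"
  have S: "finite ?S" using assms finite_components by auto
  show ?thesis
  proof (rule component_eqI[OF S])
    have "(\<Oplus>\<^bsub>A\<^esub>n\<in>?S. component a n \<oplus>\<^bsub>A\<^esub> component b n)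
        = (\<Oplus>\<^bsub>A\<^esub>n\<in>?S. component a n) \<oplus>\<^bsub>A\<^esub> (\<Oplus>\<^bsub>A\<^esub>n\<in>?S. component b n)"
      by (rule M.finsum_addf) (use assms in auto)
    also have "(\<Oplus>\<^bsub>A\<^esub>n\<in>?S. component a n) = a"
      by (rule sum_components_superset) (use assms S in auto)
    also have "(\<Oplus>\<^bsub>A\<^esub>n\<in>?S. component b n) = b"
      by (rule sum_components_superset) (use assms S in auto)
    finally show "a \<oplus>\<^bsub>A\<^esub> b = (\<Oplus>\<^bsub>A\<^esub>n\<in>?S. component a n \<oplus>\<^bsub>A\<^esub> component b n)"
      by (rule sym)
  qed (use assms component_homog homog_add in auto)
qed

text \<open>Applying \<open>f\<close> to the decomposition of \<open>a\<close> gives a decomposition of \<open>f a\<close>, which is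
  unique.\<close>

lemma component_graded_map:
  assumes f: "abelian_group_hom A A f" and graded: "\<And>n. f ` homog A n \<subseteq> homog A n"
    and a: "a \<in> carrier A"
  shows "component (f a) = (\<lambda>n. f (component a n))"
proof -
  interpret f: abelian_group_hom A A f by (fact f)
  show ?thesis
  proof (rule component_eqI[OF finite_components[OF a]])
    show "f a = (\<Oplus>\<^bsub>A\<^esub>n\<in>{n. component a n \<noteq> \<zero>\<^bsub>A\<^esub>}. f (component a n))"
      using a by (simp add: f.hom_finsum[symmetric] sum_components)
  qed (use graded component_homog[OF a] f.hom_zero in auto)
qed

lemma homog_induct [consumes 1, case_names homog add]:
  assumes a: "a \<in> carrier A"
    and homog: "\<And>n x. x \<in> homog A n \<Longrightarrow> P x"
    and add: "\<And>x y. \<lbrakk>x \<in> carrier A; y \<in> carrier A; P x; P y\<rbrakk> \<Longrightarrow> P (x \<oplus>\<^bsub>A\<^esub> y)"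
  shows "P a"
proof -
  have "P (\<Oplus>\<^bsub>A\<^esub>n\<in>S. component a n)" if "finite S" for S
    using that
  proof (induction S)
    case empty
    then show ?case using homog[OF homog_zero] by simp
  next
    case (insert n S)
    then show ?case using a homog[OF component_homog] by (simp add: add)
  qed
  from this[OF finite_components[OF a]] show ?thesis using a by (simp add: sum_components)
qed

end

text \<open>Projections \<open>P n\<close> onto the candidate components force uniqueness of a decomposition, since they
  recover its terms from the sum.\<close>

lemma graded_assoc_algebraI:
  fixes A :: "('k, 'a, 'n) graded_algebra_scheme" and P :: "int \<Rightarrow> 'a \<Rightarrow> 'a"
  assumes A: "assoc_algebra K A" and sub: "\<And>n. homog A n \<subseteq> carrier A"
    and zero: "\<And>n. \<zero>\<^bsub>A\<^esub> \<in> homog A n"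
    and "\<And>n x y. \<lbrakk>x \<in> homog A n; y \<in> homog A n\<rbrakk> \<Longrightarrow> x \<oplus>\<^bsub>A\<^esub> y \<in> homog A n"
    and "\<And>n k x. \<lbrakk>k \<in> carrier K; x \<in> homog A n\<rbrakk> \<Longrightarrow> k \<odot>\<^bsub>A\<^esub> x \<in> homog A n"
    and "\<And>m n x y. \<lbrakk>x \<in> homog A m; y \<in> homog A n\<rbrakk> \<Longrightarrow> x \<otimes>\<^bsub>A\<^esub> y \<in> homog A (m + n)"
    and P: "\<And>n. abelian_group_hom A A (P n)"
    and P_homog: "\<And>m n x. x \<in> homog A n \<Longrightarrow> P m x = (if m = n then x else \<zero>\<^bsub>A\<^esub>)"
    and sum: "\<And>a. a \<in> carrier A \<Longrightarrow>
      \<exists>S c. finite S \<and> (\<forall>n. c n \<in> homog A n) \<and> a = (\<Oplus>\<^bsub>A\<^esub>n\<in>S. c n)"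
  shows "graded_assoc_algebra K A"
proof -
  interpret assoc_algebra K A by (fact A)
  have "\<exists>!c. (\<forall>n. c n \<in> homog A n) \<and> finite {n. c n \<noteq> \<zero>\<^bsub>A\<^esub>} \<and>
      a = (\<Oplus>\<^bsub>A\<^esub>n\<in>{n. c n \<noteq> \<zero>\<^bsub>A\<^esub>}. c n)" if a: "a \<in> carrier A" for a
  proof -
    obtain S c where S: "finite S" "\<And>n. c n \<in> homog A n" "a = (\<Oplus>\<^bsub>A\<^esub>n\<in>S. c n)"
      using sum[OF a] by blast
    have cc: "c n \<in> carrier A" for n using S(2) sub by auto
    show ?thesis
    proof (rule ex1I)
      let ?c = "\<lambda>n. if n \<in> S then c n else \<zero>\<^bsub>A\<^esub>"
      have "(\<Oplus>\<^bsub>A\<^esub>n\<in>{n. ?c n \<noteq> \<zero>\<^bsub>A\<^esub>}. ?c n) = (\<Oplus>\<^bsub>A\<^esub>n\<in>S. ?c n)"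
        by (rule M.finsum_superset) (use S(1) cc in auto)
      also have "\<dots> = a" unfolding S(3) by (rule M.finsum_cong') (use cc in auto)
      finally show "(\<forall>n. ?c n \<in> homog A n) \<and> finite {n. ?c n \<noteq> \<zero>\<^bsub>A\<^esub>} \<and>
          a = (\<Oplus>\<^bsub>A\<^esub>n\<in>{n. ?c n \<noteq> \<zero>\<^bsub>A\<^esub>}. ?c n)"
        using S zero by (auto intro: rev_finite_subset[OF S(1)])
    next
      fix d assume d: "(\<forall>n. d n \<in> homog A n) \<and> finite {n. d n \<noteq> \<zero>\<^bsub>A\<^esub>} \<and>
          a = (\<Oplus>\<^bsub>A\<^esub>n\<in>{n. d n \<noteq> \<zero>\<^bsub>A\<^esub>}. d n)"
      have dc: "d n \<in> carrier A" for n using d sub by auto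
      have val: "P m (\<Oplus>\<^bsub>A\<^esub>n\<in>T. e n) = (if m \<in> T then e m else \<zero>\<^bsub>A\<^esub>)"
        if T: "finite T" and e: "\<And>n. e n \<in> homog A n" for m T and e :: "int \<Rightarrow> 'a"
      proof -
        have ec: "e n \<in> carrier A" for n using e sub by auto
        interpret P: abelian_group_hom A A "P m" by (rule P)
        have "P m (\<Oplus>\<^bsub>A\<^esub>n\<in>T. e n) = (\<Oplus>\<^bsub>A\<^esub>n\<in>T. P m (e n))"
          by (rule P.hom_finsum) (use ec in auto)
        also have "\<dots> = (\<Oplus>\<^bsub>A\<^esub>n\<in>T. if m = n then e n else \<zero>\<^bsub>A\<^esub>)"
          by (rule M.finsum_cong') (use P_homog[OF e] ec in auto)
        also have "\<dots> = (if m \<in> T then e m else \<zero>\<^bsub>A\<^esub>)"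
        proof (cases "m \<in> T")
          case True
          then show ?thesis using M.finsum_singleton[of m T e] T ec by simp
        next
          case False
          then have "(\<Oplus>\<^bsub>A\<^esub>n\<in>T. if m = n then e n else \<zero>\<^bsub>A\<^esub>) = \<zero>\<^bsub>A\<^esub>"
            by (intro M.add.finprod_one_eqI) auto
          then show ?thesis using False by simp
        qed
        finally show ?thesis .
      qed
      show "d = (\<lambda>n. if n \<in> S then c n else \<zero>\<^bsub>A\<^esub>)"
      proof
        fix m
        have "d m = P m (\<Oplus>\<^bsub>A\<^esub>n\<in>{n. d n \<noteq> \<zero>\<^bsub>A\<^esub>}. d n)" using d by (subst val) auto
        also have "\<dots> = P m (\<Oplus>\<^bsub>A\<^esub>n\<in>S. c n)" using d S(3) by metis
        also have "\<dots> = (if m \<in> S then c m else \<zero>\<^bsub>A\<^esub>)" using S by (subst val) auto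
        finally show "d m = (if m \<in> S then c m else \<zero>\<^bsub>A\<^esub>)" .
      qed
    qed
  qed
  then show ?thesis using assms by (intro graded_assoc_algebra.intro graded_assoc_algebra_axioms.intro)
qed

lemma graded_algebra_homD:
  assumes "f \<in> graded_algebra_hom K A B"
  shows "f \<in> algebra_hom K A B" "x \<in> homog A n \<Longrightarrow> f x \<in> homog B n"
  using assms by (auto simp: graded_algebra_hom_def)

lemma (in graded_assoc_algebra) component_graded_hom:
  assumes f: "f \<in> graded_algebra_hom K A A" and a: "a \<in> carrier A"
  shows "component (f a) n = f (component a n)"
proof -
  have "abelian_group_hom A A f"
    by (rule algebra_hom_additive[OF graded_algebra_homD(1)[OF f]]) (rule M.abelian_group_axioms)+
  then have "component (f a) = (\<lambda>n. f (component a n))"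
    by (rule component_graded_map) (use graded_algebra_homD(2)[OF f] a in auto)
  then show ?thesis by simp
qed

lemma graded_algebra_hom_funpow:
  assumes f: "f \<in> graded_algebra_hom K A A"
  shows "f ^^ n \<in> graded_algebra_hom K A A"
proof (induction n)
  case (Suc n)
  note D = algebra_homD[OF graded_algebra_homD(1)[OF f]] graded_algebra_homD(2)[OF f]
    and D' = algebra_homD[OF graded_algebra_homD(1)[OF Suc]] graded_algebra_homD(2)[OF Suc]
  show ?case
    by (auto simp: graded_algebra_hom_def algebra_hom_def D(2-6) D'(2-6))
qed (auto simp: graded_algebra_hom_def algebra_hom_def)

section \<open>Zhang twists\<close>

locale zhang_twisted_algebra = graded_assoc_algebra K A
  for K :: "('k, 'm) ring_scheme" (structure) and A :: "('k, 'a, 'n) graded_algebra_scheme" (structure) +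
  fixes \<phi> :: "'a \<Rightarrow> 'a"
  assumes aut: "\<phi> \<in> graded_algebra_aut K A"
begin

abbreviation \<phi>inv :: "'a \<Rightarrow> 'a" where "\<phi>inv \<equiv> inv_into (carrier A) \<phi>"
abbreviation \<phi>pow :: "int \<Rightarrow> 'a \<Rightarrow> 'a" where "\<phi>pow \<equiv> aut_power A \<phi>"
abbreviation twist :: "('k, 'a, 'n) graded_algebra_scheme" where "twist \<equiv> zhang_twist A \<phi>"

lemma \<phi>_graded: "\<phi> \<in> graded_algebra_hom K A A"
  and \<phi>_bij: "bij_betw \<phi> (carrier A) (carrier A)"
  using aut by (auto simp: graded_algebra_aut_def)

lemma \<phi>_inverse [simp]:
  assumes "x \<in> carrier A"
  shows "\<phi> (\<phi>inv x) = x" "\<phi>inv (\<phi> x) = x"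
  using assms by (simp_all add: bij_betw_inv_into_right[OF \<phi>_bij] bij_betw_inv_into_left[OF \<phi>_bij])

lemma \<phi>inv_closed [simp, intro]: "x \<in> carrier A \<Longrightarrow> \<phi>inv x \<in> carrier A"
  by (rule bij_betwE[OF bij_betw_inv_into[OF \<phi>_bij], rule_format])

lemma \<phi>inv_eqI: "\<lbrakk>y \<in> carrier A; \<phi> y = x\<rbrakk> \<Longrightarrow> \<phi>inv x = y"
  by auto

text \<open>For gradedness, decompose the preimage of a homogeneous element: \<open>\<phi>\<close> maps its components to
  those of the given element, so by injectivity all but one vanish.\<close>

lemma \<phi>inv_graded: "\<phi>inv \<in> graded_algebra_hom K A A"
proof -
  note hom = algebra_homD[OF graded_algebra_homD(1)[OF \<phi>_graded]]
  have "\<phi>inv x \<in> homog A n" if x: "x \<in> homog A n" for x n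
  proof -
    have xc: "x \<in> carrier A" using x by auto
    have "component (\<phi> (\<phi>inv x)) n = \<phi> (component (\<phi>inv x) n)"
      by (simp only: component_graded_hom[OF \<phi>_graded \<phi>inv_closed[OF xc]])
    then have "\<phi> (component (\<phi>inv x) n) = x"
      by (simp only: \<phi>_inverse(1)[OF xc] component_of_homog[OF x] refl if_True)
    then show ?thesis
      using \<phi>inv_eqI[OF component_closed[OF \<phi>inv_closed[OF xc]]]
        component_homog[OF \<phi>inv_closed[OF xc], of n] by metis
  qed
  moreover have "\<phi>inv (x \<oplus>\<^bsub>A\<^esub> y) = \<phi>inv x \<oplus>\<^bsub>A\<^esub> \<phi>inv y" "\<phi>inv (x \<otimes>\<^bsub>A\<^esub> y) = \<phi>inv x \<otimes>\<^bsub>A\<^esub> \<phi>inv y"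
    if "x \<in> carrier A" "y \<in> carrier A" for x y
    using that by (auto intro!: \<phi>inv_eqI simp: hom)
  moreover have "\<phi>inv (k \<odot>\<^bsub>A\<^esub> x) = k \<odot>\<^bsub>A\<^esub> \<phi>inv x" if "k \<in> carrier K" "x \<in> carrier A" for k x
    using that by (auto intro!: \<phi>inv_eqI simp: hom)
  ultimately show ?thesis
    by (auto simp: graded_algebra_hom_def algebra_hom_def)
qed

lemma \<phi>pow_graded: "\<phi>pow m \<in> graded_algebra_hom K A A"
  by (simp add: aut_power_def graded_algebra_hom_funpow \<phi>_graded \<phi>inv_graded)

lemmas \<phi>pow_hom = graded_algebra_homD(1)[OF \<phi>pow_graded]
lemmas \<phi>pow_closed [simp, intro] = algebra_homD(2)[OF \<phi>pow_hom]
lemmas \<phi>pow_homog = graded_algebra_homD(2)[OF \<phi>pow_graded]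

lemma \<phi>pow_simps [simp]: "\<phi>pow 0 x = x" "\<phi>pow 1 x = \<phi> x" "\<phi>pow (-1) x = \<phi>inv x"
  by (simp_all add: aut_power_def)

text \<open>The only case with content is \<open>m < 0\<close>, where \<open>\<phi>\<close> cancels one factor of its inverse; at
  \<open>m = -1\<close> the two branches of \<^const>\<open>aut_power\<close> meet.\<close>

lemma \<phi>pow_step:
  assumes x: "x \<in> carrier A"
  shows "\<phi>pow (m + 1) x = \<phi> (\<phi>pow m x)"
proof (cases "0 \<le> m")
  case True
  then show ?thesis by (simp add: aut_power_def nat_add_distrib)
next
  case False
  define k where "k = nat (- m - 1)"
  have m: "nat (- m) = Suc k" "nat (- (m + 1)) = k" using False by (auto simp: k_def)
  have "(\<phi>inv ^^ k) x \<in> carrier A"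
    by (rule algebra_homD(2)[OF graded_algebra_homD(1)[OF graded_algebra_hom_funpow[OF \<phi>inv_graded]] x])
  moreover have "\<phi>pow m x = \<phi>inv ((\<phi>inv ^^ k) x)"
    unfolding aut_power_def using False by (simp only: m if_False funpow.simps o_apply)
  moreover have "\<phi>pow (m + 1) x = (\<phi>inv ^^ k) x"
  proof (cases "m = -1")
    case True
    then show ?thesis by (simp add: aut_power_def k_def)
  next
    case neq: False
    then have "\<not> 0 \<le> m + 1" using False by simp
    then show ?thesis unfolding aut_power_def by (simp only: m if_False)
  qed
  ultimately show ?thesis by simp
qed

lemma \<phi>pow_add:
  assumes x: "x \<in> carrier A"
  shows "\<phi>pow (m + n) x = \<phi>pow m (\<phi>pow n x)"
proof (induction m rule: int_induct[of _ 0])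
  case (step1 m)
  then show ?case using x \<phi>pow_step[of x "m + n"] \<phi>pow_step[of "\<phi>pow n x" m]
    by (simp add: ac_simps)
next
  case (step2 m)
  have "\<phi> (\<phi>pow (m - 1 + n) x) = \<phi> (\<phi>pow (m - 1) (\<phi>pow n x))"
    using x step2 \<phi>pow_step[of x "m - 1 + n"] \<phi>pow_step[of "\<phi>pow n x" "m - 1"] by simp
  then show ?case using x by (metis \<phi>_inverse(2) \<phi>pow_closed)
qed simp

lemma twist_simps [simp]:
  "carrier twist = carrier A" "add twist = add A" "zero twist = zero A" "one twist = one A"
  "smult twist = smult A" "homog twist = homog A" "finsum twist = finsum A"
  by (simp_all add: zhang_twist_def finsum_def)

text \<open>Summing over a common finite superset of the supports lets products with different left factors be
  added termwise.\<close>

lemma twist_mult_superset: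
  assumes a: "a \<in> carrier A" and b: "b \<in> carrier A"
    and S: "finite S" "\<And>n. n \<notin> S \<Longrightarrow> component a n = \<zero>\<^bsub>A\<^esub>"
  shows "a \<otimes>\<^bsub>twist\<^esub> b = (\<Oplus>\<^bsub>A\<^esub>m\<in>S. component a m \<otimes>\<^bsub>A\<^esub> \<phi>pow m b)"
proof -
  have "(\<Oplus>\<^bsub>A\<^esub>m\<in>{m. component a m \<noteq> \<zero>\<^bsub>A\<^esub>}. component a m \<otimes>\<^bsub>A\<^esub> \<phi>pow m b)
      = (\<Oplus>\<^bsub>A\<^esub>m\<in>S. component a m \<otimes>\<^bsub>A\<^esub> \<phi>pow m b)"
    by (rule M.finsum_superset) (use assms in auto)
  then show ?thesis by (simp add: zhang_twist_def)
qed

lemma twist_mult_homog: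
  assumes a: "a \<in> homog A m" and b: "b \<in> carrier A"
  shows "a \<otimes>\<^bsub>twist\<^esub> b = a \<otimes>\<^bsub>A\<^esub> \<phi>pow m b"
  using twist_mult_superset[of a b "{m}"] a b homog_closed[OF a]
  by (simp add: component_of_homog[OF a])

lemma twist_mult_closed [simp, intro]:
  "\<lbrakk>a \<in> carrier A; b \<in> carrier A\<rbrakk> \<Longrightarrow> a \<otimes>\<^bsub>twist\<^esub> b \<in> carrier A"
  using twist_mult_superset[OF _ _ finite_components] by auto

lemma twist_mult_add_left:
  assumes a: "a \<in> carrier A" "a' \<in> carrier A" and b: "b \<in> carrier A"
  shows "(a \<oplus>\<^bsub>A\<^esub> a') \<otimes>\<^bsub>twist\<^esub> b = a \<otimes>\<^bsub>twist\<^esub> b \<oplus>\<^bsub>A\<^esub> a' \<otimes>\<^bsub>twist\<^esub> b"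
proof -
  let ?S = "{n. component a n \<noteq> \<zero>\<^bsub>A\<^esub>} \<union> {n. component a' n \<noteq> \<zero>\<^bsub>A\<^esub>}"
  have S: "finite ?S" using a finite_components by auto
  have "(a \<oplus>\<^bsub>A\<^esub> a') \<otimes>\<^bsub>twist\<^esub> b = (\<Oplus>\<^bsub>A\<^esub>m\<in>?S. component (a \<oplus>\<^bsub>A\<^esub> a') m \<otimes>\<^bsub>A\<^esub> \<phi>pow m b)"
    by (rule twist_mult_superset) (use a b S in \<open>auto simp: component_add\<close>)
  also have "\<dots> = (\<Oplus>\<^bsub>A\<^esub>m\<in>?S. component a m \<otimes>\<^bsub>A\<^esub> \<phi>pow m b \<oplus>\<^bsub>A\<^esub> component a' m \<otimes>\<^bsub>A\<^esub> \<phi>pow m b)"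
    by (rule M.finsum_cong') (use a b in \<open>auto simp: component_add mult_l_distr\<close>)
  also have "\<dots> = (\<Oplus>\<^bsub>A\<^esub>m\<in>?S. component a m \<otimes>\<^bsub>A\<^esub> \<phi>pow m b) \<oplus>\<^bsub>A\<^esub> (\<Oplus>\<^bsub>A\<^esub>m\<in>?S. component a' m \<otimes>\<^bsub>A\<^esub> \<phi>pow m b)"
    by (rule M.finsum_addf) (use a b in auto)
  also have "(\<Oplus>\<^bsub>A\<^esub>m\<in>?S. component a m \<otimes>\<^bsub>A\<^esub> \<phi>pow m b) = a \<otimes>\<^bsub>twist\<^esub> b"
    by (rule twist_mult_superset[symmetric]) (use a b S in auto)
  also have "(\<Oplus>\<^bsub>A\<^esub>m\<in>?S. component a' m \<otimes>\<^bsub>A\<^esub> \<phi>pow m b) = a' \<otimes>\<^bsub>twist\<^esub> b"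
    by (rule twist_mult_superset[symmetric]) (use a b S in auto)
  finally show ?thesis .
qed

lemma twist_mult_add_right:
  assumes "a \<in> carrier A" and b: "b \<in> carrier A" "b' \<in> carrier A"
  shows "a \<otimes>\<^bsub>twist\<^esub> (b \<oplus>\<^bsub>A\<^esub> b') = a \<otimes>\<^bsub>twist\<^esub> b \<oplus>\<^bsub>A\<^esub> a \<otimes>\<^bsub>twist\<^esub> b'"
  using assms(1)
proof (induction a rule: homog_induct)
  case (homog n x)
  then show ?case using b homog_closed[OF homog]
    by (simp add: twist_mult_homog algebra_homD(3)[OF \<phi>pow_hom] mult_r_distr)
next
  case (add x y)
  then show ?case using b by (simp add: twist_mult_add_left M.a_ac)
qed

text \<open>For homogeneous \<open>a\<close>, \<open>b\<close> of degrees \<open>m\<close>, \<open>n\<close> both sides equal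
  \<open>a \<phi>\<^sup>m(b) \<phi>\<^sup>m\<^sup>+\<^sup>n(c)\<close>; the general case follows by additivity in \<open>a\<close> and \<open>b\<close>.\<close>

lemma twist_mult_assoc:
  assumes "a \<in> carrier A" and "b \<in> carrier A" and c: "c \<in> carrier A"
  shows "(a \<otimes>\<^bsub>twist\<^esub> b) \<otimes>\<^bsub>twist\<^esub> c = a \<otimes>\<^bsub>twist\<^esub> (b \<otimes>\<^bsub>twist\<^esub> c)"
  using assms(1)
proof (induction a rule: homog_induct)
  case (homog m x)
  note x = homog homog_closed[OF homog]
  from \<open>b \<in> carrier A\<close> show ?case
  proof (induction b rule: homog_induct)
    case (homog n y)
    note y = homog homog_closed[OF homog]
    have "(x \<otimes>\<^bsub>twist\<^esub> y) \<otimes>\<^bsub>twist\<^esub> c = (x \<otimes>\<^bsub>A\<^esub> \<phi>pow m y) \<otimes>\<^bsub>A\<^esub> \<phi>pow (m + n) c"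
      using x y c by (simp add: twist_mult_homog homog_mult \<phi>pow_homog)
    also have "\<dots> = x \<otimes>\<^bsub>twist\<^esub> (y \<otimes>\<^bsub>twist\<^esub> c)"
      using x y c by (simp add: twist_mult_homog algebra_homD(4)[OF \<phi>pow_hom] \<phi>pow_add mult_assoc)
    finally show ?case .
  next
    case (add y y')
    then show ?case using x c by (simp add: twist_mult_add_left twist_mult_add_right)
  qed
next
  case (add x x')
  then show ?case using assms by (simp add: twist_mult_add_left)
qed

lemma twist_mult_smult:
  assumes k: "k \<in> carrier K" and "a \<in> carrier A" and b: "b \<in> carrier A"
  shows "(k \<odot>\<^bsub>A\<^esub> a) \<otimes>\<^bsub>twist\<^esub> b = k \<odot>\<^bsub>A\<^esub> (a \<otimes>\<^bsub>twist\<^esub> b)"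
    and "a \<otimes>\<^bsub>twist\<^esub> (k \<odot>\<^bsub>A\<^esub> b) = k \<odot>\<^bsub>A\<^esub> (a \<otimes>\<^bsub>twist\<^esub> b)"
  using assms(2)
proof (induction a rule: homog_induct)
  case (homog n x)
  {
    case 1
    then show ?case using k b homog homog_closed[OF homog]
      by (simp add: twist_mult_homog[OF homog_smult[OF k homog]] twist_mult_homog[OF homog]
          mult_smult_left)
  next
    case 2
    then show ?case using k b homog homog_closed[OF homog]
      by (simp add: twist_mult_homog algebra_homD(5)[OF \<phi>pow_hom] mult_smult_right)
  }
next
  case (add x y)
  {
    case 1
    then show ?case using k b add by (simp add: smult_r_distr twist_mult_add_left)
  next
    case 2
    then show ?case using k b add by (simp add: smult_r_distr twist_mult_add_left)
  }
qed

lemma twist_assoc_algebra: "assoc_algebra K twist"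
proof -
  have "abelian_group twist"
  proof (rule abelian_groupI)
    show "\<exists>y\<in>carrier twist. y \<oplus>\<^bsub>twist\<^esub> x = \<zero>\<^bsub>twist\<^esub>" if "x \<in> carrier twist" for x
      using that by (intro bexI[of _ "\<ominus>\<^bsub>A\<^esub> x"]) (auto simp: M.l_neg)
  qed (auto simp: M.a_ac)
  then show ?thesis
    by (intro assoc_algebra.intro moduleI assoc_algebra_axioms.intro R.is_cring)
       (auto simp: smult_l_distr smult_r_distr smult_assoc1 twist_mult_assoc twist_mult_add_left
         twist_mult_add_right twist_mult_smult)
qed

lemma twist_homog_mult:
  "\<lbrakk>x \<in> homog A m; y \<in> homog A n\<rbrakk> \<Longrightarrow> x \<otimes>\<^bsub>twist\<^esub> y \<in> homog A (m + n)"
  by (simp add: twist_mult_homog homog_closed homog_mult \<phi>pow_homog)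

lemma twist_identity:
  assumes u: "is_identity A u" "u \<in> homog A 0" "\<phi> u = u"
  shows "is_identity twist u"
proof -
  have uc: "u \<in> carrier A" and id: "\<And>x. x \<in> carrier A \<Longrightarrow> u \<otimes>\<^bsub>A\<^esub> x = x \<and> x \<otimes>\<^bsub>A\<^esub> u = x"
    using u by (auto simp: is_identity_def)
  have pow: "\<phi>pow m u = u" for m
  proof (induction m rule: int_induct[of _ 0])
    case (step1 m)
    then show ?case using uc u by (simp add: \<phi>pow_step)
  next
    case (step2 m)
    then show ?case using uc u \<phi>pow_step[of u "m - 1"] by (metis \<phi>_inverse(2) \<phi>pow_closed diff_add_cancel)
  qed simp
  have "a \<otimes>\<^bsub>twist\<^esub> u = a" if "a \<in> carrier A" for a
    using that
    by (induction a rule: homog_induct)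
       (use uc in \<open>auto simp: twist_mult_homog pow id homog_closed twist_mult_add_left\<close>)
  then show ?thesis using uc id u(2) by (simp add: is_identity_def twist_mult_homog)
qed

end


section \<open>Leavitt path algebras\<close>

lemma lpa_generators_iff [simp]:
  "Vertex v \<in> lpa_generators E \<longleftrightarrow> v \<in> verts E"
  "Edge e \<in> lpa_generators E \<longleftrightarrow> e \<in> arcs E"
  "Ghost e \<in> lpa_generators E \<longleftrightarrow> e \<in> arcs E"
  by (auto simp: lpa_generators_def)

lemma word_degree_simps [simp]:
  "word_degree [] = 0" "word_degree (x # w) = generator_degree x + word_degree w"
  "word_degree (u @ w) = word_degree u + word_degree w"
  by (simp_all add: word_degree_def)

text \<open>The defining relations for the values of \<open>h\<close> in an algebra \<open>B\<close>. Stating them apart from the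
  free algebra lets the same predicate describe the generators of \<open>L\<close> and their twisted images.\<close>

definition leavitt_family ::
    "('v, 'e) pre_digraph \<Rightarrow> ('k, 'a, 'n) module_scheme \<Rightarrow> (('v, 'e) lpa_generator \<Rightarrow> 'a) \<Rightarrow> bool" where
  "leavitt_family E B h \<longleftrightarrow> h \<in> lpa_generators E \<rightarrow> carrier B \<and>
    (\<forall>v\<in>verts E. \<forall>w\<in>verts E.
      h (Vertex v) \<otimes>\<^bsub>B\<^esub> h (Vertex w) = (if v = w then h (Vertex w) else \<zero>\<^bsub>B\<^esub>)) \<and>
    (\<forall>e\<in>arcs E.
      h (Vertex (tail E e)) \<otimes>\<^bsub>B\<^esub> h (Edge e) = h (Edge e) \<and>
      h (Edge e) \<otimes>\<^bsub>B\<^esub> h (Vertex (head E e)) = h (Edge e) \<and>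
      h (Ghost e) \<otimes>\<^bsub>B\<^esub> h (Vertex (tail E e)) = h (Ghost e) \<and>
      h (Vertex (head E e)) \<otimes>\<^bsub>B\<^esub> h (Ghost e) = h (Ghost e)) \<and>
    (\<forall>e\<in>arcs E. \<forall>f\<in>arcs E.
      h (Ghost e) \<otimes>\<^bsub>B\<^esub> h (Edge f) = (if e = f then h (Vertex (head E e)) else \<zero>\<^bsub>B\<^esub>)) \<and>
    (\<forall>v. regular_vertex E v \<longrightarrow>
      h (Vertex v) = (\<Oplus>\<^bsub>B\<^esub>e\<in>out_arcs E v. h (Edge e) \<otimes>\<^bsub>B\<^esub> h (Ghost e)))"

locale leavitt = wf_digraph E + field K
  for E :: "('v, 'e) pre_digraph" and K :: "('k, 'm) ring_scheme" (structure)
begin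

abbreviation "F \<equiv> lpa_free K E"
abbreviation "I \<equiv> lpa_ideal K E"
abbreviation "L \<equiv> leavitt_path_algebra K E"
abbreviation "gens \<equiv> lpa_generators E"

sublocale F: assoc_algebra K F by (rule free_algebra_assoc_algebra)

definition free_homog :: "int \<Rightarrow> (('v, 'e) lpa_generator list \<Rightarrow> 'k) set" where
  "free_homog n = {f \<in> carrier F. \<forall>w. f w \<noteq> \<zero> \<longrightarrow> word_degree w = n}"

lemma free_homog_closed: "f \<in> free_homog n \<Longrightarrow> f \<in> carrier F"
  by (simp add: free_homog_def)

lemma free_homog_zero [simp]: "\<zero>\<^bsub>F\<^esub> \<in> free_homog n"
  using F.M.zero_closed by (simp add: free_homog_def free_algebra_simps)

lemma free_homog_add: "\<lbrakk>f \<in> free_homog n; g \<in> free_homog n\<rbrakk> \<Longrightarrow> f \<oplus>\<^bsub>F\<^esub> g \<in> free_homog n"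
  using F.M.a_closed[of f g] by (auto simp: free_homog_def free_algebra_simps) (metis l_zero zero_closed)

lemma free_homog_smult: "\<lbrakk>k \<in> carrier K; f \<in> free_homog n\<rbrakk> \<Longrightarrow> k \<odot>\<^bsub>F\<^esub> f \<in> free_homog n"
  using F.smult_closed[of k f] by (auto simp: free_homog_def free_algebra_simps) (metis r_null)

lemma free_homog_minus: "\<lbrakk>f \<in> free_homog n; g \<in> free_homog n\<rbrakk> \<Longrightarrow> f \<ominus>\<^bsub>F\<^esub> g \<in> free_homog n"
  using free_homog_smult[of "\<ominus> \<one>" g n]
  by (simp add: F.M.minus_eq free_homog_add free_homog_closed F.scalar_minus_one)

lemma free_homog_sum:
  "(\<And>i. i \<in> S \<Longrightarrow> f i \<in> free_homog n) \<Longrightarrow> finsum F f S \<in> free_homog n"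
proof (induction S rule: infinite_finite_induct)
  case (insert i S)
  then have "f \<in> S \<rightarrow> carrier F" "f i \<in> carrier F" using free_homog_closed by auto
  with insert show ?case by (simp add: free_homog_add)
qed simp_all

lemma free_homog_mult:
  assumes f: "f \<in> free_homog m" and g: "g \<in> free_homog n"
  shows "f \<otimes>\<^bsub>F\<^esub> g \<in> free_homog (m + n)"
proof -
  have c: "f \<in> carrier F" "g \<in> carrier F" using f g free_homog_closed by auto
  note D = c[THEN free_algebra_carrierD(1)]
  have "word_degree w = m + n" if "(f \<otimes>\<^bsub>F\<^esub> g) w \<noteq> \<zero>" for w
  proof (rule ccontr)
    assume *: "word_degree w \<noteq> m + n"
    have "f (take i w) \<otimes> g (drop i w) = \<zero>" for i
    proof -
      have "word_degree w = word_degree (take i w) + word_degree (drop i w)"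
        by (metis append_take_drop_id word_degree_simps(3))
      then have "f (take i w) = \<zero> \<or> g (drop i w) = \<zero>"
        using f g * unfolding free_homog_def by blast
      then show ?thesis using D by auto
    qed
    then show False using that by (simp add: free_algebra_simps)
  qed
  then show ?thesis using c by (simp add: free_homog_def)
qed

lemma free_homog_word:
  "\<lbrakk>w \<noteq> []; set w \<subseteq> gens\<rbrakk> \<Longrightarrow> word K w \<in> free_homog (word_degree w)"
  by (simp add: free_homog_def) (simp add: word_def)

lemma lpa_relations_homog:
  assumes "(x, y) \<in> lpa_relations K E"
  shows "\<exists>n. x \<in> free_homog n \<and> y \<in> free_homog n"
proof -
  have w: "word K w \<in> free_homog n" if "w \<noteq> []" "set w \<subseteq> gens" "word_degree w = n" for w n
    using free_homog_word that by auto
  show ?thesis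
    using assms unfolding lpa_relations_def
  proof (elim UnE)
    assume "(x, y) \<in> {(word K [Vertex v], \<Oplus>\<^bsub>F\<^esub>e\<in>out_arcs E v. word K [Edge e, Ghost e]) | v.
      regular_vertex E v}"
    then obtain v where v: "regular_vertex E v" "x = word K [Vertex v]"
      "y = (\<Oplus>\<^bsub>F\<^esub>e\<in>out_arcs E v. word K [Edge e, Ghost e])" by auto
    have "x \<in> free_homog 0" using v by (auto intro!: w simp: regular_vertex_def)
    moreover have "y \<in> free_homog 0" unfolding v(3) by (rule free_homog_sum) (auto intro!: w)
    ultimately show ?thesis by blast
  qed ((force intro!: exI[of _ "0::int"] w) | (force intro!: exI[of _ "1::int"] w)
      | (force intro!: exI[of _ "-1::int"] w))+
qed

lemma relators_closed:
  "{x \<ominus>\<^bsub>F\<^esub> y | x y. (x, y) \<in> lpa_relations K E} \<subseteq> carrier F"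
  using lpa_relations_homog free_homog_closed by auto blast

sublocale quotient: algebra_quotient K F I
  using generated_ideal_is_ideal(1)[OF F.assoc_algebra_axioms relators_closed]
  by unfold_locales (simp add: lpa_ideal_def)

lemma relators_in_ideal: "(x, y) \<in> lpa_relations K E \<Longrightarrow> x \<ominus>\<^bsub>F\<^esub> y \<in> I"
  using generated_ideal_is_ideal(2)[OF F.assoc_algebra_axioms relators_closed]
  by (auto simp: lpa_ideal_def)

definition degree_part ::
    "int \<Rightarrow> (('v, 'e) lpa_generator list \<Rightarrow> 'k) \<Rightarrow> ('v, 'e) lpa_generator list \<Rightarrow> 'k" where
  "degree_part n f = (\<lambda>w. if word_degree w = n then f w else \<zero>)"

lemma degree_part_closed: "f \<in> carrier F \<Longrightarrow> degree_part n f \<in> carrier F"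
  by (auto simp: free_algebra_carrier_iff degree_part_def elim: rev_finite_subset)

lemma degree_part_homog: "f \<in> carrier F \<Longrightarrow> degree_part n f \<in> free_homog n"
  using degree_part_closed[of f n] by (simp add: free_homog_def) (simp add: degree_part_def)

lemma degree_part_of_homog:
  "f \<in> free_homog n \<Longrightarrow> degree_part m f = (if m = n then f else \<zero>\<^bsub>F\<^esub>)"
  by (auto simp: free_homog_def degree_part_def free_algebra_simps fun_eq_iff) metis

lemma degree_part_add:
  "degree_part n (f \<oplus>\<^bsub>F\<^esub> g) = degree_part n f \<oplus>\<^bsub>F\<^esub> degree_part n g"
  by (auto simp: degree_part_def free_algebra_simps)

lemma sum_degree_parts:
  assumes f: "f \<in> carrier F"
  shows "f = (\<Oplus>\<^bsub>F\<^esub>n\<in>word_degree ` {w. f w \<noteq> \<zero>}. degree_part n f)"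
proof
  fix w
  note D = free_algebra_carrierD[OF f]
  let ?S = "word_degree ` {w. f w \<noteq> \<zero>}"
  have S: "finite ?S" using D by auto
  interpret ev: abelian_group_hom F K "\<lambda>g. g w"
    by (rule abelian_group_homI_additive)
       (auto simp: free_algebra_carrierD(1) free_algebra_simps F.M.abelian_group_axioms is_abelian_group)
  have "(\<Oplus>\<^bsub>F\<^esub>n\<in>?S. degree_part n f) w = (\<Oplus>n\<in>?S. degree_part n f w)"
    by (rule ev.hom_finsum) (use degree_part_closed[OF f] in auto)
  also have "\<dots> = f w"
  proof (cases "f w = \<zero>")
    case True
    then have "(\<Oplus>n\<in>?S. degree_part n f w) = \<zero>"
      by (intro add.finprod_one_eqI) (auto simp: degree_part_def)
    with True show ?thesis by simp
  next
    case False
    then have "(\<Oplus>n\<in>?S. degree_part n f w) = degree_part (word_degree w) f w"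
      by (intro finsum_single S) (auto simp: degree_part_def D)
    then show ?thesis by (simp add: degree_part_def)
  qed
  finally show "f w = (\<Oplus>\<^bsub>F\<^esub>n\<in>?S. degree_part n f) w" by simp
qed

text \<open>The finite sums of homogeneous elements of the ideal. They turn out to be the whole ideal: they form
  an ideal themselves, because multiplying by a word preserves homogeneity, and they contain the
  relators. This proves that the ideal is homogeneous without computing the degree parts of a
  product.\<close>

inductive_set homog_sums :: "(('v, 'e) lpa_generator list \<Rightarrow> 'k) set" where
  homog: "f \<in> I \<Longrightarrow> f \<in> free_homog n \<Longrightarrow> f \<in> homog_sums"
| add: "f \<in> homog_sums \<Longrightarrow> g \<in> homog_sums \<Longrightarrow> f \<oplus>\<^bsub>F\<^esub> g \<in> homog_sums"

lemma homog_sums_closed: "f \<in> homog_sums \<Longrightarrow> f \<in> carrier F"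
  by (induction rule: homog_sums.induct) (auto simp: free_homog_closed)

lemma homog_sums_ideal: "algebra_ideal K F homog_sums"
proof (rule algebra_idealI[OF F.assoc_algebra_axioms])
  show zero: "\<zero>\<^bsub>F\<^esub> \<in> homog_sums"
    using quotient.ideal_facts(2) by (rule homog_sums.homog[of _ 0]) simp
  show smult: "k \<odot>\<^bsub>F\<^esub> f \<in> homog_sums" if "k \<in> carrier K" "f \<in> homog_sums" for k f
    using that(2)
  proof (induction rule: homog_sums.induct)
    case (homog f n)
    then show ?case using that(1) quotient.ideal_facts(5) free_homog_smult homog_sums.homog by blast
  next
    case (add f g)
    then show ?case using that(1) homog_sums_closed by (simp add: F.smult_r_distr homog_sums.add)
  qed
  show "x \<otimes>\<^bsub>F\<^esub> f \<in> homog_sums" if f: "f \<in> homog_sums" and x: "x \<in> carrier F" for f x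
    using x
  proof (induction x rule: free_algebra_induct)
    case (add x y)
    then show ?case using homog_sums_closed[OF f] by (simp add: F.mult_l_distr homog_sums.add)
  next
    case (word k w)
    have "word K w \<otimes>\<^bsub>F\<^esub> f \<in> homog_sums" using f
    proof (induction rule: homog_sums.induct)
      case (homog f n)
      then show ?case using word quotient.ideal_facts(6) free_homog_mult[OF free_homog_word] homog_sums.homog
        by (meson word_closed)
    next
      case (add f g)
      then show ?case using word homog_sums_closed by (simp add: F.mult_r_distr homog_sums.add)
    qed
    then show ?case using smult word homog_sums_closed[OF f] by (simp add: F.mult_smult_left)
  qed (use zero homog_sums_closed[OF f] in simp)
  show "f \<otimes>\<^bsub>F\<^esub> x \<in> homog_sums" if f: "f \<in> homog_sums" and x: "x \<in> carrier F" for f x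
    using x
  proof (induction x rule: free_algebra_induct)
    case (add x y)
    then show ?case using homog_sums_closed[OF f] by (simp add: F.mult_r_distr homog_sums.add)
  next
    case (word k w)
    have "f \<otimes>\<^bsub>F\<^esub> word K w \<in> homog_sums" using f
    proof (induction rule: homog_sums.induct)
      case (homog f n)
      then show ?case using word quotient.ideal_facts(7) free_homog_mult[OF _ free_homog_word] homog_sums.homog
        by (meson word_closed)
    next
      case (add f g)
      then show ?case using word homog_sums_closed by (simp add: F.mult_l_distr homog_sums.add)
    qed
    then show ?case using smult word homog_sums_closed[OF f] by (simp add: F.mult_smult_right)
  qed (use zero homog_sums_closed[OF f] in simp)
qed (auto simp: homog_sums_closed intro: homog_sums.add)

lemma ideal_homogeneous:
  assumes "f \<in> I"
  shows "degree_part n f \<in> I"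
proof -
  have "x \<ominus>\<^bsub>F\<^esub> y \<in> homog_sums" if "(x, y) \<in> lpa_relations K E" for x y
    using lpa_relations_homog[OF that] relators_in_ideal[OF that] free_homog_minus homog_sums.homog
    by blast
  then have "I \<subseteq> homog_sums"
    unfolding lpa_ideal_def by (intro generated_ideal_minimal[OF homog_sums_ideal]) auto
  then have "f \<in> homog_sums" using assms by auto
  then show ?thesis
    by (induction rule: homog_sums.induct)
       (auto simp: degree_part_of_homog degree_part_add quotient.ideal_facts(2,3))
qed

lemma lpa_simps:
  "carrier L = lpa_class K E ` carrier F" "zero L = I" "add L = set_add F"
  "mult L = rcoset_mult F I" "homog L n = lpa_class K E ` free_homog n"
  "smult L = (\<lambda>k C. \<Union>f\<in>C. lpa_class K E (k \<odot>\<^bsub>F\<^esub> f))"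
  by (auto simp: leavitt_path_algebra_def lpa_class_def A_RCOSETS_def' free_homog_def)

lemma lpa_class_hom: "lpa_class K E \<in> algebra_hom K F L"
  by (auto simp: algebra_hom_def lpa_simps lpa_class_def quotient.coset_add quotient.coset_mult
      quotient.coset_smult)

lemmas lpa_class_simps = algebra_homD(2-5)[OF lpa_class_hom]

lemma lpa_class_zero: "lpa_class K E \<zero>\<^bsub>F\<^esub> = \<zero>\<^bsub>L\<^esub>"
  by (simp add: lpa_simps lpa_class_def quotient.coset_zero)

lemma lpa_class_eq_iff:
  "\<lbrakk>f \<in> carrier F; g \<in> carrier F\<rbrakk> \<Longrightarrow> lpa_class K E f = lpa_class K E g \<longleftrightarrow> f \<ominus>\<^bsub>F\<^esub> g \<in> I"
  by (simp add: lpa_class_def quotient.coset_eq_iff)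

lemma lpa_assoc_algebra: "assoc_algebra K L"
  by (rule assoc_algebra_image[OF F.assoc_algebra_axioms lpa_class_hom])
     (simp_all add: lpa_simps(1) lpa_class_zero)

lemma lpa_class_additive: "abelian_group_hom F L (lpa_class K E)"
proof -
  interpret L: assoc_algebra K L by (rule lpa_assoc_algebra)
  show ?thesis
    by (rule algebra_hom_additive[OF lpa_class_hom F.M.abelian_group_axioms L.M.abelian_group_axioms])
qed

text \<open>The kernel of \<open>g\<close> is an ideal that contains the relators, hence contains the ideal they
  generate. So \<open>g\<close> may be evaluated at any representative of a class.\<close>

lemma lpa_factor:
  assumes B: "assoc_algebra K B" and g: "g \<in> algebra_hom K F B"
    and rel: "\<And>x y. (x, y) \<in> lpa_relations K E \<Longrightarrow> g x = g y"
  shows "\<exists>\<Psi>\<in>algebra_hom K L B. \<forall>f\<in>carrier F. \<Psi> (lpa_class K E f) = g f"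
proof -
  interpret B: assoc_algebra K B by (fact B)
  interpret g: abelian_group_hom F B g
    by (rule algebra_hom_additive[OF g F.M.abelian_group_axioms B.M.abelian_group_axioms])
  note gD = algebra_homD[OF g]
  have minus: "g (x \<ominus>\<^bsub>F\<^esub> y) = g x \<ominus>\<^bsub>B\<^esub> g y" if "x \<in> carrier F" "y \<in> carrier F" for x y
    using that by (simp add: F.M.minus_eq B.M.minus_eq)
  have "x \<ominus>\<^bsub>F\<^esub> y \<in> {x \<in> carrier F. g x = \<zero>\<^bsub>B\<^esub>}" if xy: "(x, y) \<in> lpa_relations K E" for x y
  proof -
    have "x \<in> carrier F" "y \<in> carrier F" using lpa_relations_homog[OF xy] free_homog_closed by auto
    then show ?thesis using rel[OF xy] by (simp add: minus B.M.minus_eq B.M.r_neg)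
  qed
  then have kill: "I \<subseteq> {x \<in> carrier F. g x = \<zero>\<^bsub>B\<^esub>}"
    unfolding lpa_ideal_def
    by (intro generated_ideal_minimal[OF kernel_is_ideal[OF F.assoc_algebra_axioms B g]]) auto
  define \<Psi> where "\<Psi> = (\<lambda>C. g (SOME f. f \<in> carrier F \<and> lpa_class K E f = C))"
  have \<Psi>: "\<Psi> (lpa_class K E f) = g f" if f: "f \<in> carrier F" for f
  proof -
    define f' where "f' = (SOME f'. f' \<in> carrier F \<and> lpa_class K E f' = lpa_class K E f)"
    have f': "f' \<in> carrier F" "lpa_class K E f' = lpa_class K E f"
      unfolding f'_def by (rule someI2[of _ f]; use f in auto)+
    then have "g (f' \<ominus>\<^bsub>F\<^esub> f) = \<zero>\<^bsub>B\<^esub>" using f kill by (auto simp: lpa_class_eq_iff)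
    then have "g f' = g f" using f f' by (simp add: minus B.M.minus_eq B.M.add.inv_solve_right')
    then show ?thesis by (simp add: \<Psi>_def f'_def)
  qed
  have "\<Psi> \<in> algebra_hom K L B"
    by (auto simp: algebra_hom_def lpa_simps(1) \<Psi> gD lpa_class_simps(2-4)[symmetric])
  then show ?thesis using \<Psi> by blast
qed

text \<open>Because the ideal is homogeneous, \<open>degree_part n\<close> descends to the quotient, where it provides the
  projections required by \<open>graded_assoc_algebraI\<close>.\<close>

lemma lpa_graded: "graded_assoc_algebra K L"
proof -
  interpret L: assoc_algebra K L by (rule lpa_assoc_algebra)
  interpret q: abelian_group_hom F L "lpa_class K E" by (rule lpa_class_additive)
  \<comment> \<open>The choice of a representative is immaterial by homogeneity of the ideal, as the next step shows.\<close>
  define P where "P n C = lpa_class K E (degree_part n (SOME f. f \<in> carrier F \<and> lpa_class K E f = C))"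
    for n C
  have P: "P n (lpa_class K E f) = lpa_class K E (degree_part n f)" if f: "f \<in> carrier F" for n f
  proof -
    define f' where "f' = (SOME f'. f' \<in> carrier F \<and> lpa_class K E f' = lpa_class K E f)"
    have f': "f' \<in> carrier F" "lpa_class K E f' = lpa_class K E f"
      unfolding f'_def by (rule someI2[of _ f]; use f in auto)+
    have eq: "f' = (f' \<ominus>\<^bsub>F\<^esub> f) \<oplus>\<^bsub>F\<^esub> f"
      using f f' by (simp add: F.M.minus_eq F.M.a_assoc F.M.l_neg)
    have "f' \<ominus>\<^bsub>F\<^esub> f \<in> I" using f f' by (simp add: lpa_class_eq_iff)
    then obtain i where i: "i \<in> I" "f' = i \<oplus>\<^bsub>F\<^esub> f" using eq by (rule that)
    have ic: "i \<in> carrier F" using i quotient.ideal_facts(1) by auto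
    have "degree_part n f' \<ominus>\<^bsub>F\<^esub> degree_part n f = degree_part n i"
      using i(2) ic f degree_part_closed
      by (simp add: degree_part_add F.M.minus_eq F.M.a_assoc F.M.r_neg)
    then have "lpa_class K E (degree_part n f') = lpa_class K E (degree_part n f)"
      using ideal_homogeneous[OF i(1)] f f' by (simp add: lpa_class_eq_iff degree_part_closed)
    then show ?thesis by (simp add: P_def f'_def)
  qed
  show ?thesis
  proof (rule graded_assoc_algebraI[OF lpa_assoc_algebra, where P = P])
    fix n
    show "abelian_group_hom L L (P n)"
    proof (rule abelian_group_homI_additive)
      show "P n \<in> carrier L \<rightarrow> carrier L"
        by (auto simp: lpa_simps(1) P intro!: imageI degree_part_closed)
      fix x y assume "x \<in> carrier L" "y \<in> carrier L"
      then obtain f g where fg: "f \<in> carrier F" "g \<in> carrier F"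
        "x = lpa_class K E f" "y = lpa_class K E g" by (auto simp: lpa_simps(1))
      have "P n (x \<oplus>\<^bsub>L\<^esub> y) = lpa_class K E (degree_part n (f \<oplus>\<^bsub>F\<^esub> g))"
        using fg P[of "f \<oplus>\<^bsub>F\<^esub> g"] by (simp add: lpa_class_simps(2))
      also have "\<dots> = P n x \<oplus>\<^bsub>L\<^esub> P n y"
        using fg by (simp add: P degree_part_add lpa_class_simps(2) degree_part_closed)
      finally show "P n (x \<oplus>\<^bsub>L\<^esub> y) = P n x \<oplus>\<^bsub>L\<^esub> P n y" .
    qed (rule L.M.abelian_group_axioms)+
  next
    fix m n x assume "x \<in> homog L n"
    then show "P m x = (if m = n then x else \<zero>\<^bsub>L\<^esub>)"
      by (auto simp: lpa_simps(5) P free_homog_closed degree_part_of_homog lpa_class_zero)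
  next
    fix a assume "a \<in> carrier L"
    then obtain f where f: "f \<in> carrier F" "a = lpa_class K E f" by (auto simp: lpa_simps(1))
    let ?S = "word_degree ` {w. f w \<noteq> \<zero>}"
    have "a = lpa_class K E (\<Oplus>\<^bsub>F\<^esub>n\<in>?S. degree_part n f)"
      unfolding f(2) by (rule arg_cong[OF sum_degree_parts[OF f(1)]])
    also have "\<dots> = (\<Oplus>\<^bsub>L\<^esub>n\<in>?S. lpa_class K E (degree_part n f))"
      by (rule q.hom_finsum) (use f degree_part_closed in auto)
    finally have a: "a = (\<Oplus>\<^bsub>L\<^esub>n\<in>?S. lpa_class K E (degree_part n f))" .
    show "\<exists>S c. finite S \<and> (\<forall>n. c n \<in> homog L n) \<and> a = (\<Oplus>\<^bsub>L\<^esub>n\<in>S. c n)"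
    proof (intro exI conjI allI)
      show "finite ?S" using free_algebra_carrierD(2)[OF f(1)] by simp
      show "lpa_class K E (degree_part n f) \<in> homog L n" for n
        unfolding lpa_simps(5) by (intro imageI degree_part_homog f(1))
    qed (rule a)
  next
    fix n
    show "\<zero>\<^bsub>L\<^esub> \<in> homog L n"
      unfolding lpa_simps(5) lpa_class_zero[symmetric] by (intro imageI free_homog_zero)
    show "homog L n \<subseteq> carrier L" by (auto simp: lpa_simps(1,5) free_homog_closed)
  next
    fix n x y assume "x \<in> homog L n" "y \<in> homog L n"
    then obtain f g where fg: "f \<in> free_homog n" "g \<in> free_homog n" "x = lpa_class K E f" "y = lpa_class K E g"
      by (auto simp: lpa_simps(5))
    then have "x \<oplus>\<^bsub>L\<^esub> y = lpa_class K E (f \<oplus>\<^bsub>F\<^esub> g)" by (simp add: lpa_class_simps(2) free_homog_closed)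
    then show "x \<oplus>\<^bsub>L\<^esub> y \<in> homog L n"
      unfolding lpa_simps(5) by (rule image_eqI[of _ "lpa_class K E"]) (use fg free_homog_add in blast)
  next
    fix n k x assume k: "k \<in> carrier K" and "x \<in> homog L n"
    then obtain f where f: "f \<in> free_homog n" "x = lpa_class K E f" by (auto simp: lpa_simps(5))
    then have "k \<odot>\<^bsub>L\<^esub> x = lpa_class K E (k \<odot>\<^bsub>F\<^esub> f)" using k by (simp add: lpa_class_simps(4) free_homog_closed)
    then show "k \<odot>\<^bsub>L\<^esub> x \<in> homog L n"
      unfolding lpa_simps(5) by (rule image_eqI[of _ "lpa_class K E"]) (use f k free_homog_smult in blast)
  next
    fix m n x y assume "x \<in> homog L m" "y \<in> homog L n"
    then obtain f g where fg: "f \<in> free_homog m" "g \<in> free_homog n" "x = lpa_class K E f" "y = lpa_class K E g"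
      by (auto simp: lpa_simps(5))
    then have "x \<otimes>\<^bsub>L\<^esub> y = lpa_class K E (f \<otimes>\<^bsub>F\<^esub> g)" by (simp add: lpa_class_simps(3) free_homog_closed)
    then show "x \<otimes>\<^bsub>L\<^esub> y \<in> homog L (m + n)"
      unfolding lpa_simps(5) by (rule image_eqI[of _ "lpa_class K E"]) (use fg free_homog_mult in blast)
  qed
qed

definition gen :: "('v, 'e) lpa_generator \<Rightarrow> (('v, 'e) lpa_generator list \<Rightarrow> 'k) set" where
  "gen x = lpa_class K E (word K [x])"

lemma gen_eq: "lpa_vertex K E v = gen (Vertex v)" "lpa_edge K E e = gen (Edge e)"
  "lpa_ghost K E e = gen (Ghost e)"
  by (simp_all add: gen_def lpa_vertex_def lpa_edge_def lpa_ghost_def)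

lemma gen_closed [simp, intro]: "x \<in> gens \<Longrightarrow> gen x \<in> carrier L"
  by (simp add: gen_def lpa_class_simps)

lemma gen_homog: "x \<in> gens \<Longrightarrow> gen x \<in> homog L (generator_degree x)"
  using free_homog_word[of "[x]"] by (auto simp: gen_def lpa_simps(5))

lemma lpa_class_Cons:
  "\<lbrakk>x \<in> gens; w \<noteq> []; set w \<subseteq> gens\<rbrakk>
    \<Longrightarrow> lpa_class K E (word K (x # w)) = gen x \<otimes>\<^bsub>L\<^esub> lpa_class K E (word K w)"
  using word_mult_word[of gens "[x]" w] by (simp add: gen_def lpa_class_simps(3)[symmetric])

lemma lpa_relation_eq:
  assumes "(x, y) \<in> lpa_relations K E"
  shows "lpa_class K E x = lpa_class K E y"
proof -
  have "x \<in> carrier F" "y \<in> carrier F" using lpa_relations_homog[OF assms] free_homog_closed by auto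
  then show ?thesis using relators_in_ideal[OF assms] by (simp add: lpa_class_eq_iff)
qed

lemma gen_family: "leavitt_family E L gen"
proof -
  interpret L: assoc_algebra K L by (rule lpa_assoc_algebra)
  interpret q: abelian_group_hom F L "lpa_class K E" by (rule lpa_class_additive)
  have pair: "lpa_class K E (word K [x, y]) = gen x \<otimes>\<^bsub>L\<^esub> gen y" if "x \<in> gens" "y \<in> gens" for x y
    using that lpa_class_Cons[of x "[y]"] by (simp add: gen_def)
  have single: "lpa_class K E (word K [x]) = gen x" for x by (simp add: gen_def)
  note rel = lpa_relation_eq[unfolded lpa_relations_def]
  have 1: "gen (Vertex v) \<otimes>\<^bsub>L\<^esub> gen (Vertex w) = (if v = w then gen (Vertex w) else \<zero>\<^bsub>L\<^esub>)"
    if "v \<in> verts E" "w \<in> verts E" for v w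
  proof -
    have "lpa_class K E (word K [Vertex v, Vertex w])
        = lpa_class K E (if v = w then word K [Vertex w] else \<zero>\<^bsub>F\<^esub>)"
      by (rule rel) (use that in auto)
    then show ?thesis using that by (simp add: pair single lpa_class_zero split: if_splits)
  qed
  have 3: "gen (Ghost e) \<otimes>\<^bsub>L\<^esub> gen (Edge f) = (if e = f then gen (Vertex (head E e)) else \<zero>\<^bsub>L\<^esub>)"
    if "e \<in> arcs E" "f \<in> arcs E" for e f
  proof -
    have "lpa_class K E (word K [Ghost e, Edge f])
        = lpa_class K E (if e = f then word K [Vertex (head E e)] else \<zero>\<^bsub>F\<^esub>)"
      by (rule rel) (use that in auto)
    then show ?thesis using that by (simp add: pair single lpa_class_zero split: if_splits)
  qed
  have 2: "gen (Vertex (tail E e)) \<otimes>\<^bsub>L\<^esub> gen (Edge e) = gen (Edge e)"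
    "gen (Edge e) \<otimes>\<^bsub>L\<^esub> gen (Vertex (head E e)) = gen (Edge e)"
    "gen (Ghost e) \<otimes>\<^bsub>L\<^esub> gen (Vertex (tail E e)) = gen (Ghost e)"
    "gen (Vertex (head E e)) \<otimes>\<^bsub>L\<^esub> gen (Ghost e) = gen (Ghost e)" if e: "e \<in> arcs E" for e
  proof -
    have "lpa_class K E (word K [Vertex (tail E e), Edge e]) = lpa_class K E (word K [Edge e])"
      "lpa_class K E (word K [Edge e, Vertex (head E e)]) = lpa_class K E (word K [Edge e])"
      "lpa_class K E (word K [Ghost e, Vertex (tail E e)]) = lpa_class K E (word K [Ghost e])"
      "lpa_class K E (word K [Vertex (head E e), Ghost e]) = lpa_class K E (word K [Ghost e])"
      by (rule rel; use e in auto)+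
    then show "gen (Vertex (tail E e)) \<otimes>\<^bsub>L\<^esub> gen (Edge e) = gen (Edge e)"
    "gen (Edge e) \<otimes>\<^bsub>L\<^esub> gen (Vertex (head E e)) = gen (Edge e)"
    "gen (Ghost e) \<otimes>\<^bsub>L\<^esub> gen (Vertex (tail E e)) = gen (Ghost e)"
    "gen (Vertex (head E e)) \<otimes>\<^bsub>L\<^esub> gen (Ghost e) = gen (Ghost e)"
      using e by (simp_all add: pair single)
  qed
  have 4: "gen (Vertex v) = (\<Oplus>\<^bsub>L\<^esub>e\<in>out_arcs E v. gen (Edge e) \<otimes>\<^bsub>L\<^esub> gen (Ghost e))"
    if "regular_vertex E v" for v
  proof -
    have "gen (Vertex v) = lpa_class K E (\<Oplus>\<^bsub>F\<^esub>e\<in>out_arcs E v. word K [Edge e, Ghost e])"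
      unfolding gen_def by (rule rel) (use that in auto)
    also have "\<dots> = (\<Oplus>\<^bsub>L\<^esub>e\<in>out_arcs E v. lpa_class K E (word K [Edge e, Ghost e]))"
      by (rule q.hom_finsum) auto
    also have "\<dots> = (\<Oplus>\<^bsub>L\<^esub>e\<in>out_arcs E v. gen (Edge e) \<otimes>\<^bsub>L\<^esub> gen (Ghost e))"
      by (rule L.M.finsum_cong') (auto simp: pair)
    finally show ?thesis .
  qed
  show ?thesis unfolding leavitt_family_def using 1 2 3 4 by auto
qed

text \<open>The free lift of \<open>h\<close> identifies the two sides of each relation, so it factors through \<open>L\<close>.\<close>

lemma lpa_universal_property:
  assumes B: "assoc_algebra K B" and h: "leavitt_family E B h"
  shows "\<exists>\<Psi>\<in>algebra_hom K L B. \<forall>x\<in>gens. \<Psi> (gen x) = h x"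
proof -
  interpret B: assoc_algebra K B by (fact B)
  have hc: "h \<in> gens \<rightarrow> carrier B" using h by (simp add: leavitt_family_def)
  note g = B.free_lift_algebra_hom[OF hc]
  interpret g: abelian_group_hom F B "free_lift K B h"
    by (rule algebra_hom_additive[OF g(1) F.M.abelian_group_axioms B.M.abelian_group_axioms])
  have "free_lift K B h x = free_lift K B h y" if "(x, y) \<in> lpa_relations K E" for x y
    using that unfolding lpa_relations_def
  proof (elim UnE)
    assume "(x, y) \<in> {(word K [Vertex v], \<Oplus>\<^bsub>F\<^esub>e\<in>out_arcs E v. word K [Edge e, Ghost e]) | v.
      regular_vertex E v}"
    then obtain v where v: "regular_vertex E v" "x = word K [Vertex v]"
      "y = (\<Oplus>\<^bsub>F\<^esub>e\<in>out_arcs E v. word K [Edge e, Ghost e])" by auto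
    have "free_lift K B h y = (\<Oplus>\<^bsub>B\<^esub>e\<in>out_arcs E v. free_lift K B h (word K [Edge e, Ghost e]))"
      unfolding v(3) by (rule g.hom_finsum) auto
    also have "\<dots> = (\<Oplus>\<^bsub>B\<^esub>e\<in>out_arcs E v. h (Edge e) \<otimes>\<^bsub>B\<^esub> h (Ghost e))"
      by (rule B.M.finsum_cong') (use hc in \<open>auto simp: g(2) Pi_iff\<close>)
    also have "\<dots> = h (Vertex v)" using h v by (simp add: leavitt_family_def)
    finally show ?thesis using v by (simp add: g(2) regular_vertex_def)
  qed (use h in \<open>auto simp: g(2) leavitt_family_def\<close>)
  from lpa_factor[OF B g(1) this] obtain \<Psi> where
    "\<Psi> \<in> algebra_hom K L B" "\<forall>f\<in>carrier F. \<Psi> (lpa_class K E f) = free_lift K B h f" by blast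
  then show ?thesis by (auto intro!: bexI[of _ \<Psi>] simp: gen_def g(2))
qed

text \<open>Homogeneous elements are combinations of words of the same degree.\<close>

lemma lpa_induct [consumes 1, case_names zero add word]:
  assumes a: "a \<in> homog L n"
    and zero: "P \<zero>\<^bsub>L\<^esub>"
    and add: "\<And>x y. \<lbrakk>x \<in> homog L n; y \<in> homog L n; P x; P y\<rbrakk> \<Longrightarrow> P (x \<oplus>\<^bsub>L\<^esub> y)"
    and word: "\<And>k w. \<lbrakk>k \<in> carrier K; w \<noteq> []; set w \<subseteq> gens; word_degree w = n\<rbrakk>
      \<Longrightarrow> P (k \<odot>\<^bsub>L\<^esub> lpa_class K E (word K w))"
  shows "P a"
proof -
  obtain f where f: "f \<in> free_homog n" "a = lpa_class K E f" using a by (auto simp: lpa_simps(5))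
  have "lpa_class K E f \<in> homog L n \<and> P (lpa_class K E f)" using free_homog_closed[OF f(1)]
  proof (induction f rule: free_algebra_induct)
    case zero
    then show ?case using \<open>P \<zero>\<^bsub>L\<^esub>\<close> by (simp add: lpa_class_zero graded_assoc_algebra.homog_zero[OF lpa_graded])
  next
    case (add f g)
    then show ?case
      using \<open>\<And>x y. \<lbrakk>x \<in> homog L n; y \<in> homog L n; P x; P y\<rbrakk> \<Longrightarrow> P (x \<oplus>\<^bsub>L\<^esub> y)\<close>
      by (simp add: lpa_class_simps(2) graded_assoc_algebra.homog_add[OF lpa_graded])
  next
    case (word k w)
    then have "word_degree w = n" using f by (auto simp: free_homog_def)
    moreover from this have "lpa_class K E (word K w) \<in> homog L n"
      using word free_homog_word by (auto simp: lpa_simps(5))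
    ultimately show ?case using word
      \<open>\<And>k w. \<lbrakk>k \<in> carrier K; w \<noteq> []; set w \<subseteq> gens; word_degree w = n\<rbrakk>
        \<Longrightarrow> P (k \<odot>\<^bsub>L\<^esub> lpa_class K E (word K w))\<close>
      by (auto simp: lpa_class_simps(4) graded_assoc_algebra.homog_smult[OF lpa_graded])
  qed
  then show ?thesis using f by simp
qed

end


section \<open>Monomials\<close>

context leavitt
begin

sublocale L: graded_assoc_algebra K L by (rule lpa_graded)

abbreviation vert :: "'v \<Rightarrow> (('v, 'e) lpa_generator list \<Rightarrow> 'k) set" where "vert v \<equiv> gen (Vertex v)"
abbreviation edge :: "'e \<Rightarrow> (('v, 'e) lpa_generator list \<Rightarrow> 'k) set" where "edge e \<equiv> gen (Edge e)"
abbreviation ghost :: "'e \<Rightarrow> (('v, 'e) lpa_generator list \<Rightarrow> 'k) set" where "ghost e \<equiv> gen (Ghost e)"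

lemma
  shows vert_vert: "\<lbrakk>v \<in> verts E; w \<in> verts E\<rbrakk> \<Longrightarrow> vert v \<otimes>\<^bsub>L\<^esub> vert w = (if v = w then vert w else \<zero>\<^bsub>L\<^esub>)"
    and tail_edge: "e \<in> arcs E \<Longrightarrow> vert (tail E e) \<otimes>\<^bsub>L\<^esub> edge e = edge e"
    and edge_head: "e \<in> arcs E \<Longrightarrow> edge e \<otimes>\<^bsub>L\<^esub> vert (head E e) = edge e"
    and ghost_tail: "e \<in> arcs E \<Longrightarrow> ghost e \<otimes>\<^bsub>L\<^esub> vert (tail E e) = ghost e"
    and head_ghost: "e \<in> arcs E \<Longrightarrow> vert (head E e) \<otimes>\<^bsub>L\<^esub> ghost e = ghost e"
    and ghost_edge: "\<lbrakk>e \<in> arcs E; f \<in> arcs E\<rbrakk> \<Longrightarrow>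
      ghost e \<otimes>\<^bsub>L\<^esub> edge f = (if e = f then vert (head E e) else \<zero>\<^bsub>L\<^esub>)"
    and regular_vert: "regular_vertex E v \<Longrightarrow> vert v = (\<Oplus>\<^bsub>L\<^esub>e\<in>out_arcs E v. edge e \<otimes>\<^bsub>L\<^esub> ghost e)"
  using gen_family unfolding leavitt_family_def by blast+

lemma vert_edge:
  assumes v: "v \<in> verts E" and e: "e \<in> arcs E"
  shows "vert v \<otimes>\<^bsub>L\<^esub> edge e = (if v = tail E e then edge e else \<zero>\<^bsub>L\<^esub>)"
proof -
  have "vert v \<otimes>\<^bsub>L\<^esub> edge e = (vert v \<otimes>\<^bsub>L\<^esub> vert (tail E e)) \<otimes>\<^bsub>L\<^esub> edge e"
    using v e by (simp add: L.mult_assoc tail_edge)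
  then show ?thesis using v e by (simp add: vert_vert tail_edge)
qed

lemma ghost_vert:
  assumes v: "v \<in> verts E" and e: "e \<in> arcs E"
  shows "ghost e \<otimes>\<^bsub>L\<^esub> vert v = (if v = tail E e then ghost e else \<zero>\<^bsub>L\<^esub>)"
proof -
  have "ghost e \<otimes>\<^bsub>L\<^esub> vert v = ghost e \<otimes>\<^bsub>L\<^esub> (vert (tail E e) \<otimes>\<^bsub>L\<^esub> vert v)"
    using v e by (simp add: L.mult_assoc[symmetric] ghost_tail)
  then show ?thesis using v e by (simp add: vert_vert ghost_tail)
qed

text \<open>The products of a path of length \<open>i\<close> with a ghost path of length \<open>j\<close>. Consecutive edges are
  not required to compose, and zero has every pair of lengths, so that multiplication by a generator
  always leads to a monomial again.\<close>

inductive monomial :: "nat \<Rightarrow> nat \<Rightarrow> (('v, 'e) lpa_generator list \<Rightarrow> 'k) set \<Rightarrow> bool" where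
  zero: "monomial i j \<zero>\<^bsub>L\<^esub>"
| vertex: "v \<in> verts E \<Longrightarrow> monomial 0 0 (vert v)"
| edge: "e \<in> arcs E \<Longrightarrow> monomial i j m \<Longrightarrow> monomial (Suc i) j (edge e \<otimes>\<^bsub>L\<^esub> m)"
| ghost: "e \<in> arcs E \<Longrightarrow> monomial i j m \<Longrightarrow> monomial i (Suc j) (m \<otimes>\<^bsub>L\<^esub> ghost e)"

lemma monomial_closed: "monomial i j m \<Longrightarrow> m \<in> carrier L"
  by (induction rule: monomial.induct) auto

lemma vert_monomial:
  assumes v: "v \<in> verts E"
  shows "monomial i j m \<Longrightarrow> monomial i j (vert v \<otimes>\<^bsub>L\<^esub> m)"
proof (induction rule: monomial.induct)
  case (edge e i j m)
  then show ?case using v monomial_closed[of i j m]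
    by (auto simp: L.mult_assoc[symmetric] vert_edge intro: monomial.intros)
next
  case (ghost e i j m)
  then show ?case using v monomial_closed[of i j m]
    by (auto simp: L.mult_assoc[symmetric] intro: monomial.intros)
qed (use v in \<open>auto simp: vert_vert intro: monomial.intros\<close>)

text \<open>A ghost edge cancels against the first edge of the path; if the path is empty it
  lengthens the ghost path. Both decrease \<open>i - j\<close> by one.\<close>

lemma ghost_monomial:
  assumes e: "e \<in> arcs E"
  shows "monomial i j m \<Longrightarrow>
    \<exists>i' j'. monomial i' j' (ghost e \<otimes>\<^bsub>L\<^esub> m) \<and> int i' - int j' = int i - int j - 1"
proof (induction rule: monomial.induct)
  case (zero i j)
  have "monomial i (Suc j) (ghost e \<otimes>\<^bsub>L\<^esub> \<zero>\<^bsub>L\<^esub>)" using e by (auto intro: monomial.zero)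
  then show ?case by (intro exI conjI) auto
next
  case (vertex v)
  have "monomial 0 (Suc 0) (ghost e)"
    using monomial.ghost[OF e monomial.vertex[OF head_in_verts[OF e]]] e by (simp add: head_ghost)
  then have "monomial 0 (Suc 0) (ghost e \<otimes>\<^bsub>L\<^esub> vert v)"
    using vertex e by (auto simp: ghost_vert intro: monomial.zero)
  then show ?case by (intro exI conjI) auto
next
  case (edge f i j m)
  have "ghost e \<otimes>\<^bsub>L\<^esub> (edge f \<otimes>\<^bsub>L\<^esub> m) = (ghost e \<otimes>\<^bsub>L\<^esub> edge f) \<otimes>\<^bsub>L\<^esub> m"
    using edge e monomial_closed[OF edge(2)] by (simp add: L.mult_assoc)
  then have "monomial i j (ghost e \<otimes>\<^bsub>L\<^esub> (edge f \<otimes>\<^bsub>L\<^esub> m))"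
    using edge e monomial_closed[OF edge(2)] vert_monomial[OF head_in_verts[OF e] edge(2)]
    by (auto simp: ghost_edge intro: monomial.zero)
  then show ?case by (intro exI conjI) auto
next
  case (ghost f i j m)
  then obtain i' j' where ij: "monomial i' j' (ghost e \<otimes>\<^bsub>L\<^esub> m)" "int i' - int j' = int i - int j - 1"
    by blast
  have "monomial i' (Suc j') (ghost e \<otimes>\<^bsub>L\<^esub> (m \<otimes>\<^bsub>L\<^esub> ghost f))"
    using monomial.ghost[OF ghost(1) ij(1)] ghost e monomial_closed[OF ghost(2)]
    by (simp add: L.mult_assoc)
  then show ?case using ij(2) by (intro exI conjI) auto
qed

lemma word_monomial:
  assumes "w \<noteq> []" "set w \<subseteq> gens"
  shows "\<exists>i j. monomial i j (lpa_class K E (word K w)) \<and> int i - int j = word_degree w"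
  using assms
proof (induction w rule: list_nonempty_induct)
  case (single x)
  show ?case
  proof (cases x)
    case (Vertex v)
    then have "monomial 0 0 (gen x)" using single by (auto intro: monomial.vertex)
    then show ?thesis using Vertex by (auto simp: gen_def[symmetric] intro!: exI)
  next
    case (Edge e)
    then have "e \<in> arcs E" using single by simp
    then have "monomial (Suc 0) 0 (edge e)"
      using monomial.edge[OF _ monomial.vertex, of e "head E e"] by (simp add: edge_head)
    then show ?thesis using Edge by (intro exI conjI) (auto simp: gen_def[symmetric])
  next
    case (Ghost e)
    then have "e \<in> arcs E" using single by simp
    then have "monomial 0 (Suc 0) (ghost e)"
      using monomial.ghost[OF _ monomial.vertex, of e "head E e"] by (simp add: head_ghost)
    then show ?thesis using Ghost by (intro exI conjI) (auto simp: gen_def[symmetric])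
  qed
next
  case (cons x w)
  then obtain i j where ij: "monomial i j (lpa_class K E (word K w))" "int i - int j = word_degree w"
    by auto
  have eq: "lpa_class K E (word K (x # w)) = gen x \<otimes>\<^bsub>L\<^esub> lpa_class K E (word K w)"
    using cons by (intro lpa_class_Cons) auto
  show ?case
  proof (cases x)
    case (Vertex v)
    then have "monomial i j (lpa_class K E (word K (x # w)))"
      unfolding eq using cons.prems ij(1) vert_monomial[of v i j] by simp
    then show ?thesis using ij Vertex by (intro exI conjI) auto
  next
    case (Edge e)
    then have "monomial (Suc i) j (lpa_class K E (word K (x # w)))"
      unfolding eq using cons.prems ij(1) monomial.edge[of e i j] by simp
    then show ?thesis using ij Edge by (intro exI conjI) auto
  next
    case (Ghost e)
    then obtain i' j' where "monomial i' j' (ghost e \<otimes>\<^bsub>L\<^esub> lpa_class K E (word K w))"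
      "int i' - int j' = int i - int j - 1"
      using ghost_monomial[OF _ ij(1), of e] cons.prems by auto
    then show ?thesis unfolding eq using Ghost ij(2) by (intro exI conjI) auto
  qed
qed

lemma monomial_split_left:
  "monomial i' j m \<Longrightarrow> i' = Suc i \<Longrightarrow>
    m = \<zero>\<^bsub>L\<^esub> \<or> (\<exists>e\<in>arcs E. \<exists>m'. monomial i j m' \<and> m = edge e \<otimes>\<^bsub>L\<^esub> m')"
proof (induction rule: monomial.induct)
  case (ghost f i' j m)
  show ?case
  proof (cases "m = \<zero>\<^bsub>L\<^esub>")
    case False
    then obtain e m' where e: "e \<in> arcs E" "monomial i j m'" "m = edge e \<otimes>\<^bsub>L\<^esub> m'" using ghost by auto
    then have "m \<otimes>\<^bsub>L\<^esub> ghost f = edge e \<otimes>\<^bsub>L\<^esub> (m' \<otimes>\<^bsub>L\<^esub> ghost f)"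
      using ghost(1) monomial_closed[OF e(2)] by (simp add: L.mult_assoc)
    then show ?thesis using e ghost(1) monomial.ghost by blast
  qed (use ghost in simp)
qed auto

lemma monomial_split_right:
  "monomial i j' m \<Longrightarrow> j' = Suc j \<Longrightarrow>
    m = \<zero>\<^bsub>L\<^esub> \<or> (\<exists>e\<in>arcs E. \<exists>m'. monomial i j m' \<and> m = m' \<otimes>\<^bsub>L\<^esub> ghost e)"
proof (induction rule: monomial.induct)
  case (edge f i j' m)
  show ?case
  proof (cases "m = \<zero>\<^bsub>L\<^esub>")
    case False
    then obtain e m' where e: "e \<in> arcs E" "monomial i j m'" "m = m' \<otimes>\<^bsub>L\<^esub> ghost e" using edge by auto
    then have "edge f \<otimes>\<^bsub>L\<^esub> m = (edge f \<otimes>\<^bsub>L\<^esub> m') \<otimes>\<^bsub>L\<^esub> ghost e"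
      using edge(1) monomial_closed[OF e(2)] by (simp add: L.mult_assoc)
    then show ?thesis using e edge(1) monomial.edge by blast
  qed (use edge in simp)
qed auto

section \<open>Range projections\<close>

text \<open>The idempotent \<open>p\<^sub>S\<close>. For finite \<open>S\<close> it acts as a left identity on products that start with an edge in \<open>S\<close> and
  as a right identity on products that end with a ghost edge in \<open>S\<close>.\<close>

definition range_proj :: "'e set \<Rightarrow> (('v, 'e) lpa_generator list \<Rightarrow> 'k) set" where
  "range_proj S = (\<Oplus>\<^bsub>L\<^esub>e\<in>S. edge e \<otimes>\<^bsub>L\<^esub> ghost e)"

lemma range_proj_closed [simp, intro]: "S \<subseteq> arcs E \<Longrightarrow> range_proj S \<in> carrier L"
  unfolding range_proj_def by (rule L.M.finsum_closed) auto

lemma range_proj_mult: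
  assumes "S \<subseteq> arcs E" "x \<in> carrier L"
  shows "range_proj S \<otimes>\<^bsub>L\<^esub> x = (\<Oplus>\<^bsub>L\<^esub>e\<in>S. edge e \<otimes>\<^bsub>L\<^esub> (ghost e \<otimes>\<^bsub>L\<^esub> x))"
proof -
  have "range_proj S \<otimes>\<^bsub>L\<^esub> x = (\<Oplus>\<^bsub>L\<^esub>e\<in>S. (edge e \<otimes>\<^bsub>L\<^esub> ghost e) \<otimes>\<^bsub>L\<^esub> x)"
    unfolding range_proj_def by (rule L.finsum_mult_left) (use assms in auto)
  also have "\<dots> = (\<Oplus>\<^bsub>L\<^esub>e\<in>S. edge e \<otimes>\<^bsub>L\<^esub> (ghost e \<otimes>\<^bsub>L\<^esub> x))"
    by (rule L.M.finsum_cong') (use assms in \<open>auto simp: L.mult_assoc subset_iff\<close>)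
  finally show ?thesis .
qed

lemma mult_range_proj:
  assumes "S \<subseteq> arcs E" "x \<in> carrier L"
  shows "x \<otimes>\<^bsub>L\<^esub> range_proj S = (\<Oplus>\<^bsub>L\<^esub>e\<in>S. (x \<otimes>\<^bsub>L\<^esub> edge e) \<otimes>\<^bsub>L\<^esub> ghost e)"
proof -
  have "x \<otimes>\<^bsub>L\<^esub> range_proj S = (\<Oplus>\<^bsub>L\<^esub>e\<in>S. x \<otimes>\<^bsub>L\<^esub> (edge e \<otimes>\<^bsub>L\<^esub> ghost e))"
    unfolding range_proj_def by (rule L.finsum_mult_right) (use assms in auto)
  also have "\<dots> = (\<Oplus>\<^bsub>L\<^esub>e\<in>S. (x \<otimes>\<^bsub>L\<^esub> edge e) \<otimes>\<^bsub>L\<^esub> ghost e)"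
    by (rule L.M.finsum_cong') (use assms in \<open>auto simp: L.mult_assoc subset_iff\<close>)
  finally show ?thesis .
qed

lemma range_proj_homog:
  assumes "S \<subseteq> arcs E"
  shows "range_proj S \<in> homog L 0"
  unfolding range_proj_def using assms
proof (induction S rule: infinite_finite_induct)
  case (insert e S)
  then have "edge e \<otimes>\<^bsub>L\<^esub> ghost e \<in> homog L (1 + -1)"
    using gen_homog[of "Edge e"] gen_homog[of "Ghost e"] by (intro L.homog_mult) auto
  moreover have "(\<lambda>e. edge e \<otimes>\<^bsub>L\<^esub> ghost e) \<in> S \<rightarrow> carrier L" using insert by auto
  ultimately show ?case using insert by (simp add: L.homog_add L.homog_closed)
qed auto

lemma range_proj_edge:
  assumes S: "finite S" "S \<subseteq> arcs E" and e: "e \<in> S"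
  shows "range_proj S \<otimes>\<^bsub>L\<^esub> edge e = edge e"
proof -
  have ec: "e \<in> arcs E" using S e by auto
  have "range_proj S \<otimes>\<^bsub>L\<^esub> edge e = (\<Oplus>\<^bsub>L\<^esub>f\<in>S. edge f \<otimes>\<^bsub>L\<^esub> (ghost f \<otimes>\<^bsub>L\<^esub> edge e))"
    using S ec by (intro range_proj_mult) auto
  also have "\<dots> = edge e \<otimes>\<^bsub>L\<^esub> (ghost e \<otimes>\<^bsub>L\<^esub> edge e)"
    by (rule L.M.finsum_single[OF S(1) e]) (use S ec in \<open>auto simp: ghost_edge subset_iff\<close>)
  finally show ?thesis using ec by (simp add: ghost_edge edge_head)
qed

lemma ghost_range_proj:
  assumes S: "finite S" "S \<subseteq> arcs E" and e: "e \<in> S"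
  shows "ghost e \<otimes>\<^bsub>L\<^esub> range_proj S = ghost e"
proof -
  have ec: "e \<in> arcs E" using S e by auto
  have "ghost e \<otimes>\<^bsub>L\<^esub> range_proj S = (\<Oplus>\<^bsub>L\<^esub>f\<in>S. (ghost e \<otimes>\<^bsub>L\<^esub> edge f) \<otimes>\<^bsub>L\<^esub> ghost f)"
    using S ec by (intro mult_range_proj) auto
  also have "\<dots> = (ghost e \<otimes>\<^bsub>L\<^esub> edge e) \<otimes>\<^bsub>L\<^esub> ghost e"
    by (rule L.M.finsum_single[OF S(1) e]) (use S ec in \<open>auto simp: ghost_edge subset_iff\<close>)
  finally show ?thesis using ec by (simp add: ghost_edge head_ghost)
qed

lemma range_proj_absorb:
  assumes T: "finite T" "T \<subseteq> arcs E" and S: "S \<subseteq> T"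
  shows "range_proj T \<otimes>\<^bsub>L\<^esub> range_proj S = range_proj S"
    and "range_proj S \<otimes>\<^bsub>L\<^esub> range_proj T = range_proj S"
proof -
  have Sc: "S \<subseteq> arcs E" using S T by auto
  have "range_proj T \<otimes>\<^bsub>L\<^esub> range_proj S = (\<Oplus>\<^bsub>L\<^esub>e\<in>S. (range_proj T \<otimes>\<^bsub>L\<^esub> edge e) \<otimes>\<^bsub>L\<^esub> ghost e)"
    using T Sc by (intro mult_range_proj) auto
  also have "\<dots> = (\<Oplus>\<^bsub>L\<^esub>e\<in>S. edge e \<otimes>\<^bsub>L\<^esub> ghost e)"
    by (rule L.M.finsum_cong') (use T S Sc range_proj_edge[OF T] in auto)
  finally show "range_proj T \<otimes>\<^bsub>L\<^esub> range_proj S = range_proj S" by (simp add: range_proj_def)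
  have "range_proj S \<otimes>\<^bsub>L\<^esub> range_proj T = (\<Oplus>\<^bsub>L\<^esub>e\<in>S. edge e \<otimes>\<^bsub>L\<^esub> (ghost e \<otimes>\<^bsub>L\<^esub> range_proj T))"
    using T Sc by (intro range_proj_mult) auto
  also have "\<dots> = (\<Oplus>\<^bsub>L\<^esub>e\<in>S. edge e \<otimes>\<^bsub>L\<^esub> ghost e)"
    by (rule L.M.finsum_cong') (use T S Sc ghost_range_proj[OF T] in auto)
  finally show "range_proj S \<otimes>\<^bsub>L\<^esub> range_proj T = range_proj S" by (simp add: range_proj_def)
qed

lemma range_proj_enlarge:
  assumes T: "finite T" "T \<subseteq> arcs E" and S: "S \<subseteq> T" and x: "x \<in> carrier L"
  shows "range_proj S \<otimes>\<^bsub>L\<^esub> x = x \<Longrightarrow> range_proj T \<otimes>\<^bsub>L\<^esub> x = x"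
    and "x \<otimes>\<^bsub>L\<^esub> range_proj S = x \<Longrightarrow> x \<otimes>\<^bsub>L\<^esub> range_proj T = x"
proof -
  have c: "range_proj S \<in> carrier L" "range_proj T \<in> carrier L" using S T by auto
  show "range_proj T \<otimes>\<^bsub>L\<^esub> x = x" if "range_proj S \<otimes>\<^bsub>L\<^esub> x = x"
    using L.mult_assoc[OF c(2,1) x] that by (simp add: range_proj_absorb(1)[OF T S])
  show "x \<otimes>\<^bsub>L\<^esub> range_proj T = x" if "x \<otimes>\<^bsub>L\<^esub> range_proj S = x"
    using L.mult_assoc[OF x c] that by (simp add: range_proj_absorb(2)[OF T S])
qed

lemma corners_zero:
  assumes x: "x \<in> carrier L" and S: "S \<subseteq> arcs E"
    and corner: "\<And>e f. \<lbrakk>e \<in> arcs E; f \<in> arcs E\<rbrakk> \<Longrightarrow> ghost e \<otimes>\<^bsub>L\<^esub> (x \<otimes>\<^bsub>L\<^esub> edge f) = \<zero>\<^bsub>L\<^esub>"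
  shows "range_proj S \<otimes>\<^bsub>L\<^esub> (x \<otimes>\<^bsub>L\<^esub> range_proj S) = \<zero>\<^bsub>L\<^esub>"
proof -
  \<comment> \<open>Expand the projection on the right first, so that every summand contains a corner.\<close>
  have row: "ghost e \<otimes>\<^bsub>L\<^esub> (x \<otimes>\<^bsub>L\<^esub> range_proj S) = \<zero>\<^bsub>L\<^esub>" if e: "e \<in> arcs E" for e
  proof -
    have "ghost e \<otimes>\<^bsub>L\<^esub> (x \<otimes>\<^bsub>L\<^esub> range_proj S) = (ghost e \<otimes>\<^bsub>L\<^esub> x) \<otimes>\<^bsub>L\<^esub> range_proj S"
      using e x S by (simp add: L.mult_assoc)
    also have "\<dots> = (\<Oplus>\<^bsub>L\<^esub>f\<in>S. ((ghost e \<otimes>\<^bsub>L\<^esub> x) \<otimes>\<^bsub>L\<^esub> edge f) \<otimes>\<^bsub>L\<^esub> ghost f)"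
      using e x S by (intro mult_range_proj) auto
    also have "\<dots> = \<zero>\<^bsub>L\<^esub>"
      by (rule L.M.add.finprod_one_eqI) (use e x S corner in \<open>auto simp: L.mult_assoc subset_iff\<close>)
    finally show ?thesis .
  qed
  have "range_proj S \<otimes>\<^bsub>L\<^esub> (x \<otimes>\<^bsub>L\<^esub> range_proj S)
      = (\<Oplus>\<^bsub>L\<^esub>e\<in>S. edge e \<otimes>\<^bsub>L\<^esub> (ghost e \<otimes>\<^bsub>L\<^esub> (x \<otimes>\<^bsub>L\<^esub> range_proj S)))"
    using x S by (intro range_proj_mult) auto
  also have "\<dots> = \<zero>\<^bsub>L\<^esub>"
    by (rule L.M.add.finprod_one_eqI) (use S row in \<open>auto simp: subset_iff\<close>)
  finally show ?thesis .
qed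

text \<open>A monomial of positive degree starts with an edge, so the finitely many first edges of the monomials
  in \<open>x\<close> form a suitable \<open>S\<close>.\<close>

lemma left_local_unit:
  assumes "x \<in> homog L n" "0 < n"
  shows "\<exists>S. finite S \<and> S \<subseteq> arcs E \<and> range_proj S \<otimes>\<^bsub>L\<^esub> x = x"
  using assms(1)
proof (induction rule: lpa_induct)
  case zero
  then show ?case by (intro exI[of _ "{}"]) auto
next
  case (add x y)
  then obtain S T where S: "finite S" "S \<subseteq> arcs E" "range_proj S \<otimes>\<^bsub>L\<^esub> x = x"
    and T: "finite T" "T \<subseteq> arcs E" "range_proj T \<otimes>\<^bsub>L\<^esub> y = y" by blast
  have c: "x \<in> carrier L" "y \<in> carrier L" using add by auto
  have U: "finite (S \<union> T)" "S \<union> T \<subseteq> arcs E" using S T by auto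
  have "range_proj (S \<union> T) \<otimes>\<^bsub>L\<^esub> x = x" "range_proj (S \<union> T) \<otimes>\<^bsub>L\<^esub> y = y"
    using range_proj_enlarge(1)[OF U _ c(1) S(3)] range_proj_enlarge(1)[OF U _ c(2) T(3)] by auto
  then have "range_proj (S \<union> T) \<otimes>\<^bsub>L\<^esub> (x \<oplus>\<^bsub>L\<^esub> y) = x \<oplus>\<^bsub>L\<^esub> y"
    using c S T U by (simp add: L.mult_r_distr)
  then show ?case using U by blast
next
  case (word k w)
  then obtain i j where ij: "monomial i j (lpa_class K E (word K w))" "int i - int j = n"
    using word_monomial by blast
  have "i \<noteq> 0" using ij(2) \<open>0 < n\<close> by linarith
  then obtain i' where "i = Suc i'" using not0_implies_Suc by blast
  from monomial_split_left[OF ij(1) this] consider "lpa_class K E (word K w) = \<zero>\<^bsub>L\<^esub>"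
    | e m where "e \<in> arcs E" "monomial i' j m" "lpa_class K E (word K w) = edge e \<otimes>\<^bsub>L\<^esub> m" by blast
  then show ?case
  proof cases
    case 1
    then show ?thesis using word by (intro exI[of _ "{}"]) auto
  next
    case 2
    have "range_proj {e} \<otimes>\<^bsub>L\<^esub> (k \<odot>\<^bsub>L\<^esub> (edge e \<otimes>\<^bsub>L\<^esub> m)) = k \<odot>\<^bsub>L\<^esub> ((range_proj {e} \<otimes>\<^bsub>L\<^esub> edge e) \<otimes>\<^bsub>L\<^esub> m)"
      using 2 monomial_closed[OF 2(2)] word by (simp add: L.mult_smult_right L.mult_assoc)
    then show ?thesis using 2 by (intro exI[of _ "{e}"]) (auto simp: range_proj_edge)
  qed
qed

lemma right_local_unit:
  assumes "x \<in> homog L n" "n < 0"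
  shows "\<exists>S. finite S \<and> S \<subseteq> arcs E \<and> x \<otimes>\<^bsub>L\<^esub> range_proj S = x"
  using assms(1)
proof (induction rule: lpa_induct)
  case zero
  then show ?case by (intro exI[of _ "{}"]) auto
next
  case (add x y)
  then obtain S T where S: "finite S" "S \<subseteq> arcs E" "x \<otimes>\<^bsub>L\<^esub> range_proj S = x"
    and T: "finite T" "T \<subseteq> arcs E" "y \<otimes>\<^bsub>L\<^esub> range_proj T = y" by blast
  have c: "x \<in> carrier L" "y \<in> carrier L" using add by auto
  have U: "finite (S \<union> T)" "S \<union> T \<subseteq> arcs E" using S T by auto
  have "x \<otimes>\<^bsub>L\<^esub> range_proj (S \<union> T) = x" "y \<otimes>\<^bsub>L\<^esub> range_proj (S \<union> T) = y"
    using range_proj_enlarge(2)[OF U _ c(1) S(3)] range_proj_enlarge(2)[OF U _ c(2) T(3)] by auto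
  then have "(x \<oplus>\<^bsub>L\<^esub> y) \<otimes>\<^bsub>L\<^esub> range_proj (S \<union> T) = x \<oplus>\<^bsub>L\<^esub> y"
    using c S T U by (simp add: L.mult_l_distr)
  then show ?case using U by blast
next
  case (word k w)
  then obtain i j where ij: "monomial i j (lpa_class K E (word K w))" "int i - int j = n"
    using word_monomial by blast
  have "j \<noteq> 0" using ij(2) \<open>n < 0\<close> by linarith
  then obtain j' where "j = Suc j'" using not0_implies_Suc by blast
  from monomial_split_right[OF ij(1) this] consider "lpa_class K E (word K w) = \<zero>\<^bsub>L\<^esub>"
    | e m where "e \<in> arcs E" "monomial i j' m" "lpa_class K E (word K w) = m \<otimes>\<^bsub>L\<^esub> ghost e" by blast
  then show ?case
  proof cases
    case 1
    then show ?thesis using word by (intro exI[of _ "{}"]) auto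
  next
    case 2
    have "(k \<odot>\<^bsub>L\<^esub> (m \<otimes>\<^bsub>L\<^esub> ghost e)) \<otimes>\<^bsub>L\<^esub> range_proj {e} = k \<odot>\<^bsub>L\<^esub> (m \<otimes>\<^bsub>L\<^esub> (ghost e \<otimes>\<^bsub>L\<^esub> range_proj {e}))"
      using 2 monomial_closed[OF 2(2)] word by (simp add: L.mult_smult_left L.mult_assoc)
    then show ?thesis using 2 by (intro exI[of _ "{e}"]) (auto simp: ghost_range_proj)
  qed
qed

section \<open>The filtration of the degree zero part\<close>

text \<open>Level \<open>n\<close> is the span of the products of a path with a ghost path of the same length \<open>i \<le> n\<close>,
  built from the middle outwards.\<close>

inductive level :: "nat \<Rightarrow> (('v, 'e) lpa_generator list \<Rightarrow> 'k) set \<Rightarrow> bool" where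
  zero: "level n \<zero>\<^bsub>L\<^esub>"
| vertex: "k \<in> carrier K \<Longrightarrow> v \<in> verts E \<Longrightarrow> level n (k \<odot>\<^bsub>L\<^esub> vert v)"
| conj: "e \<in> arcs E \<Longrightarrow> f \<in> arcs E \<Longrightarrow> level n x \<Longrightarrow> level (Suc n) (edge e \<otimes>\<^bsub>L\<^esub> (x \<otimes>\<^bsub>L\<^esub> ghost f))"
| add: "level n x \<Longrightarrow> level n y \<Longrightarrow> level n (x \<oplus>\<^bsub>L\<^esub> y)"

lemma level_homog: "level n x \<Longrightarrow> x \<in> homog L 0"
proof (induction rule: level.induct)
  case (vertex k v n)
  then show ?case using gen_homog[of "Vertex v"] by (simp add: L.homog_smult)
next
  case (conj e f n x)
  then have "edge e \<otimes>\<^bsub>L\<^esub> (x \<otimes>\<^bsub>L\<^esub> ghost f) \<in> homog L (1 + (0 + -1))"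
    using gen_homog[of "Edge e"] gen_homog[of "Ghost f"] by (intro L.homog_mult) auto
  then show ?case by simp
qed (auto simp: L.homog_add)

lemma level_closed: "level n x \<Longrightarrow> x \<in> carrier L"
  using level_homog by auto

lemma level_Suc: "level n x \<Longrightarrow> level (Suc n) x"
  by (induction rule: level.induct) (auto intro: level.intros)

lemma level_mono: "level m x \<Longrightarrow> m \<le> n \<Longrightarrow> level n x"
  by (induction n) (auto simp: le_Suc_eq intro: level_Suc)

lemma level_smult:
  assumes k: "k \<in> carrier K"
  shows "level n x \<Longrightarrow> level n (k \<odot>\<^bsub>L\<^esub> x)"
proof (induction rule: level.induct)
  case (vertex l v n)
  then show ?case using k by (simp add: L.smult_assoc1[symmetric] level.vertex)
next
  case (conj e f n x)
  then have "level (Suc n) (edge e \<otimes>\<^bsub>L\<^esub> ((k \<odot>\<^bsub>L\<^esub> x) \<otimes>\<^bsub>L\<^esub> ghost f))" by (intro level.conj)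
  then show ?case using conj k level_closed[OF conj(3)]
    by (simp add: L.mult_smult_left L.mult_smult_right)
next
  case (add n x y)
  then show ?case using k level_closed by (simp add: L.smult_r_distr level.add)
qed (use k in \<open>auto intro: level.zero\<close>)

lemma monomial_level: "monomial n n m \<Longrightarrow> level n m"
proof (induction n arbitrary: m)
  case 0
  then show ?case
  proof cases
    case (vertex v)
    then show ?thesis using level.vertex[of \<one> v 0] by simp
  qed (auto intro: level.zero)
next
  case (Suc n)
  from monomial_split_left[OF Suc.prems refl] consider "m = \<zero>\<^bsub>L\<^esub>"
    | e m' where "e \<in> arcs E" "monomial n (Suc n) m'" "m = edge e \<otimes>\<^bsub>L\<^esub> m'" by blast
  then show ?case
  proof cases
    case 2
    from monomial_split_right[OF 2(2) refl] consider "m' = \<zero>\<^bsub>L\<^esub>"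
      | f m'' where "f \<in> arcs E" "monomial n n m''" "m' = m'' \<otimes>\<^bsub>L\<^esub> ghost f" by blast
    then show ?thesis
      by cases (use 2 Suc.IH in \<open>auto intro: level.zero level.conj\<close>)
  qed (simp add: level.zero)
qed

lemma degree_zero_level:
  assumes "x \<in> homog L 0"
  shows "\<exists>n. level n x"
  using assms
proof (induction rule: lpa_induct)
  case (add x y)
  then obtain m n where "level m x" "level n y" by blast
  then have "level (max m n) x" "level (max m n) y" using level_mono by (meson max.cobounded1 max.cobounded2)+
  then show ?case using level.add by blast
next
  case (word k w)
  then obtain i j where "monomial i j (lpa_class K E (word K w))" "int i - int j = 0"
    using word_monomial by metis
  then have "level i (lpa_class K E (word K w))" using monomial_level by simp
  then show ?case using word level_smult by blast
qed (auto intro: level.zero)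

lemma vert_level:
  assumes v: "v \<in> verts E"
  shows "level n x \<Longrightarrow> level n (vert v \<otimes>\<^bsub>L\<^esub> x)"
proof (induction rule: level.induct)
  case (conj e f n x)
  then show ?case using v level_closed[OF conj(3)]
    by (auto simp: L.mult_assoc[symmetric] vert_edge) (auto simp: L.mult_assoc intro: level.intros)
qed (use v level_closed in \<open>auto simp: L.mult_smult_right L.mult_r_distr vert_vert intro: level.intros\<close>)

lemma level_vert:
  assumes v: "v \<in> verts E"
  shows "level n x \<Longrightarrow> level n (x \<otimes>\<^bsub>L\<^esub> vert v)"
proof (induction rule: level.induct)
  case (conj e f n x)
  then show ?case using v level_closed[OF conj(3)]
    by (auto simp: L.mult_assoc ghost_vert intro: level.intros)
qed (use v level_closed in \<open>auto simp: L.mult_smult_left L.mult_l_distr vert_vert intro: level.intros\<close>)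

text \<open>Outer edges are stripped off, leaving at most vertices around the middle; a vertex term becomes a
  vertex or zero, which is why level \<open>Suc n\<close> drops to \<open>n\<close>.\<close>

lemma level_corner:
  assumes e: "e \<in> arcs E" "f \<in> arcs E"
  shows "level m x \<Longrightarrow> m = Suc n \<Longrightarrow> level n (ghost e \<otimes>\<^bsub>L\<^esub> (x \<otimes>\<^bsub>L\<^esub> edge f))"
proof (induction rule: level.induct)
  case (vertex k v m)
  have "ghost e \<otimes>\<^bsub>L\<^esub> ((k \<odot>\<^bsub>L\<^esub> vert v) \<otimes>\<^bsub>L\<^esub> edge f) = k \<odot>\<^bsub>L\<^esub> (ghost e \<otimes>\<^bsub>L\<^esub> (vert v \<otimes>\<^bsub>L\<^esub> edge f))"
    using vertex e by (simp add: L.mult_smult_left L.mult_smult_right)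
  then show ?case using vertex e by (auto simp: vert_edge ghost_edge intro: level.intros)
next
  case (conj e' f' m x)
  have x: "x \<in> carrier L" "level n x" using conj level_closed by auto
  have "ghost e \<otimes>\<^bsub>L\<^esub> ((edge e' \<otimes>\<^bsub>L\<^esub> (x \<otimes>\<^bsub>L\<^esub> ghost f')) \<otimes>\<^bsub>L\<^esub> edge f)
      = (ghost e \<otimes>\<^bsub>L\<^esub> edge e') \<otimes>\<^bsub>L\<^esub> (x \<otimes>\<^bsub>L\<^esub> (ghost f' \<otimes>\<^bsub>L\<^esub> edge f))"
    using conj e x by (simp add: L.mult_assoc)
  then show ?case using conj e x
    by (auto simp: ghost_edge intro: level.zero intro!: vert_level level_vert)
next
  case (add m x y)
  have "x \<in> carrier L" "y \<in> carrier L" using add level_closed by auto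
  then show ?case using add e by (auto simp: L.mult_l_distr L.mult_r_distr intro: level.add)
qed (use e in \<open>auto intro: level.zero\<close>)

text \<open>Terms of length zero are collected in \<open>c\<close> and the others in \<open>d\<close>; \<open>S\<close> consists of the
  outermost edges of the latter.\<close>

lemma level_decompose:
  "level n x \<Longrightarrow> \<exists>c d S. level 0 c \<and> d \<in> carrier L \<and> x = c \<oplus>\<^bsub>L\<^esub> d \<and> finite S \<and> S \<subseteq> arcs E \<and>
    range_proj S \<otimes>\<^bsub>L\<^esub> (d \<otimes>\<^bsub>L\<^esub> range_proj S) = d"
proof (induction rule: level.induct)
  case (zero n)
  show ?case by (intro exI[of _ "\<zero>\<^bsub>L\<^esub>"] exI[of _ "{}"]) (auto intro: level.zero)
next
  case (vertex k v n)
  then show ?case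
    by (intro exI[of _ "k \<odot>\<^bsub>L\<^esub> vert v"] exI[of _ "\<zero>\<^bsub>L\<^esub>"] exI[of _ "{}"]) (auto intro: level.vertex)
next
  case (conj e f n x)
  have x: "x \<in> carrier L" using conj level_closed by auto
  let ?S = "{e, f}"
  have "range_proj ?S \<otimes>\<^bsub>L\<^esub> ((edge e \<otimes>\<^bsub>L\<^esub> (x \<otimes>\<^bsub>L\<^esub> ghost f)) \<otimes>\<^bsub>L\<^esub> range_proj ?S)
      = (range_proj ?S \<otimes>\<^bsub>L\<^esub> edge e) \<otimes>\<^bsub>L\<^esub> (x \<otimes>\<^bsub>L\<^esub> (ghost f \<otimes>\<^bsub>L\<^esub> range_proj ?S))"
    using conj x by (simp add: L.mult_assoc)
  also have "\<dots> = edge e \<otimes>\<^bsub>L\<^esub> (x \<otimes>\<^bsub>L\<^esub> ghost f)"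
    using conj by (simp add: range_proj_edge ghost_range_proj)
  finally show ?case using conj x
    by (intro exI[of _ "\<zero>\<^bsub>L\<^esub>"] exI[of _ "edge e \<otimes>\<^bsub>L\<^esub> (x \<otimes>\<^bsub>L\<^esub> ghost f)"] exI[of _ ?S]) (auto intro: level.zero)
next
  case (add n x y)
  then obtain c d S c' d' T where
    S: "level 0 c" "d \<in> carrier L" "x = c \<oplus>\<^bsub>L\<^esub> d" "finite S" "S \<subseteq> arcs E"
      "range_proj S \<otimes>\<^bsub>L\<^esub> (d \<otimes>\<^bsub>L\<^esub> range_proj S) = d" and
    T: "level 0 c'" "d' \<in> carrier L" "y = c' \<oplus>\<^bsub>L\<^esub> d'" "finite T" "T \<subseteq> arcs E"
      "range_proj T \<otimes>\<^bsub>L\<^esub> (d' \<otimes>\<^bsub>L\<^esub> range_proj T) = d'" by metis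
  let ?U = "S \<union> T"
  have U: "finite ?U" "?U \<subseteq> arcs E" using S T by auto
  \<comment> \<open>Elements cut down by a smaller projection are also cut down by the larger one.\<close>
  have enlarge: "range_proj ?U \<otimes>\<^bsub>L\<^esub> (a \<otimes>\<^bsub>L\<^esub> range_proj ?U) = a"
    if a: "a \<in> carrier L" "range_proj W \<otimes>\<^bsub>L\<^esub> (a \<otimes>\<^bsub>L\<^esub> range_proj W) = a" and W: "W \<subseteq> ?U" for a W
  proof -
    have Wc: "W \<subseteq> arcs E" using W U by auto
    have "range_proj ?U \<otimes>\<^bsub>L\<^esub> ((range_proj W \<otimes>\<^bsub>L\<^esub> (a \<otimes>\<^bsub>L\<^esub> range_proj W)) \<otimes>\<^bsub>L\<^esub> range_proj ?U)
        = (range_proj ?U \<otimes>\<^bsub>L\<^esub> range_proj W) \<otimes>\<^bsub>L\<^esub> (a \<otimes>\<^bsub>L\<^esub> (range_proj W \<otimes>\<^bsub>L\<^esub> range_proj ?U))"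
      using a(1) Wc U by (simp add: L.mult_assoc)
    then show ?thesis using a by (simp add: range_proj_absorb[OF U W])
  qed
  have "c \<in> carrier L" "c' \<in> carrier L" using S T level_closed by auto
  then have "x \<oplus>\<^bsub>L\<^esub> y = (c \<oplus>\<^bsub>L\<^esub> c') \<oplus>\<^bsub>L\<^esub> (d \<oplus>\<^bsub>L\<^esub> d')" using S T by (simp add: L.M.a_ac)
  moreover have "range_proj ?U \<otimes>\<^bsub>L\<^esub> ((d \<oplus>\<^bsub>L\<^esub> d') \<otimes>\<^bsub>L\<^esub> range_proj ?U) = d \<oplus>\<^bsub>L\<^esub> d'"
    using S T U enlarge[of d S] enlarge[of d' T] by (simp add: L.mult_l_distr L.mult_r_distr)
  ultimately show ?case using S T U level.add
    by (intro exI[of _ "c \<oplus>\<^bsub>L\<^esub> c'"] exI[of _ "d \<oplus>\<^bsub>L\<^esub> d'"] exI[of _ ?U]) auto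
qed

section \<open>The identity element\<close>

lemma one_eq: "\<one>\<^bsub>L\<^esub> = (\<Oplus>\<^bsub>L\<^esub>v\<in>verts E. vert v)"
proof -
  interpret q: abelian_group_hom F L "lpa_class K E" by (rule lpa_class_additive)
  have "\<one>\<^bsub>L\<^esub> = lpa_class K E (\<Oplus>\<^bsub>F\<^esub>v\<in>verts E. word K [Vertex v])"
    by (simp add: leavitt_path_algebra_def)
  also have "\<dots> = (\<Oplus>\<^bsub>L\<^esub>v\<in>verts E. vert v)"
    unfolding gen_def by (rule q.hom_finsum) auto
  finally show ?thesis .
qed

lemma one_homog: "\<one>\<^bsub>L\<^esub> \<in> homog L 0"
proof -
  have "(\<Oplus>\<^bsub>L\<^esub>v\<in>S. vert v) \<in> homog L 0" if "S \<subseteq> verts E" for S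
    using that
  proof (induction S rule: infinite_finite_induct)
    case (insert v S)
    then have "vert v \<in> homog L 0" using gen_homog[of "Vertex v"] by simp
    moreover have "(\<lambda>v. vert v) \<in> S \<rightarrow> carrier L" using insert by auto
    ultimately show ?case using insert by (simp add: L.homog_add L.homog_closed)
  qed auto
  then show ?thesis by (simp add: one_eq)
qed

text \<open>Every generator absorbs some vertex on either side, so it is enough to multiply by vertices.\<close>

lemma one_is_identity:
  assumes fin: "finite (verts E)"
  shows "is_identity L \<one>\<^bsub>L\<^esub>"
proof -
  have one: "\<one>\<^bsub>L\<^esub> \<in> carrier L" using one_homog by auto
  have v: "\<one>\<^bsub>L\<^esub> \<otimes>\<^bsub>L\<^esub> vert w = vert w" "vert w \<otimes>\<^bsub>L\<^esub> \<one>\<^bsub>L\<^esub> = vert w" if w: "w \<in> verts E" for w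
  proof -
    have "\<one>\<^bsub>L\<^esub> \<otimes>\<^bsub>L\<^esub> vert w = (\<Oplus>\<^bsub>L\<^esub>v\<in>verts E. vert v \<otimes>\<^bsub>L\<^esub> vert w)"
      unfolding one_eq by (rule L.finsum_mult_left) (use w in auto)
    also have "\<dots> = vert w \<otimes>\<^bsub>L\<^esub> vert w"
      by (rule L.M.finsum_single[OF fin w]) (use w in \<open>auto simp: vert_vert\<close>)
    finally show "\<one>\<^bsub>L\<^esub> \<otimes>\<^bsub>L\<^esub> vert w = vert w" using w by (simp add: vert_vert)
    have "vert w \<otimes>\<^bsub>L\<^esub> \<one>\<^bsub>L\<^esub> = (\<Oplus>\<^bsub>L\<^esub>v\<in>verts E. vert w \<otimes>\<^bsub>L\<^esub> vert v)"
      unfolding one_eq by (rule L.finsum_mult_right) (use w in auto)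
    also have "\<dots> = vert w \<otimes>\<^bsub>L\<^esub> vert w"
      by (rule L.M.finsum_single[OF fin w]) (use w in \<open>auto simp: vert_vert\<close>)
    finally show "vert w \<otimes>\<^bsub>L\<^esub> \<one>\<^bsub>L\<^esub> = vert w" using w by (simp add: vert_vert)
  qed
  have absorb: "\<one>\<^bsub>L\<^esub> \<otimes>\<^bsub>L\<^esub> x = x"
    if "vert w \<otimes>\<^bsub>L\<^esub> x = x" "w \<in> verts E" "x \<in> carrier L" for w x
  proof -
    have "(\<one>\<^bsub>L\<^esub> \<otimes>\<^bsub>L\<^esub> vert w) \<otimes>\<^bsub>L\<^esub> x = \<one>\<^bsub>L\<^esub> \<otimes>\<^bsub>L\<^esub> (vert w \<otimes>\<^bsub>L\<^esub> x)"
      using that(2,3) one by (intro L.mult_assoc) auto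
    then show ?thesis using that(1,2) by (simp add: v)
  qed
  have absorb': "x \<otimes>\<^bsub>L\<^esub> \<one>\<^bsub>L\<^esub> = x"
    if "x \<otimes>\<^bsub>L\<^esub> vert w = x" "w \<in> verts E" "x \<in> carrier L" for w x
  proof -
    have "(x \<otimes>\<^bsub>L\<^esub> vert w) \<otimes>\<^bsub>L\<^esub> \<one>\<^bsub>L\<^esub> = x \<otimes>\<^bsub>L\<^esub> vert w"
      using that(2,3) one by (simp add: L.mult_assoc v)
    then show ?thesis using that by simp
  qed
  have g: "\<one>\<^bsub>L\<^esub> \<otimes>\<^bsub>L\<^esub> gen x = gen x" "gen x \<otimes>\<^bsub>L\<^esub> \<one>\<^bsub>L\<^esub> = gen x" if x: "x \<in> gens" for x
  proof -
    show "\<one>\<^bsub>L\<^esub> \<otimes>\<^bsub>L\<^esub> gen x = gen x"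
    proof (cases x)
      case (Vertex w)
      then show ?thesis using x by (simp add: v)
    next
      case (Edge e)
      then show ?thesis using x by (intro absorb[of "tail E e"]) (auto simp: tail_edge)
    next
      case (Ghost e)
      then show ?thesis using x by (intro absorb[of "head E e"]) (auto simp: head_ghost)
    qed
    show "gen x \<otimes>\<^bsub>L\<^esub> \<one>\<^bsub>L\<^esub> = gen x"
    proof (cases x)
      case (Vertex w)
      then show ?thesis using x by (simp add: v)
    next
      case (Edge e)
      then show ?thesis using x by (intro absorb'[of _ "head E e"]) (auto simp: edge_head)
    next
      case (Ghost e)
      then show ?thesis using x by (intro absorb'[of _ "tail E e"]) (auto simp: ghost_tail)
    qed
  qed
  have word: "\<one>\<^bsub>L\<^esub> \<otimes>\<^bsub>L\<^esub> lpa_class K E (word K w) = lpa_class K E (word K w) \<and>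
      lpa_class K E (word K w) \<otimes>\<^bsub>L\<^esub> \<one>\<^bsub>L\<^esub> = lpa_class K E (word K w)"
    if "w \<noteq> []" "set w \<subseteq> gens" for w
    using that
  proof (induction w rule: list_nonempty_induct)
    case (single x)
    then show ?case using g by (simp add: gen_def[symmetric])
  next
    case (cons x w)
    then have w: "lpa_class K E (word K w) \<in> carrier L" "x \<in> gens"
      by (auto intro: lpa_class_simps(1))
    have "lpa_class K E (word K (x # w)) = gen x \<otimes>\<^bsub>L\<^esub> lpa_class K E (word K w)"
      using cons by (intro lpa_class_Cons) auto
    moreover have "\<one>\<^bsub>L\<^esub> \<otimes>\<^bsub>L\<^esub> (gen x \<otimes>\<^bsub>L\<^esub> lpa_class K E (word K w)) = gen x \<otimes>\<^bsub>L\<^esub> lpa_class K E (word K w)"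
      using w one by (simp add: L.mult_assoc[symmetric] g)
    moreover have "(gen x \<otimes>\<^bsub>L\<^esub> lpa_class K E (word K w)) \<otimes>\<^bsub>L\<^esub> \<one>\<^bsub>L\<^esub> = gen x \<otimes>\<^bsub>L\<^esub> lpa_class K E (word K w)"
      using w one cons by (simp add: L.mult_assoc)
    ultimately show ?case by simp
  qed
  have "\<one>\<^bsub>L\<^esub> \<otimes>\<^bsub>L\<^esub> x = x \<and> x \<otimes>\<^bsub>L\<^esub> \<one>\<^bsub>L\<^esub> = x" if "x \<in> carrier L" for x
    using that
  proof (induction x rule: L.homog_induct)
    case (homog n x)
    then show ?case
    proof (induction rule: lpa_induct)
      case (add x y)
      then show ?case using one by (simp add: L.mult_l_distr L.mult_r_distr L.homog_closed)
    next
      case (word k w)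
      have "lpa_class K E (word K w) \<in> carrier L" using word by (auto intro: lpa_class_simps(1))
      then show ?case using word one \<open>\<And>w. \<lbrakk>w \<noteq> []; set w \<subseteq> gens\<rbrakk> \<Longrightarrow> _\<close>
        by (simp add: L.mult_smult_left L.mult_smult_right)
    qed (use one in simp)
  next
    case (add x y)
    then show ?case using one by (simp add: L.mult_l_distr L.mult_r_distr)
  qed
  then show ?thesis using one by (simp add: is_identity_def)
qed

end

section \<open>The homomorphism into the twist\<close>

locale leavitt_twist = leavitt E K + Z: zhang_twisted_algebra K "leavitt_path_algebra K E" \<phi>
  for E :: "('v, 'e) pre_digraph" and K :: "('k, 'm) ring_scheme" (structure) and \<phi> +
  assumes fix_vertices: "v \<in> verts E \<Longrightarrow> \<phi> (vert v) = vert v"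
begin

fun twisted_gen :: "('v, 'e) lpa_generator \<Rightarrow> (('v, 'e) lpa_generator list \<Rightarrow> 'k) set" where
  "twisted_gen (Vertex v) = vert v"
| "twisted_gen (Edge e) = edge e"
| "twisted_gen (Ghost e) = Z.\<phi>inv (ghost e)"

lemma \<phi>inv_vert: "v \<in> verts E \<Longrightarrow> Z.\<phi>inv (vert v) = vert v"
  by (rule Z.\<phi>inv_eqI) (auto simp: fix_vertices)

lemmas \<phi>inv_mult = algebra_homD(4)[OF graded_algebra_homD(1)[OF Z.\<phi>inv_graded]]

lemma twisted_gen_homog: "x \<in> gens \<Longrightarrow> twisted_gen x \<in> homog L (generator_degree x)"
  using gen_homog[of x] graded_algebra_homD(2)[OF Z.\<phi>inv_graded] by (cases x) auto

lemma twisted_gen_closed: "x \<in> gens \<Longrightarrow> twisted_gen x \<in> carrier L"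
  using twisted_gen_homog by auto

lemma twist_vert: "v \<in> verts E \<Longrightarrow> b \<in> carrier L \<Longrightarrow> vert v \<otimes>\<^bsub>Z.twist\<^esub> b = vert v \<otimes>\<^bsub>L\<^esub> b"
  using Z.twist_mult_homog[OF gen_homog[of "Vertex v"]] by simp

lemma twist_edge: "e \<in> arcs E \<Longrightarrow> b \<in> carrier L \<Longrightarrow> edge e \<otimes>\<^bsub>Z.twist\<^esub> b = edge e \<otimes>\<^bsub>L\<^esub> \<phi> b"
  using Z.twist_mult_homog[OF gen_homog[of "Edge e"]] by simp

lemma twist_ghost:
  assumes e: "e \<in> arcs E" and b: "b \<in> carrier L"
  shows "Z.\<phi>inv (ghost e) \<otimes>\<^bsub>Z.twist\<^esub> b = Z.\<phi>inv (ghost e \<otimes>\<^bsub>L\<^esub> b)"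
  using Z.twist_mult_homog[OF twisted_gen_homog[of "Ghost e"] b] e b by (simp add: \<phi>inv_mult)

text \<open>\<open>\<phi>\<inverse>(e*) \<star> f = \<phi>\<inverse>(e* f)\<close> and \<open>e \<star> \<phi>\<inverse>(e*) = e e*\<close> reduce each relation to the same relation in
  \<open>L\<close>, up to applying \<open>\<phi>\<close> or its inverse to vertices.\<close>

lemma twisted_family: "leavitt_family E Z.twist twisted_gen"
proof -
  have "Z.\<phi>inv \<zero>\<^bsub>L\<^esub> = \<zero>\<^bsub>L\<^esub>"
    using abelian_group_hom.hom_zero[OF algebra_hom_additive[OF graded_algebra_homD(1)[OF Z.\<phi>inv_graded]
      L.M.abelian_group_axioms L.M.abelian_group_axioms]] .
  moreover have "vert v = (\<Oplus>\<^bsub>L\<^esub>e\<in>out_arcs E v. edge e \<otimes>\<^bsub>Z.twist\<^esub> Z.\<phi>inv (ghost e))"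
    if v: "regular_vertex E v" for v
  proof -
    have "(\<Oplus>\<^bsub>L\<^esub>e\<in>out_arcs E v. edge e \<otimes>\<^bsub>Z.twist\<^esub> Z.\<phi>inv (ghost e))
        = (\<Oplus>\<^bsub>L\<^esub>e\<in>out_arcs E v. edge e \<otimes>\<^bsub>L\<^esub> ghost e)"
      by (rule L.M.finsum_cong') (auto simp: twist_edge)
    then show ?thesis using regular_vert[OF v] by simp
  qed
  moreover have "Z.\<phi>inv (ghost e) \<otimes>\<^bsub>Z.twist\<^esub> vert (tail E e) = Z.\<phi>inv (ghost e)" if "e \<in> arcs E" for e
    using that by (simp add: twist_ghost ghost_tail)
  moreover have "vert (head E e) \<otimes>\<^bsub>Z.twist\<^esub> Z.\<phi>inv (ghost e) = Z.\<phi>inv (ghost e)" if "e \<in> arcs E" for e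
    using that \<phi>inv_mult[of "vert (head E e)" "ghost e"]
    by (simp add: twist_vert head_ghost \<phi>inv_vert)
  ultimately show ?thesis
    unfolding leavitt_family_def
    by (auto simp: twisted_gen_closed twist_vert twist_edge twist_ghost vert_vert tail_edge edge_head
        fix_vertices ghost_edge \<phi>inv_vert)
qed

context
  fixes \<Psi>
  assumes \<Psi>: "\<Psi> \<in> algebra_hom K L Z.twist" and \<Psi>_gen: "\<And>x. x \<in> gens \<Longrightarrow> \<Psi> (gen x) = twisted_gen x"
begin

lemmas \<Psi>D = algebra_homD[OF \<Psi>, unfolded Z.twist_simps]

lemma \<Psi>_additive: "abelian_group_hom L L \<Psi>"
  by (rule abelian_group_homI_additive) (use \<Psi>D L.M.abelian_group_axioms in auto)

lemma \<Psi>_zero [simp]: "\<Psi> \<zero>\<^bsub>L\<^esub> = \<zero>\<^bsub>L\<^esub>"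
  by (rule abelian_group_hom.hom_zero[OF \<Psi>_additive])

lemma \<Psi>_homog: "x \<in> homog L n \<Longrightarrow> \<Psi> x \<in> homog L n"
proof (induction rule: lpa_induct)
  case (word k w)
  have c: "lpa_class K E (word K u) \<in> carrier L" if "u \<noteq> []" "set u \<subseteq> gens" for u
    using that by (auto intro: lpa_class_simps(1))
  have "\<Psi> (lpa_class K E (word K w)) \<in> homog L (word_degree w)" using word(2,3)
  proof (induction w rule: list_nonempty_induct)
    case (single x)
    then show ?case using \<Psi>_gen[of x] twisted_gen_homog[of x] by (simp add: gen_def)
  next
    case (cons x w)
    then show ?case using c[of w] twisted_gen_homog[of x]
      by (simp add: lpa_class_Cons \<Psi>D \<Psi>_gen Z.twist_homog_mult)
  qed
  then show ?case using word c by (simp add: \<Psi>D L.homog_smult)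
qed (auto simp: \<Psi>D L.homog_add L.homog_closed)

lemma \<Psi>_graded: "\<Psi> \<in> graded_algebra_hom K L Z.twist"
  using \<Psi> \<Psi>_homog by (auto simp: graded_algebra_hom_def)

lemma \<Psi>_range_proj:
  assumes S: "S \<subseteq> arcs E"
  shows "\<Psi> (range_proj S) = range_proj S"
proof -
  have "\<Psi> (range_proj S) = (\<Oplus>\<^bsub>L\<^esub>e\<in>S. \<Psi> (edge e \<otimes>\<^bsub>L\<^esub> ghost e))"
    unfolding range_proj_def
    by (rule abelian_group_hom.hom_finsum[OF \<Psi>_additive]) (use S in auto)
  also have "\<dots> = (\<Oplus>\<^bsub>L\<^esub>e\<in>S. edge e \<otimes>\<^bsub>L\<^esub> ghost e)"
    by (rule L.M.finsum_cong') (use S in \<open>auto simp: subset_iff \<Psi>D \<Psi>_gen twist_edge\<close>)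
  finally show ?thesis by (simp add: range_proj_def)
qed

lemma \<Psi>_level_0: "level n c \<Longrightarrow> n = 0 \<Longrightarrow> \<Psi> c = c"
  by (induction rule: level.induct) (auto simp: \<Psi>D \<Psi>_gen level_closed)

text \<open>By the induction hypothesis all corners \<open>e* x f\<close> vanish, which leaves \<open>x = c - p c p\<close> with \<open>c\<close>
  a combination of vertices, an element that \<open>\<Psi>\<close> fixes.\<close>

lemma kernel_level: "level n x \<Longrightarrow> \<Psi> x = \<zero>\<^bsub>L\<^esub> \<Longrightarrow> x = \<zero>\<^bsub>L\<^esub>"
proof (induction n arbitrary: x)
  case 0
  then show ?case using \<Psi>_level_0 by metis
next
  case (Suc n)
  have x: "x \<in> carrier L" using Suc level_closed by auto
  have corner: "ghost e \<otimes>\<^bsub>L\<^esub> (x \<otimes>\<^bsub>L\<^esub> edge f) = \<zero>\<^bsub>L\<^esub>" if e: "e \<in> arcs E" "f \<in> arcs E" for e f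
  proof (rule Suc.IH)
    show "level n (ghost e \<otimes>\<^bsub>L\<^esub> (x \<otimes>\<^bsub>L\<^esub> edge f))" using level_corner[OF e Suc.prems(1)] by simp
    interpret T: assoc_algebra K Z.twist by (rule Z.twist_assoc_algebra)
    show "\<Psi> (ghost e \<otimes>\<^bsub>L\<^esub> (x \<otimes>\<^bsub>L\<^esub> edge f)) = \<zero>\<^bsub>L\<^esub>"
      using e x Suc.prems(2) T.mult_zero_left T.mult_zero_right by (simp add: \<Psi>D \<Psi>_gen)
  qed
  obtain c d S where S: "level 0 c" "d \<in> carrier L" "x = c \<oplus>\<^bsub>L\<^esub> d" "finite S" "S \<subseteq> arcs E"
    "range_proj S \<otimes>\<^bsub>L\<^esub> (d \<otimes>\<^bsub>L\<^esub> range_proj S) = d"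
    using level_decompose[OF Suc.prems(1)] by blast
  define p where "p = range_proj S"
  have p: "p \<in> homog L 0" "p \<in> carrier L" "\<Psi> p = p"
    using S range_proj_homog \<Psi>_range_proj by (auto simp: p_def)
  have c: "c \<in> homog L 0" "c \<in> carrier L" "\<Psi> c = c"
    using S(1) level_homog level_closed \<Psi>_level_0 by auto
  have pcp: "p \<otimes>\<^bsub>L\<^esub> (c \<otimes>\<^bsub>L\<^esub> p) \<in> carrier L" using p c by auto
  have "\<zero>\<^bsub>L\<^esub> = p \<otimes>\<^bsub>L\<^esub> (x \<otimes>\<^bsub>L\<^esub> p)" using corners_zero[OF x S(5) corner] by (simp add: p_def)
  also have "\<dots> = p \<otimes>\<^bsub>L\<^esub> (c \<otimes>\<^bsub>L\<^esub> p) \<oplus>\<^bsub>L\<^esub> d"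
    using S p c unfolding S(3) by (simp add: L.mult_l_distr L.mult_r_distr flip: p_def)
  finally have "d = \<ominus>\<^bsub>L\<^esub> (p \<otimes>\<^bsub>L\<^esub> (c \<otimes>\<^bsub>L\<^esub> p))"
    using S(2) pcp L.M.minus_equality L.M.a_comm by metis
  then have xe: "x = c \<oplus>\<^bsub>L\<^esub> (\<ominus>\<^bsub>L\<^esub> (p \<otimes>\<^bsub>L\<^esub> (c \<otimes>\<^bsub>L\<^esub> p)))" using S(3) by simp
  have "\<Psi> (p \<otimes>\<^bsub>L\<^esub> (c \<otimes>\<^bsub>L\<^esub> p)) = p \<otimes>\<^bsub>L\<^esub> (c \<otimes>\<^bsub>L\<^esub> p)"
    using p c by (simp add: \<Psi>D Z.twist_mult_homog)
  then have "\<Psi> x = x"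
    unfolding xe using c pcp abelian_group_hom.hom_a_inv[OF \<Psi>_additive] by (simp add: \<Psi>D)
  then show ?case using Suc.prems(2) by simp
qed

text \<open>Multiplication by \<open>e*\<close> lowers the degree, and \<open>x\<close> is recovered from all \<open>e* x\<close> by a left
  local unit.\<close>

lemma kernel_nonneg: "x \<in> homog L (int n) \<Longrightarrow> \<Psi> x = \<zero>\<^bsub>L\<^esub> \<Longrightarrow> x = \<zero>\<^bsub>L\<^esub>"
proof (induction n arbitrary: x)
  case 0
  then show ?case using degree_zero_level kernel_level by auto
next
  case (Suc n)
  interpret T: assoc_algebra K Z.twist by (rule Z.twist_assoc_algebra)
  have x: "x \<in> carrier L" using Suc by auto
  have z: "ghost e \<otimes>\<^bsub>L\<^esub> x = \<zero>\<^bsub>L\<^esub>" if e: "e \<in> arcs E" for e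
  proof (rule Suc.IH)
    show "ghost e \<otimes>\<^bsub>L\<^esub> x \<in> homog L (int n)"
      using L.homog_mult[OF gen_homog[of "Ghost e"] Suc.prems(1)] e by simp
    show "\<Psi> (ghost e \<otimes>\<^bsub>L\<^esub> x) = \<zero>\<^bsub>L\<^esub>"
      using e x Suc.prems(2) T.mult_zero_right by (simp add: \<Psi>D \<Psi>_gen)
  qed
  obtain S where S: "S \<subseteq> arcs E" "range_proj S \<otimes>\<^bsub>L\<^esub> x = x"
    using left_local_unit[OF Suc.prems(1)] by auto
  have "range_proj S \<otimes>\<^bsub>L\<^esub> x = \<zero>\<^bsub>L\<^esub>"
    unfolding range_proj_mult[OF S(1) x]
    by (rule L.M.add.finprod_one_eqI) (use S z in \<open>auto simp: subset_iff\<close>)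
  then show ?case using S by simp
qed

lemma kernel_nonpos: "x \<in> homog L (- int n) \<Longrightarrow> \<Psi> x = \<zero>\<^bsub>L\<^esub> \<Longrightarrow> x = \<zero>\<^bsub>L\<^esub>"
proof (induction n arbitrary: x)
  case 0
  then show ?case using degree_zero_level kernel_level by auto
next
  case (Suc n)
  interpret T: assoc_algebra K Z.twist by (rule Z.twist_assoc_algebra)
  have x: "x \<in> carrier L" using Suc by auto
  have z: "x \<otimes>\<^bsub>L\<^esub> edge e = \<zero>\<^bsub>L\<^esub>" if e: "e \<in> arcs E" for e
  proof (rule Suc.IH)
    show "x \<otimes>\<^bsub>L\<^esub> edge e \<in> homog L (- int n)"
      using L.homog_mult[OF Suc.prems(1) gen_homog[of "Edge e"]] e by simp
    show "\<Psi> (x \<otimes>\<^bsub>L\<^esub> edge e) = \<zero>\<^bsub>L\<^esub>"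
      using e x Suc.prems(2) T.mult_zero_left by (simp add: \<Psi>D \<Psi>_gen)
  qed
  obtain S where S: "S \<subseteq> arcs E" "x \<otimes>\<^bsub>L\<^esub> range_proj S = x"
    using right_local_unit[OF Suc.prems(1)] by auto
  have "x \<otimes>\<^bsub>L\<^esub> range_proj S = \<zero>\<^bsub>L\<^esub>"
    unfolding mult_range_proj[OF S(1) x]
    by (rule L.M.add.finprod_one_eqI) (use S z in \<open>auto simp: subset_iff\<close>)
  then show ?case using S by simp
qed

lemma \<Psi>_inj: "inj_on \<Psi> (carrier L)"
proof (rule abelian_group_hom.injI[OF \<Psi>_additive])
  fix x assume x: "x \<in> carrier L" "\<Psi> x = \<zero>\<^bsub>L\<^esub>"
  have "L.component x n = \<zero>\<^bsub>L\<^esub>" for n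
  proof -
    have "\<Psi> (L.component x n) = L.component (\<Psi> x) n"
      by (subst L.component_graded_map[OF \<Psi>_additive _ x(1)]) (use \<Psi>_homog in auto)
    also have "\<dots> = \<zero>\<^bsub>L\<^esub>" using x(2) by (simp add: L.component_of_homog[OF L.homog_zero[of n]])
    finally have "\<Psi> (L.component x n) = \<zero>\<^bsub>L\<^esub>" .
    then show ?thesis
      using L.component_homog[OF x(1), of n] kernel_nonneg kernel_nonpos by (cases n rule: int_cases2) auto
  qed
  then have "(\<Oplus>\<^bsub>L\<^esub>n\<in>{}. L.component x n) = x"
    by (intro L.sum_components_superset[OF x(1)]) auto
  then show "x = \<zero>\<^bsub>L\<^esub>" by simp
qed

lemma \<Psi>_unital:
  assumes fin: "finite (verts E)"
  shows "\<Psi> \<in> unital_algebra_hom K L Z.twist"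
proof -
  \<comment> \<open>This applies to both \<open>\<phi>\<close> and \<open>\<Psi>\<close>.\<close>
  have fixed: "f \<one>\<^bsub>L\<^esub> = \<one>\<^bsub>L\<^esub>" if f: "abelian_group_hom L L f" "\<And>v. v \<in> verts E \<Longrightarrow> f (vert v) = vert v" for f
  proof -
    have "f \<one>\<^bsub>L\<^esub> = (\<Oplus>\<^bsub>L\<^esub>v\<in>verts E. f (vert v))"
      unfolding one_eq by (rule abelian_group_hom.hom_finsum[OF f(1)]) auto
    also have "\<dots> = \<one>\<^bsub>L\<^esub>" unfolding one_eq by (rule L.M.finsum_cong') (auto simp: f(2))
    finally show ?thesis .
  qed
  have "\<phi> \<one>\<^bsub>L\<^esub> = \<one>\<^bsub>L\<^esub>"
    by (rule fixed[OF algebra_hom_additive[OF graded_algebra_homD(1)[OF Z.\<phi>_graded]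
      L.M.abelian_group_axioms L.M.abelian_group_axioms] fix_vertices])
  then have "is_identity Z.twist \<one>\<^bsub>L\<^esub>"
    by (intro Z.twist_identity one_is_identity[OF fin] one_homog)
  moreover have "\<Psi> \<one>\<^bsub>L\<^esub> = \<one>\<^bsub>L\<^esub>" by (rule fixed[OF \<Psi>_additive]) (simp add: \<Psi>_gen)
  ultimately show ?thesis
    using \<Psi> one_is_identity[OF fin] by (simp add: unital_algebra_hom_def)
qed

end

end

theorem proposition2p2:
  fixes E :: "('v, 'e) pre_digraph"
    and K :: "('k, 'm) ring_scheme"
    and \<phi> :: "(('v, 'e) lpa_generator list \<Rightarrow> 'k) set \<Rightarrow> (('v, 'e) lpa_generator list \<Rightarrow> 'k) set"
  assumes "wf_digraph E" and "field K"
    and "\<phi> \<in> graded_algebra_aut K (leavitt_path_algebra K E)"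
    and "\<forall>v\<in>verts E. \<phi> (lpa_vertex K E v) = lpa_vertex K E v"
  shows "\<exists>\<Psi> \<in> graded_algebra_hom K (leavitt_path_algebra K E)
                 (zhang_twist (leavitt_path_algebra K E) \<phi>).
    inj_on \<Psi> (carrier (leavitt_path_algebra K E)) \<and>
    (\<forall>v\<in>verts E. \<Psi> (lpa_vertex K E v) = lpa_vertex K E v) \<and>
    (\<forall>e\<in>arcs E. \<Psi> (lpa_edge K E e) = lpa_edge K E e) \<and>
    (\<forall>e\<in>arcs E. \<Psi> (lpa_ghost K E e) =
       inv_into (carrier (leavitt_path_algebra K E)) \<phi> (lpa_ghost K E e)) \<and>
    (finite (verts E) \<longrightarrow>
       \<Psi> \<in> unital_algebra_hom K (leavitt_path_algebra K E)
             (zhang_twist (leavitt_path_algebra K E) \<phi>))"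
proof -
  interpret leavitt E K by (intro leavitt.intro assms(1,2))
  interpret leavitt_twist E K \<phi>
    by (intro leavitt_twist.intro zhang_twisted_algebra.intro zhang_twisted_algebra_axioms.intro
        leavitt_twist_axioms.intro leavitt_axioms lpa_graded assms(3))
       (use assms(4) in \<open>simp add: gen_eq\<close>)
  obtain \<Psi> where \<Psi>: "\<Psi> \<in> algebra_hom K L Z.twist" "\<And>x. x \<in> gens \<Longrightarrow> \<Psi> (gen x) = twisted_gen x"
    using lpa_universal_property[OF Z.twist_assoc_algebra twisted_family] by blast
  show ?thesis
    using \<Psi>_graded[OF \<Psi>] \<Psi>_inj[OF \<Psi>] \<Psi>_unital[OF \<Psi>] \<Psi>(2)
    by (intro bexI[of _ \<Psi>]) (auto simp: gen_eq)
qed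

end
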